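(* Let $n\ge 2$ and let $f:\mathbb{R}\to\mathbb{R}$ be Lipschitz and non-increasing. Let $E\subset\partial_\infty\mathbb{H}^n$ be an asymptotic equator, let $\mathcal{C}$ be an asymptotic hemisphere associated to $E$, and let $P$ be the totally geodesic hyperplane with $\partial_\infty P=E$. Let $\Omega\subset\mathbb{H}^n$ be a connected domain with $C^2$ boundary $\Sigma$ such that $\partial_\infty\Sigma=E$ and $\partial_\infty\Omega=\mathcal{C}$. Assume that the overdetermined elliptic problem (OEP) on $\Omega$ associated with $f$ (see context) has a solution $u\in C^2(\overline{\Omega})$. Then $\Omega=P_c^+$ for some $c\in\mathbb{R}$ and $u$ is translating invariant with respect to $P$.
   Context: $\mathbb{H}^n$ is the hyperbolic space of constant curvature $-1$, $d$ its distance, $\partial_\infty\mathbb{H}^n\cong\mathbb{S}^{n-1}$ its ideal boundary, and $\overline{\mathbb{H}^n}=\mathbb{H}^n\cup\partial_\infty\mathbb{H}^n$ its compactification with the ideal (cone) topology. For $A\subset\mathbb{H}^n$, $\partial_\infty A$ is the intersection of $\partial_\infty\mathbb{H}^n$ with the closure of $A$ in $\overline{\mathbb{H}^n}$. An asymptotic equator is a set $E=\partial_\infty P$ with $P$ a totally geodesic hyperplane; $P$ is uniquely determined by $E$. An asymptotic hemisphere associated to $E$ is the closure in $\partial_\infty\mathbb{H}^n$ of a connected component of $\partial_\infty\mathbb{H}^n\setminus E$. With $N$ a unit normal field along $P$ and $c\in\mathbb{R}$, the equidistant hypersurface at (signed) distance $c$ is $P_c=\{\exp_p(cN(p)):p\in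 P\}$, and $P_c^+$ is the connected component of $\mathbb{H}^n\setminus P_c$ with $\partial_\infty P_c^+=\mathcal{C}$. For a unit speed complete geodesic $\gamma$, the hyperbolic translation $\mathcal{L}_\gamma^t$ is the isometry with $\mathcal{L}_\gamma^t(\gamma(s))=\gamma(s+t)$ acting by parallel transport along $\gamma$ on tangent spaces at points of $\gamma$. A function $u$ on $P_c^+$ is translating invariant with respect to $P$ if $u(p)=u(\mathcal{L}_\gamma^t(p))$ for every complete geodesic $\gamma\subset P$, every $t\in\mathbb{R}$ and every $p\in P_c^+$. OEP on $\Omega$ associated with $f$: a solution is a function $u$ such that, for some constants $C$ and $\alpha\le 0$, $\Delta u+f(u)=0$ in $\Omega$; $u>0$ in $\Omega$; $u$ is bounded in $\Omega$; $u=0$ on $\partial\Omega$; $u(p)\to C$ uniformly as $d(p,\partial\Omega)\to+\infty$; and $\langle\nabla u,\vec v\rangle=\alpha$ on $\partial\Omega$, where $\Delta,\nabla,\langle\cdot,\cdot\rangle$ are taken with respect to the hyperbolic metric and $\vec v$ is the unit outward normal vector along $\partial\Omega$. *)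

theory Defs
  imports "HOL-Analysis.Analysis"
begin

text \<open>
  Hyperbolic \<open>n\<close>-space is the Poincare ball model: the open unit ball of a Euclidean space of
  dimension \<open>n\<close> with the metric \<open>conf\<^sup>2\<close> times the Euclidean one, which has constant
  curvature \<open>-1\<close>. Its compactification with the cone topology is then the closed unit ball with
  the Euclidean topology, and its ideal boundary is the unit sphere. Points of the model and tangent
  vectors both have the type \<open>'a\<close>.
\<close>

section \<open>Metric, distance and ideal boundary\<close>

abbreviation hyp :: "'a::euclidean_space set" where
  "hyp \<equiv> ball 0 1"

definition conf :: "'a::euclidean_space \<Rightarrow> real" where
  "conf x = 2 / (1 - (norm x)\<^sup>2)"

definition hinner :: "'a::euclidean_space \<Rightarrow> 'a \<Rightarrow> 'a \<Rightarrow> real" where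
  "hinner x v w = (conf x)\<^sup>2 * (v \<bullet> w)"

definition hnorm :: "'a::euclidean_space \<Rightarrow> 'a \<Rightarrow> real" where
  "hnorm x v = sqrt (hinner x v v)"

definition hdist :: "'a::euclidean_space \<Rightarrow> 'a \<Rightarrow> real" where
  "hdist x y = arcosh (1 + 2 * (dist x y)\<^sup>2 / ((1 - (norm x)\<^sup>2) * (1 - (norm y)\<^sup>2)))"

definition hdist_set :: "'a::euclidean_space \<Rightarrow> 'a set \<Rightarrow> real" where
  "hdist_set p S = (INF q\<in>S. hdist p q)"

definition hclosure :: "'a::euclidean_space set \<Rightarrow> 'a set" where
  "hclosure A = closure A \<inter> hyp"

definition hboundary :: "'a::euclidean_space set \<Rightarrow> 'a set" where
  "hboundary A = frontier A \<inter> hyp"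

definition ideal_boundary :: "'a::euclidean_space set \<Rightarrow> 'a set" where
  "ideal_boundary A = closure A \<inter> sphere 0 1"

section \<open>Gradient, divergence and Laplacian\<close>

definition egrad :: "('a::euclidean_space \<Rightarrow> real) \<Rightarrow> 'a \<Rightarrow> 'a" where
  "egrad u x = (THE D. GDERIV u x :> D)"

text \<open>The metric dual of the differential: \<open>hinner x (hgrad u x) v\<close> is the derivative of \<open>u\<close> at
  \<open>x\<close> in the direction \<open>v\<close>.\<close>

definition hgrad :: "('a::euclidean_space \<Rightarrow> real) \<Rightarrow> 'a \<Rightarrow> 'a" where
  "hgrad u x = (1 / (conf x)\<^sup>2) *\<^sub>R egrad u x"

text \<open>The volume density of the metric is \<open>conf ^ n\<close>.\<close>

definition hdiv :: "('a::euclidean_space \<Rightarrow> 'a) \<Rightarrow> 'a \<Rightarrow> real" where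
  "hdiv X x = (\<Sum>b\<in>Basis. frechet_derivative (\<lambda>y. conf y ^ DIM('a) *\<^sub>R X y) (at x) b \<bullet> b)
                / conf x ^ DIM('a)"

definition hlaplacian :: "('a::euclidean_space \<Rightarrow> real) \<Rightarrow> 'a \<Rightarrow> real" where
  "hlaplacian u = hdiv (hgrad u)"

section \<open>Geodesics, parallel transport and translations\<close>

text \<open>Christoffel form of the Levi-Civita connection: for a metric \<open>exp (2 * \<phi>)\<close> times the Euclidean
  one it is \<open>(v \<bullet> grad \<phi>) w + (w \<bullet> grad \<phi>) v - (v \<bullet> w) grad \<phi>\<close>, and for
  \<open>\<phi> = ln conf\<close> the Euclidean gradient of \<open>\<phi>\<close> at \<open>x\<close> is \<open>conf x *\<^sub>R x\<close>.\<close>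

definition christoffel :: "'a::euclidean_space \<Rightarrow> 'a \<Rightarrow> 'a \<Rightarrow> 'a" where
  "christoffel x v w = conf x *\<^sub>R ((x \<bullet> v) *\<^sub>R w + (x \<bullet> w) *\<^sub>R v - (v \<bullet> w) *\<^sub>R x)"

definition velocity :: "(real \<Rightarrow> 'a::euclidean_space) \<Rightarrow> real \<Rightarrow> 'a" where
  "velocity \<gamma> s = vector_derivative \<gamma> (at s)"

text \<open>The covariant derivative of \<open>V\<close> along \<open>\<gamma>\<close> is the ordinary derivative plus the Christoffel term;
  parallel means that it vanishes.\<close>

definition parallel_along :: "(real \<Rightarrow> 'a::euclidean_space) \<Rightarrow> (real \<Rightarrow> 'a) \<Rightarrow> bool" where
  "parallel_along \<gamma> V \<longleftrightarrow>
     (\<forall>s. (V has_vector_derivative - christoffel (\<gamma> s) (velocity \<gamma> s) (V s)) (at s))"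

definition complete_geodesic :: "(real \<Rightarrow> 'a::euclidean_space) \<Rightarrow> bool" where
  "complete_geodesic \<gamma> \<longleftrightarrow>
     (\<forall>s. \<gamma> s \<in> hyp \<and> \<gamma> differentiable (at s)) \<and> parallel_along \<gamma> (velocity \<gamma>)"

definition unit_speed_geodesic :: "(real \<Rightarrow> 'a::euclidean_space) \<Rightarrow> bool" where
  "unit_speed_geodesic \<gamma> \<longleftrightarrow>
     complete_geodesic \<gamma> \<and> (\<forall>s. hnorm (\<gamma> s) (velocity \<gamma> s) = 1)"

definition hexp :: "'a::euclidean_space \<Rightarrow> 'a \<Rightarrow> 'a" where
  "hexp p v = (THE q. \<exists>\<gamma>. complete_geodesic \<gamma> \<and> \<gamma> 0 = p \<and> velocity \<gamma> 0 = v \<and> \<gamma> 1 = q)"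

definition hyp_isometry :: "('a::euclidean_space \<Rightarrow> 'a) \<Rightarrow> bool" where
  "hyp_isometry L \<longleftrightarrow>
     bij_betw L hyp hyp \<and> (\<forall>p\<in>hyp. \<forall>q\<in>hyp. hdist (L p) (L q) = hdist p q)"

definition is_hyp_translation ::
    "(real \<Rightarrow> 'a::euclidean_space) \<Rightarrow> real \<Rightarrow> ('a \<Rightarrow> 'a) \<Rightarrow> bool" where
  "is_hyp_translation \<gamma> t L \<longleftrightarrow>
     hyp_isometry L \<and> (\<forall>s. L (\<gamma> s) = \<gamma> (s + t)) \<and>
     (\<forall>s. \<exists>L'. (L has_derivative L') (at (\<gamma> s)) \<and>
          (\<forall>V. parallel_along \<gamma> V \<longrightarrow> L' (V s) = V (s + t)))"

text \<open>For a unit speed complete geodesic the translation is unique on \<open>hyp\<close>; its values elsewhere are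
  irrelevant, hence \<open>SOME\<close> instead of \<open>THE\<close>.\<close>

definition hyp_translation :: "(real \<Rightarrow> 'a::euclidean_space) \<Rightarrow> real \<Rightarrow> 'a \<Rightarrow> 'a" where
  "hyp_translation \<gamma> t = (SOME L. is_hyp_translation \<gamma> t L)"

definition translating_invariant ::
    "'a::euclidean_space set \<Rightarrow> 'a set \<Rightarrow> ('a \<Rightarrow> real) \<Rightarrow> bool" where
  "translating_invariant P D u \<longleftrightarrow>
     (\<forall>\<gamma>. unit_speed_geodesic \<gamma> \<and> range \<gamma> \<subseteq> P \<longrightarrow>
        (\<forall>t. \<forall>p\<in>D. u p = u (hyp_translation \<gamma> t p)))"

section \<open>Hypersurfaces and domains of class \<open>C\<^sup>2\<close>\<close>

definition C2_on :: "'a::euclidean_space set \<Rightarrow> ('a \<Rightarrow> real) \<Rightarrow> bool" where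
  "C2_on U \<phi> \<longleftrightarrow>
     (\<exists>G H. (\<forall>x\<in>U. GDERIV \<phi> x :> G x \<and> (G has_derivative blinfun_apply (H x)) (at x)) \<and>
            continuous_on U H)"

definition regular_C2_on :: "'a::euclidean_space set \<Rightarrow> ('a \<Rightarrow> real) \<Rightarrow> bool" where
  "regular_C2_on U \<phi> \<longleftrightarrow> open U \<and> U \<subseteq> hyp \<and> C2_on U \<phi> \<and> (\<forall>x\<in>U. egrad \<phi> x \<noteq> 0)"

definition C2_hypersurface :: "'a::euclidean_space set \<Rightarrow> bool" where
  "C2_hypersurface S \<longleftrightarrow>
     S \<subseteq> hyp \<and>
     (\<forall>p\<in>S. \<exists>U \<phi>. p \<in> U \<and> regular_C2_on U \<phi> \<and> S \<inter> U = {x \<in> U. \<phi> x = 0})"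

text \<open>Near each of its boundary points the domain lies on one side of its boundary.\<close>

definition C2_domain :: "'a::euclidean_space set \<Rightarrow> bool" where
  "C2_domain \<Omega> \<longleftrightarrow>
     open \<Omega> \<and> connected \<Omega> \<and> \<Omega> \<noteq> {} \<and> \<Omega> \<subseteq> hyp \<and>
     (\<forall>p\<in>hboundary \<Omega>. \<exists>U \<phi>. p \<in> U \<and> regular_C2_on U \<phi> \<and>
        \<Omega> \<inter> U = {x \<in> U. \<phi> x < 0} \<and> hboundary \<Omega> \<inter> U = {x \<in> U. \<phi> x = 0})"

text \<open>The derivatives of \<open>u\<close> up to order two extend continuously from \<open>\<Omega>\<close> to its closure in
  \<open>hyp\<close>; \<open>G\<close> and \<open>H\<close> are the extended gradient and Hessian.\<close>

definition C2_upto_boundary :: "'a::euclidean_space set \<Rightarrow> ('a \<Rightarrow> real) \<Rightarrow> bool" where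
  "C2_upto_boundary \<Omega> u \<longleftrightarrow>
     continuous_on (hclosure \<Omega>) u \<and>
     (\<exists>G H. (\<forall>x\<in>\<Omega>. GDERIV u x :> G x \<and> (G has_derivative blinfun_apply (H x)) (at x)) \<and>
            continuous_on (hclosure \<Omega>) G \<and> continuous_on (hclosure \<Omega>) H)"

definition tangent_space :: "'a::euclidean_space set \<Rightarrow> 'a \<Rightarrow> 'a set" where
  "tangent_space S p =
     {v. \<exists>c :: real \<Rightarrow> 'a. (\<forall>t. c t \<in> S) \<and> c 0 = p \<and> (c has_vector_derivative v) (at 0)}"

definition unit_normal_at :: "'a::euclidean_space set \<Rightarrow> 'a \<Rightarrow> 'a \<Rightarrow> bool" where
  "unit_normal_at S p v \<longleftrightarrow> hnorm p v = 1 \<and> (\<forall>w\<in>tangent_space S p. hinner p v w = 0)"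

definition unit_normal_field :: "'a::euclidean_space set \<Rightarrow> ('a \<Rightarrow> 'a) \<Rightarrow> bool" where
  "unit_normal_field S N \<longleftrightarrow> continuous_on S N \<and> (\<forall>p\<in>S. unit_normal_at S p (N p))"

definition outward_unit_normal :: "'a::euclidean_space set \<Rightarrow> 'a \<Rightarrow> 'a \<Rightarrow> bool" where
  "outward_unit_normal \<Omega> p v \<longleftrightarrow>
     unit_normal_at (hboundary \<Omega>) p v \<and> (\<forall>\<^sub>F t in at_right 0. p + t *\<^sub>R v \<notin> closure \<Omega>)"

section \<open>Hyperplanes, equators, hemispheres and equidistant hypersurfaces\<close>

text \<open>A connected hypersurface that is complete and totally geodesic: every geodesic of the ambient
  space that starts tangentially to \<open>P\<close> stays in \<open>P\<close> for all times.\<close>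

definition totally_geodesic_hyperplane :: "'a::euclidean_space set \<Rightarrow> bool" where
  "totally_geodesic_hyperplane P \<longleftrightarrow>
     P \<noteq> {} \<and> connected P \<and> C2_hypersurface P \<and>
     (\<forall>\<gamma>. complete_geodesic \<gamma> \<and> \<gamma> 0 \<in> P \<and> velocity \<gamma> 0 \<in> tangent_space P (\<gamma> 0) \<longrightarrow>
        range \<gamma> \<subseteq> P)"

definition asymptotic_equator :: "'a::euclidean_space set \<Rightarrow> bool" where
  "asymptotic_equator E \<longleftrightarrow> (\<exists>P. totally_geodesic_hyperplane P \<and> E = ideal_boundary P)"

definition asymptotic_hemisphere :: "'a::euclidean_space set \<Rightarrow> 'a set \<Rightarrow> bool" where
  "asymptotic_hemisphere E \<C> \<longleftrightarrow> (\<exists>K\<in>components (sphere 0 1 - E). \<C> = closure K)"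

definition equidistant ::
    "'a::euclidean_space set \<Rightarrow> ('a \<Rightarrow> 'a) \<Rightarrow> real \<Rightarrow> 'a set" where
  "equidistant P N c = (\<lambda>p. hexp p (c *\<^sub>R N p)) ` P"

definition equidistant_side ::
    "'a::euclidean_space set \<Rightarrow> ('a \<Rightarrow> 'a) \<Rightarrow> 'a set \<Rightarrow> real \<Rightarrow> 'a set" where
  "equidistant_side P N \<C> c =
     (THE D. D \<in> components (hyp - equidistant P N c) \<and> ideal_boundary D = \<C>)"

section \<open>The overdetermined elliptic problem\<close>

text \<open>The gradient of \<open>u\<close> at a boundary point is the limit of the gradient from inside \<open>\<Omega>\<close>.\<close>

definition OEP_solution ::
    "(real \<Rightarrow> real) \<Rightarrow> 'a::euclidean_space set \<Rightarrow> ('a \<Rightarrow> real) \<Rightarrow> bool" where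
  "OEP_solution f \<Omega> u \<longleftrightarrow>
     (\<exists>C \<alpha>. \<alpha> \<le> 0 \<and>
       (\<forall>x\<in>\<Omega>. hlaplacian u x + f (u x) = 0) \<and>
       (\<forall>x\<in>\<Omega>. u x > 0) \<and>
       bounded (u ` \<Omega>) \<and>
       (\<forall>x\<in>hboundary \<Omega>. u x = 0) \<and>
       (\<forall>\<epsilon>>0. \<exists>R. \<forall>p\<in>\<Omega>. hdist_set p (hboundary \<Omega>) > R \<longrightarrow> \<bar>u p - C\<bar> < \<epsilon>) \<and>
       (\<forall>p\<in>hboundary \<Omega>. \<forall>v. outward_unit_normal \<Omega> p v \<longrightarrow>
          hinner p (Lim (at p within \<Omega>) (hgrad u)) v = \<alpha>))"

end

theory Submission
  imports Defs
begin

text \<open>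
  The boundary value problem is compared with its images under isometries that push the hemisphere \<open>\<C>\<close> into itself.

  In the hyperboloid model the hyperplane \<open>P\<close> is the zero set of a linear form, the product with a unit spacelike
  vector \<open>M\<close>; the value of this form at a point is its height over \<open>P\<close>, the hyperbolic sine of the signed distance.
  Let \<open>L\<close> be an isometry that maps the closed hemisphere into its interior and \<open>\<Omega>\<close> into \<open>\<Omega>\<close>. Since \<open>f\<close> is
  non-increasing, the maximum principle gives \<open>u \<le> u \<circ> L\<close> on \<open>\<Omega>\<close> (\<open>comparison\<close>). The domain is not compact: on the ideal
  boundary off the equator \<open>u\<close> and \<open>u \<circ> L\<close> tend to the same constant, and at the equator, where \<open>u\<close> is only bounded, a
  positive strictly superharmonic function that is infinite there takes care (\<open>barrier_superharmonic\<close>).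

  Take for \<open>L\<close> an isometry \<open>g\<close> that fixes \<open>M\<close>, followed by the translation by \<open>t\<close> along a geodesic orthogonal to \<open>P\<close>.
  For large \<open>t\<close> it moves \<open>\<Omega>\<close> close to an interior point of the hemisphere, hence into \<open>\<Omega>\<close>. Decrease \<open>t\<close>. At a first
  contact of the image with the boundary the two solutions would have the same normal derivative \<open>\<alpha>\<close>, which
  contradicts the Hopf lemma (\<open>no_contact\<close>); here \<open>f\<close> is required to be Lipschitz. The contact cannot
  escape to infinity because for \<open>t > 0\<close> the ideal boundaries are disjoint. So \<open>\<Omega>\<close> is mapped into itself for all
  \<open>t > 0\<close> (\<open>shift_inside\<close>), and in the limit \<open>g\<close> maps \<open>\<Omega>\<close> into itself with \<open>u \<le> u \<circ> g\<close>. Two points of the same height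
  are exchanged by a reflection \<open>g\<close>, so \<open>\<Omega>\<close> and \<open>u\<close> depend on the height only (\<open>same_height\<close>), and \<open>\<Omega>\<close> consists of
  the points above some height (\<open>Omega_height\<close>).

  It remains to match the differential geometric notions with these coordinates. A complete connected totally geodesic
  hypersurface is the zero set of a linear form (\<open>totally_geodesic_hyperplane_is_plane\<close>), the equidistant
  hypersurfaces are the level sets of the height (\<open>equidistant_level\<close>), and translations along geodesics in \<open>P\<close>
  preserve it (\<open>translation_preserves_height\<close>).
\<close>

section \<open>The hyperboloid\<close>

text \<open>The Lorentz form on \<open>'a \<times> real\<close>, where the second component is time.\<close>

definition mink :: "'a::euclidean_space \<times> real \<Rightarrow> 'a \<times> real \<Rightarrow> real" where
  "mink X Y = fst X \<bullet> fst Y - snd X * snd Y"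

lemma mink_commute: "mink X Y = mink Y X"
  by (simp add: mink_def inner_commute mult.commute)

lemma mink_add_left: "mink (X + Y) Z = mink X Z + mink Y Z"
  and mink_add_right: "mink Z (X + Y) = mink Z X + mink Z Y"
  and mink_diff_left: "mink (X - Y) Z = mink X Z - mink Y Z"
  and mink_diff_right: "mink Z (X - Y) = mink Z X - mink Z Y"
  and mink_scale_left: "mink (r *\<^sub>R X) Z = r * mink X Z"
  and mink_scale_right: "mink Z (r *\<^sub>R X) = r * mink Z X"
  and mink_minus_left: "mink (- X) Z = - mink X Z"
  and mink_minus_right: "mink Z (- X) = - mink Z X"
  and mink_zero_left: "mink 0 Z = 0"
  and mink_zero_right: "mink Z 0 = 0"
  by (simp_all add: mink_def algebra_simps inner_simps)

lemmas mink_simps = mink_add_left mink_add_right mink_diff_left mink_diff_right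
  mink_scale_left mink_scale_right mink_minus_left mink_minus_right mink_zero_left mink_zero_right

lemma tendsto_mink [tendsto_intros]:
  assumes "(f \<longlongrightarrow> a) F" "(g \<longlongrightarrow> b) F"
  shows "((\<lambda>x. mink (f x) (g x)) \<longlongrightarrow> mink a b) F"
  unfolding mink_def by (intro tendsto_intros assms)

lemma continuous_on_mink [continuous_intros]:
  assumes "continuous_on S f" "continuous_on S g"
  shows "continuous_on S (\<lambda>x. mink (f x) (g x))"
  unfolding mink_def by (intro continuous_intros assms)

lemma has_real_derivative_mink_left:
  assumes "(f has_vector_derivative f') F"
  shows "((\<lambda>x. mink (f x) Y) has_real_derivative mink f' Y) F"
proof -
  have "bounded_linear (\<lambda>X. mink X Y)"
    by (rule linear_conv_bounded_linear[THEN iffD1], rule linearI) (simp_all only: mink_simps real_scaleR_def)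
  from bounded_linear.has_vector_derivative[OF this assms]
  show ?thesis by (simp add: has_real_derivative_iff_has_vector_derivative)
qed

lemma has_real_derivative_mink_right:
  assumes "(f has_vector_derivative f') F"
  shows "((\<lambda>x. mink Y (f x)) has_real_derivative mink Y f') F"
  using has_real_derivative_mink_left[OF assms] by (simp add: mink_commute)

lemma mink_self: "mink X X = (norm (fst X))\<^sup>2 - (snd X)\<^sup>2"
  by (simp add: mink_def power2_norm_eq_inner) (simp add: power2_eq_square)

lemma mink_nondegenerate:
  assumes "\<And>Y. mink X Y = 0" shows "X = 0"
proof -
  have "mink X (fst X, - snd X) = norm (fst X)^2 + (snd X)^2"
    by (simp add: mink_def dot_square_norm power2_eq_square[of "snd X"])
  then have "norm (fst X)^2 + (snd X)^2 = 0" using assms by simp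
  then show ?thesis by (simp add: sum_power2_eq_zero_iff prod_eq_iff)
qed

definition hyperboloid :: "('a::euclidean_space \<times> real) set" where
  "hyperboloid = {X. mink X X = -1 \<and> 0 < snd X}"

text \<open>The solid future cone without its apex. It contains the hyperboloid and the null vectors that represent
  ideal points.\<close>

definition future :: "('a::euclidean_space \<times> real) set" where
  "future = {X. mink X X \<le> 0 \<and> 0 < snd X}"

lemma hyperboloid_future: "X \<in> hyperboloid \<Longrightarrow> X \<in> future"
  by (auto simp: hyperboloid_def future_def)

text \<open>The reversed Cauchy-Schwarz inequality for causal vectors of the same time orientation.\<close>

lemma mink_future_neg:
  assumes "X \<in> hyperboloid" "Y \<in> future"
  shows "mink X Y < 0"
proof -
  have x: "norm (fst X)^2 < (snd X)^2" "0 < snd X"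
    using assms(1) by (auto simp: hyperboloid_def mink_self)
  have y: "norm (fst Y)^2 \<le> (snd Y)^2" "0 < snd Y"
    using assms(2) by (auto simp: future_def mink_self)
  have nx: "norm (fst X) < snd X" using x by (simp add: power_less_imp_less_base)
  have ny: "norm (fst Y) \<le> snd Y" using y by (simp add: power_mono_iff)
  have "fst X \<bullet> fst Y \<le> norm (fst X) * norm (fst Y)" by (rule norm_cauchy_schwarz)
  also have "\<dots> \<le> norm (fst X) * snd Y" using ny by (simp add: mult_left_mono)
  also have "\<dots> < snd X * snd Y" using nx y(2) by simp
  finally show ?thesis by (simp add: mink_def)
qed

lemma futureI:
  assumes "X \<in> hyperboloid" "mink X Y < 0" "mink Y Y \<le> 0"
  shows "Y \<in> future"
proof (rule ccontr)
  assume "Y \<notin> future"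
  then have s: "snd Y \<le> 0" using assms(3) by (auto simp: future_def)
  show False
  proof (cases "snd Y = 0")
    case True
    then have "Y = 0" using assms(3) by (auto simp: mink_self prod_eq_iff)
    then show False using assms(2) by (simp add: mink_simps)
  next
    case False
    then have "- Y \<in> future" using s assms(3) by (auto simp: future_def mink_simps)
    from mink_future_neg[OF assms(1) this] show False using assms(2) by (simp add: mink_simps)
  qed
qed

lemma hyperboloidI:
  assumes "X \<in> hyperboloid" "mink X Y < 0" "mink Y Y = -1"
  shows "Y \<in> hyperboloid"
  using futureI[OF assms(1,2)] assms(3) by (auto simp: hyperboloid_def future_def)

text \<open>Both claims follow from an identity that writes a multiple of \<open>- mink X Y - 1\<close> as a sum of squares.\<close>

lemma mink_hyperboloid_le:
  assumes "X \<in> hyperboloid" "Y \<in> hyperboloid"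
  shows "mink X Y \<le> -1" and "mink X Y = -1 \<Longrightarrow> X = Y"
proof -
  have x: "norm (fst X)^2 + 1 = (snd X)^2" "0 < snd X"
    using assms(1) by (auto simp: hyperboloid_def mink_self)
  have y: "norm (fst Y)^2 + 1 = (snd Y)^2" "0 < snd Y"
    using assms(2) by (auto simp: hyperboloid_def mink_self)
  have id: "norm (snd X *\<^sub>R fst Y - snd Y *\<^sub>R fst X)^2
      = snd X^2 * norm (fst Y)^2 + snd Y^2 * norm (fst X)^2 - 2 * (snd X * snd Y) * (fst X \<bullet> fst Y)"
    unfolding power2_norm_eq_inner
    by (simp add: inner_simps inner_commute algebra_simps power2_eq_square)
  have nX: "norm (fst X)^2 = (snd X)^2 - 1" and nY: "norm (fst Y)^2 = (snd Y)^2 - 1"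
    using x y by auto
  define m where "m = - mink X Y"
  have fxy: "fst X \<bullet> fst Y = snd X * snd Y - m" by (simp add: m_def mink_def)
  have id2: "norm (snd X *\<^sub>R fst Y - snd Y *\<^sub>R fst X)^2 =
    2 * (snd X * snd Y) * (m - 1) - (snd X - snd Y)^2"
    unfolding id nX nY fxy by (simp add: power2_eq_square algebra_simps)
  then have "0 \<le> 2 * (snd X * snd Y) * (m - 1) - (snd X - snd Y)^2"
    by (metis zero_le_power2)
  then have "0 \<le> 2 * (snd X * snd Y) * (m - 1)"
    using zero_le_power2[of "snd X - snd Y"] by linarith
  moreover have "0 < 2 * (snd X * snd Y)" using x(2) y(2) by simp
  ultimately have "0 \<le> m - 1" by (simp add: zero_le_mult_iff)
  then show "mink X Y \<le> -1" by (simp add: m_def)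
  assume "mink X Y = -1"
  then have "m = 1" by (simp add: m_def)
  then have 0: "norm (snd X *\<^sub>R fst Y - snd Y *\<^sub>R fst X)^2 + (snd X - snd Y)^2 = 0"
    using id2 by simp
  then have "snd X = snd Y" "snd X *\<^sub>R fst Y - snd Y *\<^sub>R fst X = 0"
    by (auto simp: sum_power2_eq_zero_iff)
  then show "X = Y" using x(2) by (auto simp: prod_eq_iff)
qed

lemma boost_in_hyperboloid:
  assumes "X \<in> hyperboloid" "mink X V = 0" "mink V V = 1"
  shows "cosh s *\<^sub>R X + sinh s *\<^sub>R V \<in> hyperboloid"
proof (rule hyperboloidI[OF assms(1)])
  have xx: "mink X X = -1" using assms(1) by (simp add: hyperboloid_def)
  show "mink X (cosh s *\<^sub>R X + sinh s *\<^sub>R V) < 0"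
    using assms(2) xx by (simp add: mink_simps cosh_real_pos)
  show "mink (cosh s *\<^sub>R X + sinh s *\<^sub>R V) (cosh s *\<^sub>R X + sinh s *\<^sub>R V) = - 1"
    using assms(2,3) xx cosh_square_eq[of s] mink_commute[of X V]
    by (simp add: mink_simps power2_eq_square)
qed

text \<open>\<open>lift\<close> and its inverse \<open>proj\<close> are the stereographic projection between the Poincare ball and the
  hyperboloid. The vector \<open>conevec x\<close> is the multiple of \<open>lift x\<close> by \<open>1 - (norm x)\<^sup>2\<close>; it stays bounded at the unit
  sphere, where it is a null vector that represents an ideal point.\<close>

definition lift :: "'a::euclidean_space \<Rightarrow> 'a \<times> real" where
  "lift x = (conf x *\<^sub>R x, conf x - 1)"

definition proj :: "'a::euclidean_space \<times> real \<Rightarrow> 'a" where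
  "proj X = (1 / (1 + snd X)) *\<^sub>R fst X"

definition conevec :: "'a::euclidean_space \<Rightarrow> 'a \<times> real" where
  "conevec x = (2 *\<^sub>R x, 1 + (norm x)\<^sup>2)"

lemma hyp_norm: "x \<in> hyp \<Longrightarrow> 0 < 1 - (norm x)\<^sup>2"
  by (auto simp: abs_square_less_1)

lemma conf_pos: "x \<in> hyp \<Longrightarrow> 0 < conf x"
  using hyp_norm[of x] by (simp add: conf_def)

lemma conf_ge2: "x \<in> hyp \<Longrightarrow> 2 \<le> conf x"
  using hyp_norm[of x] by (simp add: conf_def field_simps)

lemma conf_norm: "x \<in> hyp \<Longrightarrow> conf x * (x \<bullet> x) = conf x - 2"
  using hyp_norm[of x] by (simp add: conf_def field_simps power2_norm_eq_inner)

lemma conf_norm': "x \<in> hyp \<Longrightarrow> conf x * (1 - (norm x)^2) = 2"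
  using hyp_norm[of x] by (metis conf_def less_irrefl nonzero_divide_eq_eq)

lemma conevec_lift: "x \<in> hyp \<Longrightarrow> conevec x = (1 - (norm x)^2) *\<^sub>R lift x"
proof -
  assume x: "x \<in> hyp"
  have "(1 - (norm x)\<^sup>2) * conf x = 2" using conf_norm'[OF x] by (simp add: mult.commute)
  then show ?thesis
    by (simp add: conevec_def lift_def right_diff_distrib)
qed

lemma mink_conevec: "mink (conevec x) (conevec x) = - ((1 - (norm x)\<^sup>2)\<^sup>2)"
 
  by (simp add: mink_self conevec_def power2_eq_square algebra_simps)

lemma conevec_future: "x \<in> cball 0 1 \<Longrightarrow> conevec x \<in> future"
  by (simp add: future_def mink_conevec) (simp add: conevec_def add_pos_nonneg)

lemma lift_hyperboloid: "x \<in> hyp \<Longrightarrow> lift x \<in> hyperboloid"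
proof -
  assume x: "x \<in> hyp"
  have "conf x * conf x * (x \<bullet> x) = conf x * (conf x - 2)"
    by (simp only: mult.assoc conf_norm[OF x])
  then show ?thesis using conf_ge2[OF x]
    by (simp add: hyperboloid_def mink_def lift_def algebra_simps)
qed

lemma mink_lift_lift [simp]: "x \<in> hyp \<Longrightarrow> mink (lift x) (lift x) = -1"
  using lift_hyperboloid[of x] by (simp add: hyperboloid_def)

lemma proj_lift: "x \<in> hyp \<Longrightarrow> proj (lift x) = x"
  using conf_pos[of x] by (simp add: proj_def lift_def)

lemma proj_hyp:
  assumes "X \<in> hyperboloid" shows "proj X \<in> hyp"
proof -
  have x: "norm (fst X)^2 < (snd X)^2" "0 < snd X"
    using assms(1) by (auto simp: hyperboloid_def mink_self)
  have "norm (fst X) < snd X" using x by (simp add: power_less_imp_less_base)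
  then show ?thesis using x(2) by (simp add: proj_def)
qed

lemma conf_proj:
  assumes "X \<in> hyperboloid" shows "conf (proj X) = 1 + snd X"
proof -
  have x: "norm (fst X)^2 = (snd X)^2 - 1" "0 < snd X"
    using assms(1) by (auto simp: hyperboloid_def mink_self)
  have "(norm (proj X))^2 = ((snd X)^2 - 1) / (1 + snd X)^2"
    using x by (simp add: proj_def power_divide)
  also have "(snd X)\<^sup>2 - 1 = (snd X - 1) * (1 + snd X)"
    by (simp add: power2_eq_square algebra_simps)
  also have "(snd X - 1) * (1 + snd X) / (1 + snd X)\<^sup>2 = (snd X - 1) / (1 + snd X)"
    using x(2) by (simp add: power2_eq_square)
  finally have "1 - (norm (proj X))\<^sup>2 = 2 / (1 + snd X)"
    using x(2) by (simp add: field_simps)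
  then show ?thesis using x(2) by (simp add: conf_def)
qed

lemma lift_proj:
  assumes "X \<in> hyperboloid" shows "lift (proj X) = X"
  unfolding lift_def conf_proj[OF assms] using assms
  by (simp add: proj_def hyperboloid_def prod_eq_iff)

lemma lift_inj: "x \<in> hyp \<Longrightarrow> y \<in> hyp \<Longrightarrow> lift x = lift y \<Longrightarrow> x = y"
  by (metis proj_lift)

lemma hdist_lift:
  assumes "x \<in> hyp" "y \<in> hyp"
  shows "hdist x y = arcosh (- mink (lift x) (lift y))"
proof -
  define p q where "p = 1 - (norm x)\<^sup>2" and "q = 1 - (norm y)\<^sup>2"
  have p: "0 < p" "0 < q" unfolding p_def q_def using hyp_norm assms by blast+
  have d: "(dist x y)\<^sup>2 = (1 - p) + (1 - q) - 2 * (x \<bullet> y)"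
    by (simp add: p_def q_def dist_norm power2_norm_eq_inner inner_simps inner_commute)
  have "1 + 2 * (dist x y)\<^sup>2 / (p * q) = (2 / p - 1) * (2 / q - 1) - (2 / p) * (2 / q) * (x \<bullet> y)"
    unfolding d using p by (simp add: field_simps)
  then have "1 + 2 * (dist x y)\<^sup>2 / (p * q) = - mink (lift x) (lift y)"
    by (simp add: mink_def lift_def conf_def p_def q_def)
  then show ?thesis by (simp add: hdist_def p_def q_def)
qed

text \<open>Up to the conformal factor this is the differential of \<open>lift\<close>: a linear isometry from the Euclidean space of
  directions at \<open>x\<close> onto the Minkowski complement of \<open>lift x\<close>. The inverse is \<open>coframe x\<close>.\<close>

definition frame :: "'a::euclidean_space \<Rightarrow> 'a \<Rightarrow> 'a \<times> real" where
  "frame x v = ((conf x * (x \<bullet> v)) *\<^sub>R x + v, conf x * (x \<bullet> v))"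

definition coframe :: "'a::euclidean_space \<Rightarrow> 'a \<times> real \<Rightarrow> 'a" where
  "coframe x Y = fst Y - snd Y *\<^sub>R x"

lemma frame_linear: "linear (frame x)"
  by (rule linearI) (auto simp: frame_def algebra_simps inner_simps)

lemma coframe_linear: "linear (coframe x)"
  by (rule linearI) (auto simp: coframe_def algebra_simps)

lemma frame_scale: "frame x (r *\<^sub>R v) = r *\<^sub>R frame x v"
  by (simp add: frame_def algebra_simps)

lemma mink_frame: "x \<in> hyp \<Longrightarrow> mink (frame x v) (frame x w) = v \<bullet> w"
proof -
  assume x: "x \<in> hyp"
  have "mink (frame x v) (frame x w) = v \<bullet> w +
     conf x * (x \<bullet> v) * (x \<bullet> w) * (conf x * (x \<bullet> x) + 2 - conf x)"
    by (simp add: mink_def frame_def inner_simps inner_commute algebra_simps)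
  then show ?thesis using conf_norm[OF x] by simp
qed

lemma mink_lift_frame: "x \<in> hyp \<Longrightarrow> mink (lift x) (frame x v) = 0"
proof -
  assume x: "x \<in> hyp"
  have "mink (lift x) (frame x v) = conf x * (x \<bullet> v) * (conf x * (x \<bullet> x) + 2 - conf x)"
    by (simp add: mink_def lift_def frame_def inner_simps inner_commute algebra_simps)
  then show ?thesis using conf_norm[OF x] by simp
qed

lemma coframe_frame: "coframe x (frame x v) = v"
  by (simp add: frame_def coframe_def)

lemma frame_coframe:
  assumes x: "x \<in> hyp" and Y: "mink (lift x) Y = 0"
  shows "frame x (coframe x Y) = Y"
proof -
  have "conf x * (x \<bullet> coframe x Y) = conf x * (x \<bullet> fst Y) - snd Y * (conf x * (x \<bullet> x))"
    by (simp add: coframe_def inner_simps algebra_simps)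
  also have "\<dots> = snd Y"
    using Y by (simp add: conf_norm[OF x] mink_def lift_def algebra_simps)
  finally show ?thesis by (simp add: frame_def coframe_def prod_eq_iff)
qed

lemma coframe_inner:
  assumes "x \<in> hyp" "mink (lift x) Y = 0" "mink (lift x) Z = 0"
  shows "coframe x Y \<bullet> coframe x Z = mink Y Z"
  using mink_frame[OF assms(1), of "coframe x Y" "coframe x Z"] assms by (simp add: frame_coframe)

section \<open>Lorentz transformations\<close>

definition lorentz :: "('a::euclidean_space \<times> real \<Rightarrow> 'a \<times> real) \<Rightarrow> bool" where
  "lorentz A \<longleftrightarrow> linear A \<and> (\<forall>X Y. mink (A X) (A Y) = mink X Y) \<and> (\<forall>X\<in>future. A X \<in> future)"

text \<open>Time orientation has to be tested at a single point, by the reversed Cauchy-Schwarz inequality.\<close>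

lemma lorentzI:
  assumes "linear A" "\<And>X Y. mink (A X) (A Y) = mink X Y"
    and "X \<in> hyperboloid" "A X \<in> hyperboloid"
  shows "lorentz A"
  unfolding lorentz_def
proof (intro conjI allI ballI)
  fix Z :: "'a \<times> real" assume Z: "Z \<in> future"
  show "A Z \<in> future"
  proof (rule futureI[OF assms(4)])
    show "mink (A X) (A Z) < 0" using mink_future_neg[OF assms(3) Z] assms(2) by simp
    show "mink (A Z) (A Z) \<le> 0" using Z assms(2) by (simp add: future_def)
  qed
qed (use assms in auto)

lemma lorentz_linear: "lorentz A \<Longrightarrow> linear A"
  and lorentz_mink: "lorentz A \<Longrightarrow> mink (A X) (A Y) = mink X Y"
  and lorentz_future: "lorentz A \<Longrightarrow> X \<in> future \<Longrightarrow> A X \<in> future"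
  by (simp_all add: lorentz_def del: split_paired_All)

lemma lorentz_hyperboloid: "lorentz A \<Longrightarrow> X \<in> hyperboloid \<Longrightarrow> A X \<in> hyperboloid"
  using lorentz_future[of A X] by (auto simp: hyperboloid_future) 
    (simp add: hyperboloid_def future_def lorentz_mink)

lemma lorentz_compose: "lorentz A \<Longrightarrow> lorentz B \<Longrightarrow> lorentz (A \<circ> B)"
  by (simp add: lorentz_def linear_compose del: split_paired_All)

lemma hyperboloid_nonempty: "(0, 1) \<in> hyperboloid"
  by (simp add: hyperboloid_def mink_def)

lemma lorentz_inverse:
  assumes A: "lorentz A"
  shows "\<exists>B. lorentz B \<and> (\<forall>X. B (A X) = X) \<and> (\<forall>X. A (B X) = X)"
proof -
  have "X = 0" if "A X = 0" for X
    by (rule mink_nondegenerate) (metis A lorentz_mink mink_zero_left that)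
  then have inj: "inj A" using lorentz_linear[OF A] by (simp add: linear_injective_0)
  have surj: "surj A" using inj lorentz_linear[OF A] by (simp add: linear_injective_imp_surjective)
  define B where "B = inv A"
  have B: "linear B" unfolding B_def by (rule inj_linear_imp_inv_linear[OF lorentz_linear[OF A] inj])
  have BA: "B (A X) = X" and AB: "A (B X) = X" for X
    using inj surj by (simp_all add: B_def surj_f_inv_f)
  have "lorentz B"
  proof (rule lorentzI[OF B])
    show "mink (B X) (B Y) = mink X Y" for X Y using lorentz_mink[OF A, of "B X" "B Y"] by (simp add: AB)
    show "A (0,1) \<in> hyperboloid" using lorentz_hyperboloid[OF A hyperboloid_nonempty] .
    show "B (A (0,1)) \<in> hyperboloid" by (simp add: BA hyperboloid_nonempty)
  qed
  with BA AB show ?thesis by blast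
qed

text \<open>The hyperbolic rotation by \<open>t\<close> in the plane of \<open>T\<close> and \<open>V\<close>. It is the identity on the complement of this
  plane.\<close>

definition boost :: "'a::euclidean_space \<times> real \<Rightarrow> 'a \<times> real \<Rightarrow> real \<Rightarrow> 'a \<times> real \<Rightarrow> 'a \<times> real" where
  "boost T V t Z = Z - mink Z T *\<^sub>R ((cosh t - 1) *\<^sub>R T + sinh t *\<^sub>R V)
                     + mink Z V *\<^sub>R (sinh t *\<^sub>R T + (cosh t - 1) *\<^sub>R V)"

lemma boost_linear: "linear (boost T V t)"
  by (rule linearI) (auto simp: boost_def mink_simps algebra_simps)

lemma boost_lorentz:
  assumes T: "T \<in> hyperboloid" and V: "mink T V = 0" "mink V V = 1"
  shows "lorentz (boost T V t)"
proof (rule lorentzI[OF boost_linear _ T])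
  have TT: "mink T T = -1" using T by (simp add: hyperboloid_def)
  have VT: "mink V T = 0" using V by (simp add: mink_commute)
  have bT: "boost T V t T = cosh t *\<^sub>R T + sinh t *\<^sub>R V"
    by (simp add: boost_def TT V algebra_simps)
  show "boost T V t T \<in> hyperboloid"
    unfolding bT by (rule boost_in_hyperboloid[OF T V])
  fix X Y
  have "cosh t * cosh t = 1 + sinh t * sinh t"
    using cosh_square_eq[of t] by (simp add: power2_eq_square)
  then have "cosh t * cosh t * z = (1 + sinh t * sinh t) * z" for z by simp
  then have c: "cosh t * (cosh t * z) = z + sinh t * (sinh t * z)" for z
    by (simp add: algebra_simps)
  show "mink (boost T V t X) (boost T V t Y) = mink X Y"
    unfolding boost_def
    by (simp add: mink_simps TT V VT mink_commute[of T X] mink_commute[of V X] mink_commute[of T Y] mink_commute[of V Y])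
      (simp add: algebra_simps c)
qed

lemma boost_apply_T:
  assumes "T \<in> hyperboloid" "mink T V = 0"
  shows "boost T V t T = cosh t *\<^sub>R T + sinh t *\<^sub>R V"
  using assms by (simp add: boost_def hyperboloid_def algebra_simps)

lemma boost_apply_V:
  assumes "mink T V = 0" "mink V V = 1"
  shows "boost T V t V = sinh t *\<^sub>R T + cosh t *\<^sub>R V"
  using assms by (simp add: boost_def mink_commute[of V T] algebra_simps)

lemma boost_fix:
  assumes "mink Z T = 0" "mink Z V = 0" shows "boost T V t Z = Z"
  using assms by (simp add: boost_def)

lemma boost_0: "boost T V 0 Z = Z"
  by (simp add: boost_def)

lemma tendsto_boost:
  assumes "(f \<longlongrightarrow> t) F" "(g \<longlongrightarrow> Z) F"
  shows "((\<lambda>k. boost T V (f k) (g k)) \<longlongrightarrow> boost T V t Z) F"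
  unfolding boost_def by (intro tendsto_intros assms)

lemma mink_boost_V:
  assumes "mink T V = 0" "mink V V = 1"
  shows "mink (boost T V t Z) V = cosh t * mink Z V - sinh t * mink Z T"
  using assms by (simp add: boost_def mink_simps algebra_simps)

text \<open>The witness is the Lorentz reflection in the hyperplane orthogonal to \<open>X - Y\<close>. It exchanges \<open>X\<close> and
  \<open>Y\<close>, and it fixes \<open>M\<close> because equal heights mean that \<open>M\<close> is orthogonal to \<open>X - Y\<close>.\<close>

lemma exists_lorentz_swap:
  assumes X: "X \<in> hyperboloid" and Y: "Y \<in> hyperboloid" and M: "mink X M = mink Y M"
  obtains g where "lorentz g" "g M = M" "g X = Y"
proof (cases "X = Y")
  case True
  have "lorentz (id :: 'a \<times> real \<Rightarrow> _)" by (simp add: lorentz_def linear_id)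
  then show ?thesis using that[of id] True by simp
next
  case False
  define W where "W = X - Y"
  have XX: "mink X X = -1" "mink Y Y = -1" using X Y by (auto simp: hyperboloid_def)
  have WW: "mink W W = - 2 - 2 * mink X Y" by (simp add: W_def mink_simps XX mink_commute[of Y X])
  have nz: "mink W W \<noteq> 0" using mink_hyperboloid_le(2)[OF X Y] False WW by auto
  define g where "g Z = Z - (2 * mink Z W / mink W W) *\<^sub>R W" for Z
  have MW: "mink M W = 0" using M by (simp add: W_def mink_simps mink_commute[of M])
  have XW: "mink X W = mink W W / 2" by (simp add: WW) (simp add: W_def mink_simps XX)
  show ?thesis
  proof (rule that[of g])
    show "g M = M" by (simp add: g_def MW)
    show gX: "g X = Y" using nz by (simp add: g_def XW) (simp add: W_def)
    have lin: "linear g" by (rule linearI) (auto simp: g_def mink_simps algebra_simps add_divide_distrib)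
    show "lorentz g"
    proof (rule lorentzI[OF lin _ X])
      show "g X \<in> hyperboloid" by (simp add: gX Y)
      fix Z Z' show "mink (g Z) (g Z') = mink Z Z'"
        using nz by (simp add: g_def mink_simps mink_commute[of W Z] mink_commute[of W Z']) 
    qed
  qed
qed

text \<open>The isometry of the ball that a Lorentz transformation induces. Written with \<open>conevec\<close> instead of \<open>lift\<close>, the
  formula also gives its continuous extension to the ideal boundary.\<close>

definition act :: "('a::euclidean_space \<times> real \<Rightarrow> 'a \<times> real) \<Rightarrow> 'a \<Rightarrow> 'a" where
  "act A x = (1 / (snd (A (conevec x)) + (1 - (norm x)\<^sup>2))) *\<^sub>R fst (A (conevec x))"

lemma act_proj:
  assumes "lorentz A" "x \<in> hyp" shows "act A x = proj (A (lift x))"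
proof -
  have q: "0 < 1 - (norm x)^2" using assms(2) by (rule hyp_norm)
  have "A (conevec x) = (1 - (norm x)^2) *\<^sub>R A (lift x)"
    using assms by (simp add: conevec_lift lorentz_linear linear_cmul)
  then have "act A x = (1 / ((1 - (norm x)^2) * (1 + snd (A (lift x))))) *\<^sub>R ((1 - (norm x)^2) *\<^sub>R fst (A (lift x)))"
    unfolding act_def by (simp only: fst_scaleR snd_scaleR real_scaleR_def distrib_left mult_1_right add.commute)
  also have "\<dots> = proj (A (lift x))" using q by (simp add: proj_def)
  finally show ?thesis .
qed

lemma lift_act: "lorentz A \<Longrightarrow> x \<in> hyp \<Longrightarrow> lift (act A x) = A (lift x)"
  by (simp add: act_proj lift_proj lorentz_hyperboloid lift_hyperboloid)

lemma act_hyp: "lorentz A \<Longrightarrow> x \<in> hyp \<Longrightarrow> act A x \<in> hyp"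
  using proj_hyp[OF lorentz_hyperboloid[OF _ lift_hyperboloid]] act_proj by metis

lemma act_denominator_pos:
  assumes "lorentz A" "x \<in> cball 0 1" shows "0 < snd (A (conevec x)) + (1 - (norm x)\<^sup>2)"
proof -
  have "A (conevec x) \<in> future" using assms by (simp add: lorentz_future conevec_future del: mem_cball)
  moreover have "(norm x)\<^sup>2 \<le> 1" using assms(2) by (simp add: power_le_one)
  ultimately show ?thesis by (simp add: future_def)
qed

lemma act_sphere:
  assumes A: "lorentz A" and x: "x \<in> sphere 0 1"
  shows "act A x \<in> sphere 0 1" and "\<exists>r>0. conevec (act A x) = r *\<^sub>R A (conevec x)"
proof -
  have n: "norm x = 1" using x by simp
  have f: "A (conevec x) \<in> future" using A x by (simp add: lorentz_future conevec_future)
  then have s: "0 < snd (A (conevec x))" by (simp add: future_def)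
  have "mink (A (conevec x)) (A (conevec x)) = 0" using A n by (simp add: lorentz_mink mink_conevec)
  then have "norm (fst (A (conevec x)))^2 = (snd (A (conevec x)))^2"
    by (simp add: mink_self)
  then have e: "norm (fst (A (conevec x))) = snd (A (conevec x))" using s
    by (metis less_eq_real_def norm_ge_zero power2_eq_imp_eq)
  then show 1: "act A x \<in> sphere 0 1" using s n by (simp add: act_def)
  have "conevec (act A x) = (2 / snd (A (conevec x))) *\<^sub>R A (conevec x)"
    using 1 s by (simp add: conevec_def prod_eq_iff n act_def)
  then show "\<exists>r>0. conevec (act A x) = r *\<^sub>R A (conevec x)" using s by (meson divide_pos_pos zero_less_numeral)
qed

lemma act_isometry: "lorentz A \<Longrightarrow> x \<in> hyp \<Longrightarrow> y \<in> hyp \<Longrightarrow> hdist (act A x) (act A y) = hdist x y"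
  by (simp add: hdist_lift act_hyp lift_act lorentz_mink del: mem_ball mem_ball_0)

lemma tendsto_conevec [tendsto_intros]: "(f \<longlongrightarrow> x) F \<Longrightarrow> ((\<lambda>k. conevec (f k)) \<longlongrightarrow> conevec x) F"
  unfolding conevec_def by (intro tendsto_intros)

lemma continuous_on_conevec [continuous_intros]: "continuous_on S f \<Longrightarrow> continuous_on S (\<lambda>x. conevec (f x))"
  unfolding conevec_def by (intro continuous_intros)

lemma tendsto_act_family:
  assumes "lorentz A" "x \<in> cball 0 1" "(f \<longlongrightarrow> x) F" "((\<lambda>k. B k (conevec (f k))) \<longlongrightarrow> A (conevec x)) F"
  shows "((\<lambda>k. act (B k) (f k)) \<longlongrightarrow> act A x) F"
proof -
  have "snd (A (conevec x)) + (1 - (norm x)\<^sup>2) \<noteq> 0" using act_denominator_pos[OF assms(1,2)] by simp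
  then show ?thesis unfolding act_def by (intro tendsto_intros assms)
qed

lemma tendsto_linear: "linear (A :: 'b::euclidean_space \<Rightarrow> 'c::real_normed_vector) \<Longrightarrow> (f \<longlongrightarrow> x) F \<Longrightarrow> ((\<lambda>k. A (f k)) \<longlongrightarrow> A x) F"
  by (metis bounded_linear.tendsto linear_conv_bounded_linear)

lemma tendsto_act:
  assumes "lorentz A" "x \<in> cball 0 1" "(f \<longlongrightarrow> x) F"
  shows "((\<lambda>k. act A (f k)) \<longlongrightarrow> act A x) F"
  by (rule tendsto_act_family[OF assms, where B = "\<lambda>_. A"])
    (rule tendsto_linear[OF lorentz_linear[OF assms(1)] tendsto_conevec[OF assms(3)]])

lemma tendsto_act_boost:
  assumes "T \<in> hyperboloid" "mink T V = 0" "mink V V = 1" "lorentz g"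
    and "x \<in> cball 0 1" "(f \<longlongrightarrow> x) F" "(t \<longlongrightarrow> \<tau>) F"
  shows "((\<lambda>k. act (boost T V (t k) \<circ> g) (f k)) \<longlongrightarrow> act (boost T V \<tau> \<circ> g) x) F"
proof (rule tendsto_act_family[OF _ assms(5,6)])
  show "lorentz (boost T V \<tau> \<circ> g)" by (rule lorentz_compose[OF boost_lorentz[OF assms(1-3)] assms(4)])
  show "((\<lambda>k. (boost T V (t k) \<circ> g) (conevec (f k))) \<longlongrightarrow> (boost T V \<tau> \<circ> g) (conevec x)) F"
    unfolding comp_apply
    by (rule tendsto_boost[OF assms(7) tendsto_linear[OF lorentz_linear[OF assms(4)] tendsto_conevec[OF assms(6)]]])
qed

section \<open>Geodesics and parallel fields\<close>

text \<open>For a Euclidean unit vector \<open>e\<close> this is the unit speed geodesic from \<open>x\<close> in the direction \<open>e\<close>, the projection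
  of a branch of a hyperbola.\<close>

definition geo :: "'a::euclidean_space \<Rightarrow> 'a \<Rightarrow> real \<Rightarrow> 'a" where
  "geo x e s = proj (cosh s *\<^sub>R lift x + sinh s *\<^sub>R frame x e)"

lemma geo_point:
  assumes "x \<in> hyp" "norm e = 1"
  shows "cosh s *\<^sub>R lift x + sinh s *\<^sub>R frame x e \<in> hyperboloid"
  using assms by (intro boost_in_hyperboloid lift_hyperboloid mink_lift_frame)
    (simp_all add: mink_frame del: mem_ball mem_ball_0 add: dot_square_norm)

lemma lift_geo:
  "x \<in> hyp \<Longrightarrow> norm e = 1 \<Longrightarrow> lift (geo x e s) = cosh s *\<^sub>R lift x + sinh s *\<^sub>R frame x e"
  by (simp only: geo_def lift_proj[OF geo_point])

lemma geo_hyp: "x \<in> hyp \<Longrightarrow> norm e = 1 \<Longrightarrow> geo x e s \<in> hyp"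
  unfolding geo_def by (rule proj_hyp[OF geo_point])

lemma geo_0: "x \<in> hyp \<Longrightarrow> geo x e 0 = x"
  by (simp add: geo_def proj_lift del: mem_ball mem_ball_0)

lemma linear_component_derivatives:
  assumes "(X has_vector_derivative X') F"
  shows "((\<lambda>s. fst (X s)) has_vector_derivative fst X') F"
    and "((\<lambda>s. snd (X s)) has_vector_derivative snd X') F"
  using bounded_linear.has_vector_derivative[OF bounded_linear_fst assms]
    bounded_linear.has_vector_derivative[OF bounded_linear_snd assms] by auto

lemma conf_has_derivative:
  assumes "\<gamma> s \<in> hyp" "(\<gamma> has_vector_derivative v) (at s)"
  shows "((\<lambda>s. conf (\<gamma> s)) has_real_derivative (conf (\<gamma> s))\<^sup>2 * (\<gamma> s \<bullet> v)) (at s)"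
proof -
  have q: "1 - (norm (\<gamma> s))\<^sup>2 \<noteq> 0" using hyp_norm[OF assms(1)] by simp
  have q': "1 - \<gamma> s \<bullet> \<gamma> s \<noteq> 0" using q by (simp add: dot_square_norm)
  have d: "((\<lambda>s. \<gamma> s \<bullet> \<gamma> s) has_real_derivative 2 * (\<gamma> s \<bullet> v)) (at s)"
    using bounded_bilinear.has_vector_derivative[OF bounded_bilinear_inner assms(2) assms(2)]
    by (simp add: has_real_derivative_iff_has_vector_derivative inner_commute)
  have "((\<lambda>s. 2 / (1 - \<gamma> s \<bullet> \<gamma> s)) has_real_derivative
      (0 * (1 - \<gamma> s \<bullet> \<gamma> s) - 2 * (0 - 2 * (\<gamma> s \<bullet> v))) / ((1 - \<gamma> s \<bullet> \<gamma> s) * (1 - \<gamma> s \<bullet> \<gamma> s))) (at s)"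
    by (intro DERIV_divide DERIV_diff DERIV_const d q')
  then show ?thesis
    unfolding conf_def dot_square_norm[symmetric]
    by (rule DERIV_cong) (simp add: power2_eq_square)
qed

text \<open>The Levi-Civita connection of the hyperboloid is the tangential part of the flat derivative. The next
  two lemmas express this in the ball: the differential of \<open>lift\<close> is \<open>conf x *\<^sub>R frame x v\<close>, and the image of a
  parallel field varies only in the normal direction \<open>lift (\<gamma> s)\<close>.\<close>

lemma lift_has_derivative:
  assumes "\<gamma> s \<in> hyp" "(\<gamma> has_vector_derivative v) (at s)"
  shows "((\<lambda>s. lift (\<gamma> s)) has_vector_derivative conf (\<gamma> s) *\<^sub>R frame (\<gamma> s) v) (at s)"
proof -
  note c = conf_has_derivative[OF assms]
  have 1: "((\<lambda>s. conf (\<gamma> s) *\<^sub>R \<gamma> s) has_vector_derivative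
      (conf (\<gamma> s) *\<^sub>R v + ((conf (\<gamma> s))\<^sup>2 * (\<gamma> s \<bullet> v)) *\<^sub>R \<gamma> s)) (at s)"
    by (rule has_vector_derivative_scaleR[OF c assms(2)])
  have 2: "((\<lambda>s. conf (\<gamma> s) - 1) has_vector_derivative ((conf (\<gamma> s))\<^sup>2 * (\<gamma> s \<bullet> v))) (at s)"
    using DERIV_diff[OF c DERIV_const[of 1]] by (simp add: has_real_derivative_iff_has_vector_derivative)
  from has_vector_derivative_Pair[OF 1 2] show ?thesis
    by (simp add: lift_def frame_def power2_eq_square algebra_simps)
qed

lemma parallel_lift_derivative:
  assumes x: "\<gamma> s \<in> hyp" and v: "(\<gamma> has_vector_derivative v) (at s)"
    and V: "(V has_vector_derivative - christoffel (\<gamma> s) v (V s)) (at s)"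
  shows "((\<lambda>s. conf (\<gamma> s) *\<^sub>R frame (\<gamma> s) (V s)) has_vector_derivative
           ((conf (\<gamma> s))\<^sup>2 * (v \<bullet> V s)) *\<^sub>R lift (\<gamma> s)) (at s)"
proof -
  define c where "c = conf (\<gamma> s)"
  define x where "x = \<gamma> s"
  define w where "w = V s"
  have cn: "c * (x \<bullet> x) = c - 2" using conf_norm[OF x] by (simp add: c_def x_def)
  note dc = conf_has_derivative[OF x v]
  have dc2: "((\<lambda>s. (conf (\<gamma> s))\<^sup>2) has_real_derivative 2 * c * (c\<^sup>2 * (x \<bullet> v))) (at s)"
    by (rule DERIV_cong[OF DERIV_power[OF dc]]) (simp add: c_def x_def)
  have dxV: "((\<lambda>s. \<gamma> s \<bullet> V s) has_real_derivative x \<bullet> (- christoffel x v w) + v \<bullet> w) (at s)"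
    using bounded_bilinear.has_vector_derivative[OF bounded_bilinear_inner v V]
    by (simp add: has_real_derivative_iff_has_vector_derivative x_def w_def)
  have db: "((\<lambda>s. (conf (\<gamma> s))\<^sup>2 * (\<gamma> s \<bullet> V s)) has_real_derivative c\<^sup>2 * (v \<bullet> w) * (c - 1)) (at s)"
  proof (rule DERIV_cong[OF DERIV_mult[OF dc2 dxV]])
    have "2 * c * (c\<^sup>2 * (x \<bullet> v)) * (x \<bullet> w) + (x \<bullet> (- christoffel x v w) + v \<bullet> w) * c\<^sup>2
       = c\<^sup>2 * (v \<bullet> w) * (1 + c * (x \<bullet> x))"
      by (simp add: christoffel_def c_def x_def inner_simps inner_commute algebra_simps power2_eq_square)
    also have "\<dots> = c\<^sup>2 * (v \<bullet> w) * (c - 1)" by (simp add: cn)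
    finally show "2 * c * (c\<^sup>2 * (x \<bullet> v)) * (\<gamma> s \<bullet> V s) + (x \<bullet> (- christoffel x v w) + v \<bullet> w) * (conf (\<gamma> s))\<^sup>2
      = c\<^sup>2 * (v \<bullet> w) * (c - 1)" by (simp add: c_def x_def w_def)
  qed
  have d1: "((\<lambda>s. ((conf (\<gamma> s))\<^sup>2 * (\<gamma> s \<bullet> V s)) *\<^sub>R \<gamma> s + conf (\<gamma> s) *\<^sub>R V s) has_vector_derivative
      ((c\<^sup>2 * (x \<bullet> w)) *\<^sub>R v + (c\<^sup>2 * (v \<bullet> w) * (c - 1)) *\<^sub>R x) +
      (c *\<^sub>R (- christoffel x v w) + (c\<^sup>2 * (x \<bullet> v)) *\<^sub>R w)) (at s)"
    using has_vector_derivative_add[OF has_vector_derivative_scaleR[OF db v] has_vector_derivative_scaleR[OF dc V]]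
    by (simp only: c_def x_def w_def)
  have e1: "((c\<^sup>2 * (x \<bullet> w)) *\<^sub>R v + (c\<^sup>2 * (v \<bullet> w) * (c - 1)) *\<^sub>R x) +
      (c *\<^sub>R (- christoffel x v w) + (c\<^sup>2 * (x \<bullet> v)) *\<^sub>R w) = (c\<^sup>2 * (v \<bullet> w)) *\<^sub>R (c *\<^sub>R x)"
    by (simp add: christoffel_def c_def[symmetric] x_def[symmetric] algebra_simps power2_eq_square)
      (simp add: c_def x_def)
  have d2: "((\<lambda>s. (conf (\<gamma> s))\<^sup>2 * (\<gamma> s \<bullet> V s)) has_vector_derivative (c\<^sup>2 * (v \<bullet> w)) * (c - 1)) (at s)"
    using db by (simp add: has_real_derivative_iff_has_vector_derivative)
  from has_vector_derivative_Pair[OF d1[unfolded e1] d2] show ?thesis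
    by (simp add: lift_def frame_def power2_eq_square c_def x_def w_def algebra_simps)
qed

lemma velocity_eq: "(\<gamma> has_vector_derivative v) (at s) \<Longrightarrow> velocity \<gamma> s = v"
  by (simp add: velocity_def vector_derivative_at)

lemma curve_lift_derivatives:
  assumes X: "\<And>s. X s \<in> hyperboloid" "\<And>s. (X has_vector_derivative X' s) (at s)"
  shows "((\<lambda>s. proj (X s)) has_vector_derivative (1 / (1 + snd (X s))) *\<^sub>R coframe (proj (X s)) (X' s)) (at s)"
proof -
  have nz: "1 + snd (X s) \<noteq> 0" for s using X(1)[of s] by (simp add: hyperboloid_def)
  have "((\<lambda>s. 1 + snd (X s)) has_real_derivative snd (X' s)) (at s)"
    using DERIV_add[OF DERIV_const[of 1] linear_component_derivatives(2)[OF X(2)[of s],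
        folded has_real_derivative_iff_has_vector_derivative]] by simp
  from DERIV_divide[OF DERIV_const[of 1] this nz[of s]]
  have i: "((\<lambda>s. 1 / (1 + snd (X s))) has_real_derivative - (snd (X' s) / (1 + snd (X s))\<^sup>2)) (at s)"
    by (rule DERIV_cong) (simp add: power2_eq_square)
  from has_vector_derivative_scaleR[OF i linear_component_derivatives(1)[OF X(2)]]
  show ?thesis
    unfolding proj_def coframe_def
    by (rule has_vector_derivative_eq_rhs) (simp add: algebra_simps power2_eq_square)
qed

lemma hyperbola_complete_geodesic:
  fixes k :: real
  assumes X: "X \<in> hyperboloid" and V: "mink X V = 0" "mink V V = 1"
  defines "\<gamma> \<equiv> \<lambda>s. proj (cosh (k * s) *\<^sub>R X + sinh (k * s) *\<^sub>R V)"
  shows "complete_geodesic \<gamma>"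
    and "velocity \<gamma> s = (k / conf (\<gamma> s)) *\<^sub>R coframe (\<gamma> s) (sinh (k * s) *\<^sub>R X + cosh (k * s) *\<^sub>R V)"
    and "(\<gamma> has_vector_derivative velocity \<gamma> s) (at s)"
proof -
  define Z where "Z s = cosh (k * s) *\<^sub>R X + sinh (k * s) *\<^sub>R V" for s
  define Z' where "Z' s = sinh (k * s) *\<^sub>R X + cosh (k * s) *\<^sub>R V" for s
  have \<gamma>: "\<gamma> s = proj (Z s)" for s by (simp add: \<gamma>_def Z_def)
  have Zh: "Z s \<in> hyperboloid" for s unfolding Z_def by (rule boost_in_hyperboloid[OF X V])
  have dZ: "(Z has_vector_derivative k *\<^sub>R Z' s) (at s)" for s
    unfolding Z_def Z'_def by (auto intro!: derivative_eq_intros simp: algebra_simps)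
  have dZ': "(Z' has_vector_derivative k *\<^sub>R Z s) (at s)" for s
    unfolding Z_def Z'_def by (auto intro!: derivative_eq_intros simp: algebra_simps)
  have XX: "mink X X = -1" using X by (simp add: hyperboloid_def)
  have sc: "cosh r * cosh r = 1 + sinh r * sinh r" for r :: real
    using cosh_square_eq[of r] by (simp add: power2_eq_square)
  have ZZ': "mink (Z s) (Z' s) = 0" for s
    using V XX mink_commute[of V X] by (simp add: Z_def Z'_def mink_simps)
  have Z'Z': "mink (Z' s) (Z' s) = 1" for s
    using V XX mink_commute[of V X] by (simp add: Z'_def mink_simps sc)
  have hyp: "\<gamma> s \<in> hyp" for s unfolding \<gamma> by (rule proj_hyp[OF Zh])
  have c: "conf (\<gamma> s) = 1 + snd (Z s)" for s unfolding \<gamma> by (rule conf_proj[OF Zh])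
  have lift: "lift (\<gamma> s) = Z s" for s unfolding \<gamma> by (rule lift_proj[OF Zh])
  define v where "v s = (k / conf (\<gamma> s)) *\<^sub>R coframe (\<gamma> s) (Z' s)" for s
  have dg: "(\<gamma> has_vector_derivative v s) (at s)" for s
    using curve_lift_derivatives[of Z, OF Zh dZ, of s]
    unfolding \<gamma>[symmetric] v_def c by (simp add: coframe_def algebra_simps)
  have vel: "velocity \<gamma> = v" by (rule ext) (rule velocity_eq[OF dg])
  show "velocity \<gamma> s = (k / conf (\<gamma> s)) *\<^sub>R coframe (\<gamma> s) (sinh (k * s) *\<^sub>R X + cosh (k * s) *\<^sub>R V)"
    by (simp add: vel v_def Z'_def)
  show "(\<gamma> has_vector_derivative velocity \<gamma> s) (at s)" by (simp add: vel dg)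
  have fv: "conf (\<gamma> s) *\<^sub>R frame (\<gamma> s) (v s) = k *\<^sub>R Z' s" for s
    using conf_pos[OF hyp[of s]] frame_coframe[OF hyp[of s], of "Z' s"] ZZ'
    by (simp add: v_def frame_scale lift)
  have vv: "(conf (\<gamma> s))\<^sup>2 * (v s \<bullet> v s) = k\<^sup>2" for s
  proof -
    have "(conf (\<gamma> s))\<^sup>2 * (v s \<bullet> v s) = mink (conf (\<gamma> s) *\<^sub>R frame (\<gamma> s) (v s)) (conf (\<gamma> s) *\<^sub>R frame (\<gamma> s) (v s))"
      by (simp add: mink_simps mink_frame[OF hyp] power2_eq_square)
    also have "\<dots> = k\<^sup>2" unfolding fv by (simp add: mink_simps Z'Z' power2_eq_square)
    finally show ?thesis .
  qed
  have beta: "(conf (\<gamma> s))\<^sup>2 * (\<gamma> s \<bullet> v s) = k * snd (Z' s)" for s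
    using arg_cong[OF fv[of s], of snd] by (simp add: frame_def power2_eq_square mult.assoc)
  have dv: "(v has_vector_derivative - christoffel (\<gamma> s) (v s) (v s)) (at s)" for s
  proof -
    let ?c = "conf (\<gamma> s)"
    have cp: "0 < ?c" by (rule conf_pos[OF hyp])
    have di: "((\<lambda>s. k / conf (\<gamma> s)) has_real_derivative - (k * (k * snd (Z' s)) / ?c\<^sup>2)) (at s)"
      by (rule DERIV_cong[OF DERIV_divide[OF DERIV_const conf_has_derivative[of \<gamma> s, OF hyp dg]]])
        (use cp in \<open>simp_all add: beta\<close>, simp add: power2_eq_square)
    have dco: "((\<lambda>s. coframe (\<gamma> s) (Z' s)) has_vector_derivative
       (k *\<^sub>R fst (Z s) - (snd (Z' s) *\<^sub>R v s + (k * snd (Z s)) *\<^sub>R \<gamma> s))) (at s)"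
    proof -
      have s2: "((\<lambda>s. snd (Z' s)) has_real_derivative k * snd (Z s)) (at s)"
        using linear_component_derivatives(2)[OF dZ'[of s]]
        by (simp add: has_real_derivative_iff_has_vector_derivative)
      have f2: "((\<lambda>s. fst (Z' s)) has_vector_derivative k *\<^sub>R fst (Z s)) (at s)"
        using linear_component_derivatives(1)[OF dZ'[of s]] by simp
      show ?thesis unfolding coframe_def
        by (rule has_vector_derivative_diff[OF f2 has_vector_derivative_scaleR[OF s2 dg]])
    qed
    have fZ: "fst (Z s) = ?c *\<^sub>R \<gamma> s" "snd (Z s) = ?c - 1" using lift[of s] by (auto simp: lift_def prod_eq_iff)
    have co: "k *\<^sub>R coframe (\<gamma> s) (Z' s) = ?c *\<^sub>R v s" using cp by (simp add: v_def)
    have "(v has_vector_derivative (k / ?c) *\<^sub>R (k *\<^sub>R fst (Z s) - (snd (Z' s) *\<^sub>R v s + (k * snd (Z s)) *\<^sub>R \<gamma> s))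
       + (- (k * (k * snd (Z' s)) / ?c\<^sup>2)) *\<^sub>R coframe (\<gamma> s) (Z' s)) (at s)"
      using has_vector_derivative_scaleR[OF di dco] by (simp only: v_def[abs_def])
    moreover have "(- (k * (k * snd (Z' s)) / ?c\<^sup>2)) *\<^sub>R coframe (\<gamma> s) (Z' s) =
        - ((k * snd (Z' s)) / ?c\<^sup>2) *\<^sub>R (k *\<^sub>R coframe (\<gamma> s) (Z' s))" by (simp add: algebra_simps)
    moreover have "- ((k * snd (Z' s)) / ?c\<^sup>2) *\<^sub>R (k *\<^sub>R coframe (\<gamma> s) (Z' s)) = - ((k * snd (Z' s)) / ?c) *\<^sub>R v s"
      unfolding co using cp by (simp add: power2_eq_square)
    moreover have "(k / ?c) *\<^sub>R (k *\<^sub>R fst (Z s) - (snd (Z' s) *\<^sub>R v s + (k * snd (Z s)) *\<^sub>R \<gamma> s)) =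
       (k\<^sup>2 / ?c) *\<^sub>R \<gamma> s - ((k * snd (Z' s)) / ?c) *\<^sub>R v s"
      unfolding fZ by (simp add: algebra_simps power2_eq_square)
    moreover have "- christoffel (\<gamma> s) (v s) (v s) = (?c * (v s \<bullet> v s)) *\<^sub>R \<gamma> s - (2 * (?c * (\<gamma> s \<bullet> v s))) *\<^sub>R v s"
      by (simp add: christoffel_def algebra_simps scaleR_2[symmetric])
    moreover have "?c * (v s \<bullet> v s) = k\<^sup>2 / ?c" using vv[of s] cp by (simp add: field_simps power2_eq_square)
    moreover have "?c * (\<gamma> s \<bullet> v s) = k * snd (Z' s) / ?c" using beta[of s] cp by (simp add: field_simps power2_eq_square)
    ultimately show ?thesis by (simp add: algebra_simps scaleR_2[symmetric])
  qed
  show "complete_geodesic \<gamma>"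
    unfolding complete_geodesic_def parallel_along_def vel
    using hyp differentiableI_vector[OF dg] dv by (simp del: mem_ball mem_ball_0)
qed

lemma geo_complete_geodesic:
  assumes "x \<in> hyp" "norm e = 1"
  shows "complete_geodesic (\<lambda>s. geo x e (k * s))"
    and "velocity (\<lambda>s. geo x e (k * s)) s =
      (k / conf (geo x e (k * s))) *\<^sub>R coframe (geo x e (k * s)) (sinh (k * s) *\<^sub>R lift x + cosh (k * s) *\<^sub>R frame x e)"
    and "((\<lambda>s. geo x e (k * s)) has_vector_derivative velocity (\<lambda>s. geo x e (k * s)) s) (at s)"
proof -
  have ee: "mink (frame x e) (frame x e) = 1"
    unfolding mink_frame[OF assms(1)] by (simp add: dot_square_norm assms)
  note g = hyperbola_complete_geodesic[OF lift_hyperboloid[OF assms(1)] mink_lift_frame[OF assms(1)] ee, of k, folded geo_def]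
  show "complete_geodesic (\<lambda>s. geo x e (k * s))" by (rule g(1))
  show "velocity (\<lambda>s. geo x e (k * s)) s =
      (k / conf (geo x e (k * s))) *\<^sub>R coframe (geo x e (k * s)) (sinh (k * s) *\<^sub>R lift x + cosh (k * s) *\<^sub>R frame x e)"
    by (rule g(2))
  show "((\<lambda>s. geo x e (k * s)) has_vector_derivative velocity (\<lambda>s. geo x e (k * s)) s) (at s)"
    by (rule g(3))
qed

lemma geo_velocity_0:
  assumes "x \<in> hyp" "norm e = 1"
  shows "velocity (\<lambda>s. geo x e (k * s)) 0 = (k / conf x) *\<^sub>R e"
  using geo_complete_geodesic(2)[OF assms, of k 0] by (simp add: geo_0[OF assms(1)] coframe_frame)

lemma geo_has_derivative:
  assumes "x \<in> hyp" "norm e = 1"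
  shows "(geo x e has_vector_derivative velocity (geo x e) s) (at s)"
  using geo_complete_geodesic(3)[OF assms, of 1 s] by simp

lemma geo_velocity: "x \<in> hyp \<Longrightarrow> norm e = 1 \<Longrightarrow> velocity (geo x e) 0 = (1 / conf x) *\<^sub>R e"
  using geo_velocity_0[of x e 1] by simp

lemma geo_velocity_derivative:
  assumes "x \<in> hyp" "norm e = 1"
  shows "(velocity (geo x e) has_vector_derivative
     - christoffel (geo x e s) (velocity (geo x e) s) (velocity (geo x e) s)) (at s)"
  using geo_complete_geodesic(1)[OF assms, of 1] by (simp add: complete_geodesic_def parallel_along_def)

lemma continuous_geo: "x \<in> hyp \<Longrightarrow> norm e = 1 \<Longrightarrow> isCont (geo x e) s"
  by (rule has_vector_derivative_continuous[OF geo_has_derivative])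

lemma constant_if_derivative_zero:
  assumes "\<And>s. (f has_vector_derivative (0::'b::real_normed_vector)) (at s)"
  shows "f s = f (0::real)"
proof -
  have "(f has_derivative (\<lambda>h. 0)) (at s)" for s
    using assms[of s] by (simp add: has_vector_derivative_def)
  then have "\<exists>c. \<forall>x\<in>UNIV. f x = c"
    by (intro has_derivative_zero_constant) simp_all
  then show ?thesis by auto
qed

text \<open>In the hyperboloid the geodesic equation reads \<open>X'' = k\<^sup>2 X\<close> with the constant squared speed \<open>k\<^sup>2\<close>, a
  linear equation with constant coefficients. The combinations \<open>X' + k X\<close> and
  \<open>X' - k X\<close> are exponential functions, which determines \<open>\<gamma>\<close> by its initial data.\<close>

lemma complete_geodesic_eq_geo:
  assumes g: "complete_geodesic \<gamma>" and v0: "velocity \<gamma> 0 = (k / conf (\<gamma> 0)) *\<^sub>R e" and e: "norm e = 1"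
  shows "\<gamma> s = geo (\<gamma> 0) e (k * s)"
proof -
  have hyp: "\<gamma> s \<in> hyp" and dg: "(\<gamma> has_vector_derivative velocity \<gamma> s) (at s)"
    and dv: "(velocity \<gamma> has_vector_derivative - christoffel (\<gamma> s) (velocity \<gamma> s) (velocity \<gamma> s)) (at s)" for s
  proof -
    show "\<gamma> s \<in> hyp" using g by (simp add: complete_geodesic_def)
    have "\<gamma> differentiable (at s)" using g by (simp add: complete_geodesic_def)
    then show "(\<gamma> has_vector_derivative velocity \<gamma> s) (at s)"
      unfolding velocity_def by (simp only: vector_derivative_works[symmetric])
    show "(velocity \<gamma> has_vector_derivative - christoffel (\<gamma> s) (velocity \<gamma> s) (velocity \<gamma> s)) (at s)"
      using g by (simp only: complete_geodesic_def parallel_along_def)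
  qed
  define X where "X s = lift (\<gamma> s)" for s
  define Y where "Y s = conf (\<gamma> s) *\<^sub>R frame (\<gamma> s) (velocity \<gamma> s)" for s
  define K where "K s = mink (Y s) (Y s)" for s
  have dX: "(X has_vector_derivative Y s) (at s)" for s
    unfolding X_def[abs_def] Y_def by (rule lift_has_derivative[OF hyp dg])
  have dY: "(Y has_vector_derivative K s *\<^sub>R X s) (at s)" for s
    using parallel_lift_derivative[OF hyp dg dv, of s]
    by (simp add: K_def Y_def[abs_def] X_def mink_simps mink_frame[OF hyp] power2_eq_square mult.assoc)
  have XY: "mink (X s) (Y s) = 0" for s by (simp add: X_def Y_def mink_simps mink_lift_frame[OF hyp])
  have "(K has_real_derivative 0) (at s)" for s
  proof -
    have "((\<lambda>s. mink (Y s) (Y s)) has_real_derivative mink (Y s) (K s *\<^sub>R X s) + mink (K s *\<^sub>R X s) (Y s)) (at s)"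
      unfolding mink_def
      using DERIV_diff[OF bounded_bilinear.has_vector_derivative[OF bounded_bilinear_inner
            linear_component_derivatives(1)[OF dY] linear_component_derivatives(1)[OF dY],
            folded has_real_derivative_iff_has_vector_derivative]
          DERIV_mult[OF linear_component_derivatives(2)[OF dY, folded has_real_derivative_iff_has_vector_derivative]
            linear_component_derivatives(2)[OF dY, folded has_real_derivative_iff_has_vector_derivative]]]
      by (rule DERIV_cong) (simp add: algebra_simps)
    then show ?thesis by (simp add: K_def[abs_def] mink_simps XY mink_commute[of "Y s" "X s"])
  qed
  then have K0: "K s = K 0" for s
    by (intro constant_if_derivative_zero) (simp add: has_real_derivative_iff_has_vector_derivative)
  have Y0: "Y 0 = k *\<^sub>R frame (\<gamma> 0) e"
    using conf_pos[OF hyp[of 0]] by (simp add: Y_def v0 frame_scale)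
  have Kk: "K s = k\<^sup>2" for s
    unfolding K0[of s] by (simp add: K_def Y0 mink_simps mink_frame[OF hyp] dot_square_norm e power2_eq_square)
  have X0: "X 0 = lift (\<gamma> 0)" by (simp add: X_def)
  have "X s = cosh (k * s) *\<^sub>R X 0 + sinh (k * s) *\<^sub>R frame (\<gamma> 0) e"
  proof (cases "k = 0")
    case True
    have "velocity \<gamma> s = 0" for s
      using Kk[of s] conf_pos[OF hyp[of s]] True by (simp add: K_def Y_def mink_simps mink_frame[OF hyp])
    then have "Y s = 0" for s by (simp add: Y_def frame_def zero_prod_def)
    then have "X s = X 0" using dX by (intro constant_if_derivative_zero) metis
    then show ?thesis using True by simp
  next
    case False
    have c: "exp (- r * s) *\<^sub>R (r *\<^sub>R X s + Y s) = r *\<^sub>R X 0 + Y 0" if r: "r\<^sup>2 = k\<^sup>2" for r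
    proof -
      have "((\<lambda>s. exp (- r * s) *\<^sub>R (r *\<^sub>R X s + Y s)) has_vector_derivative
         exp (- r * s) *\<^sub>R (r *\<^sub>R Y s + K s *\<^sub>R X s) + (exp (- r * s) * (- r)) *\<^sub>R (r *\<^sub>R X s + Y s)) (at s)" for s
      proof (rule has_vector_derivative_scaleR)
        show "((\<lambda>s. exp (- r * s)) has_real_derivative exp (- r * s) * - r) (at s)"
          by (auto intro!: derivative_eq_intros)
        show "((\<lambda>s. r *\<^sub>R X s + Y s) has_vector_derivative r *\<^sub>R Y s + K s *\<^sub>R X s) (at s)"
          by (intro has_vector_derivative_add dY bounded_linear.has_vector_derivative[OF bounded_linear_scaleR_right dX])
      qed
      moreover have "exp (- r * s) *\<^sub>R (r *\<^sub>R Y s + K s *\<^sub>R X s) + (exp (- r * s) * (- r)) *\<^sub>R (r *\<^sub>R X s + Y s) = 0" for s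
      proof -
        have "exp (- r * s) *\<^sub>R (r *\<^sub>R Y s + r\<^sup>2 *\<^sub>R X s) + (exp (- r * s) * (- r)) *\<^sub>R (r *\<^sub>R X s + Y s) = 0"
          by (simp add: algebra_simps power2_eq_square)
        then show ?thesis by (simp only: Kk r)
      qed
      ultimately have "((\<lambda>s. exp (- r * s) *\<^sub>R (r *\<^sub>R X s + Y s)) has_vector_derivative 0) (at s)" for s by simp
      from constant_if_derivative_zero[OF this, of s] show ?thesis by simp
    qed
    have c': "r *\<^sub>R X s + Y s = exp (r * s) *\<^sub>R (r *\<^sub>R X 0 + Y 0)" if "r\<^sup>2 = k\<^sup>2" for r
    proof -
      have "exp (r * s) *\<^sub>R exp (- r * s) *\<^sub>R (r *\<^sub>R X s + Y s) = exp (r * s) *\<^sub>R (r *\<^sub>R X 0 + Y 0)"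
        by (simp only: c[OF that])
      then show ?thesis by (simp add: exp_minus)
    qed
    have "(2 * k) *\<^sub>R X s = (k *\<^sub>R X s + Y s) - ((- k) *\<^sub>R X s + Y s)"
      by (simp add: algebra_simps scaleR_2[symmetric])
    also have "\<dots> = exp (k * s) *\<^sub>R (k *\<^sub>R X 0 + Y 0) - exp (- k * s) *\<^sub>R ((- k) *\<^sub>R X 0 + Y 0)"
      using c'[of k] c'[of "- k"] by simp
    also have "\<dots> = (2 * k) *\<^sub>R (cosh (k * s) *\<^sub>R X 0 + sinh (k * s) *\<^sub>R frame (\<gamma> 0) e)"
      unfolding Y0 cosh_def sinh_def by (simp add: algebra_simps)
    finally show ?thesis using False by simp
  qed
  then have "lift (\<gamma> s) = lift (geo (\<gamma> 0) e (k * s))"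
    by (simp only: lift_geo[OF hyp e]) (simp add: X_def)
  then show ?thesis by (rule lift_inj[OF hyp geo_hyp[OF hyp e]])
qed

lemma hexp_eq:
  assumes "x \<in> hyp" "norm e = 1"
  shows "hexp x ((k / conf x) *\<^sub>R e) = geo x e k"
  unfolding hexp_def
proof (rule the_equality)
  show "\<exists>\<gamma>. complete_geodesic \<gamma> \<and> \<gamma> 0 = x \<and> velocity \<gamma> 0 = (k / conf x) *\<^sub>R e \<and> \<gamma> 1 = geo x e k"
    using geo_complete_geodesic(1)[OF assms, of k] geo_velocity_0[OF assms, of k] geo_0[OF assms(1)]
    by (intro exI[of _ "\<lambda>s. geo x e (k * s)"]) auto
next
  fix q assume "\<exists>\<gamma>. complete_geodesic \<gamma> \<and> \<gamma> 0 = x \<and> velocity \<gamma> 0 = (k / conf x) *\<^sub>R e \<and> \<gamma> 1 = q"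
  then show "q = geo x e k" using complete_geodesic_eq_geo[OF _ _ assms(2), of _ k 1] by auto
qed

lemma unit_speed_geodesic_eq_geo:
  assumes "unit_speed_geodesic \<gamma>"
  shows "\<exists>e. norm e = 1 \<and> \<gamma> 0 \<in> hyp \<and> (\<forall>s. \<gamma> s = geo (\<gamma> 0) e s)"
proof -
  have g: "complete_geodesic \<gamma>" and 1: "hnorm (\<gamma> 0) (velocity \<gamma> 0) = 1"
    using assms by (auto simp: unit_speed_geodesic_def)
  have x: "\<gamma> 0 \<in> hyp" using g by (simp add: complete_geodesic_def)
  define e where "e = conf (\<gamma> 0) *\<^sub>R velocity \<gamma> 0"
  have "norm e = hnorm (\<gamma> 0) (velocity \<gamma> 0)"
    using conf_pos[OF x] by (simp add: e_def hnorm_def hinner_def real_sqrt_mult norm_eq_sqrt_inner)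
  then have e: "norm e = 1" using 1 by simp
  have "velocity \<gamma> 0 = (1 / conf (\<gamma> 0)) *\<^sub>R e" using conf_pos[OF x] by (simp add: e_def)
  from complete_geodesic_eq_geo[OF g this e, unfolded mult_1] have "\<gamma> s = geo (\<gamma> 0) e s" for s .
  with e x show ?thesis by blast
qed

section \<open>The Laplacian through geodesics\<close>

definition second_derivative_at_0 :: "(real \<Rightarrow> real) \<Rightarrow> real \<Rightarrow> bool" where
  "second_derivative_at_0 g q \<longleftrightarrow>
     (\<exists>g'. (\<forall>\<^sub>F s in nhds 0. (g has_real_derivative g' s) (at s)) \<and> (g' has_real_derivative q) (at 0))"

lemma second_derivative_add:
  assumes "second_derivative_at_0 f p" "second_derivative_at_0 g q"
  shows "second_derivative_at_0 (\<lambda>s. f s + g s) (p + q)"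
proof -
  from assms obtain f' g' where
    f: "\<forall>\<^sub>F s in nhds 0. (f has_real_derivative f' s) (at s)" "(f' has_real_derivative p) (at 0)" and
    g: "\<forall>\<^sub>F s in nhds 0. (g has_real_derivative g' s) (at s)" "(g' has_real_derivative q) (at 0)"
    unfolding second_derivative_at_0_def by blast
  show ?thesis unfolding second_derivative_at_0_def
  proof (intro exI[of _ "\<lambda>s. f' s + g' s"] conjI DERIV_add f(2) g(2))
    show "\<forall>\<^sub>F s in nhds 0. ((\<lambda>s. f s + g s) has_real_derivative f' s + g' s) (at s)"
      using f(1) g(1) by eventually_elim (rule DERIV_add)
  qed
qed

lemma second_derivative_cmult:
  assumes "second_derivative_at_0 f p"
  shows "second_derivative_at_0 (\<lambda>s. c * f s) (c * p)"
proof -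
  from assms obtain f' where
    f: "\<forall>\<^sub>F s in nhds 0. (f has_real_derivative f' s) (at s)" "(f' has_real_derivative p) (at 0)"
    unfolding second_derivative_at_0_def by blast
  show ?thesis unfolding second_derivative_at_0_def
  proof (intro exI[of _ "\<lambda>s. c * f' s"] conjI DERIV_cmult f(2))
    show "\<forall>\<^sub>F s in nhds 0. ((\<lambda>s. c * f s) has_real_derivative c * f' s) (at s)"
      using f(1) by eventually_elim (rule DERIV_cmult)
  qed
qed

lemma second_derivative_local_min:
  assumes "second_derivative_at_0 g q" and min: "\<forall>\<^sub>F s in nhds 0. g 0 \<le> g s"
  shows "0 \<le> q"
proof (rule ccontr)
  assume "\<not> 0 \<le> q"
  then have q: "q < 0" by simp
  from assms obtain g' where
    g: "\<forall>\<^sub>F s in nhds 0. (g has_real_derivative g' s) (at s)" "(g' has_real_derivative q) (at 0)"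
    unfolding second_derivative_at_0_def by blast
  from eventually_conj[OF g(1) min] obtain d1 where d1: "d1 > 0"
    "\<And>s. \<bar>s\<bar> < d1 \<Longrightarrow> (g has_real_derivative g' s) (at s) \<and> g 0 \<le> g s"
    unfolding eventually_nhds_metric dist_real_def by auto
  have g0: "g' 0 = 0"
    using DERIV_local_min[of g "g' 0" 0 d1] d1 by auto
  from DERIV_neg_dec_right[OF g(2) q] obtain d2 where d2: "d2 > 0"
    "\<And>h. 0 < h \<Longrightarrow> h < d2 \<Longrightarrow> g' (0 + h) < g' 0" by blast
  define s where "s = min d1 d2 / 2"
  have s: "0 < s" "s < d1" "s < d2" using d1 d2 by (auto simp: s_def)
  have "\<exists>z. 0 < z \<and> z < s \<and> g s - g 0 = (s - 0) * g' z"
    using s d1(2) by (intro MVT2) auto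
  then obtain z where z: "0 < z" "z < s" "g s - g 0 = s * g' z" by auto
  have "g' z < 0" using d2(2)[of z] z s g0 by simp
  then have "s * g' z < 0" using s by (simp add: mult_pos_neg)
  then have "g s < g 0" using z(3) by simp
  moreover have "g 0 \<le> g s" using d1(2)[of s] s by simp
  ultimately show False by simp
qed

text \<open>The Laplacian as the trace of the Hessian, where the Hessian is read off from the second derivatives along the
  geodesics through \<open>x\<close>. This description is invariant under isometries by construction, and it applies to functions
  of Minkowski coordinates without any computation in the ball.\<close>

definition has_hlap :: "('a::euclidean_space \<Rightarrow> real) \<Rightarrow> 'a \<Rightarrow> real \<Rightarrow> bool" where
  "has_hlap u x d \<longleftrightarrow>
     (\<exists>Q. linear Q \<and> (\<forall>e. norm e = 1 \<longrightarrow> second_derivative_at_0 (\<lambda>s. u (geo x e s)) (Q e \<bullet> e)) \<and>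
          d = (\<Sum>b\<in>Basis. Q b \<bullet> b))"

lemma has_hlap_derivative:
  assumes "has_hlap u x d" "norm e = 1"
  shows "\<exists>D. ((\<lambda>s. u (geo x e s)) has_real_derivative D) (at 0)"
proof -
  from assms obtain q where "second_derivative_at_0 (\<lambda>s. u (geo x e s)) q" unfolding has_hlap_def by blast
  then show ?thesis unfolding second_derivative_at_0_def by (blast dest: eventually_nhds_x_imp_x)
qed

lemma has_hlap_add:
  assumes "has_hlap u x d" "has_hlap w x d'" shows "has_hlap (\<lambda>y. u y + w y) x (d + d')"
proof -
  from assms obtain Q Q' where
    Q: "linear Q" "\<And>e. norm e = 1 \<Longrightarrow> second_derivative_at_0 (\<lambda>s. u (geo x e s)) (Q e \<bullet> e)" "d = (\<Sum>b\<in>Basis. Q b \<bullet> b)" and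
    Q': "linear Q'" "\<And>e. norm e = 1 \<Longrightarrow> second_derivative_at_0 (\<lambda>s. w (geo x e s)) (Q' e \<bullet> e)" "d' = (\<Sum>b\<in>Basis. Q' b \<bullet> b)"
    unfolding has_hlap_def by blast
  show ?thesis unfolding has_hlap_def
    using Q Q' by (intro exI[of _ "\<lambda>v. Q v + Q' v"])
      (auto simp: inner_add_left sum.distrib linear_compose_add intro: second_derivative_add)
qed

lemma has_hlap_cmult:
  assumes "has_hlap u x d" shows "has_hlap (\<lambda>y. c * u y) x (c * d)"
proof -
  from assms obtain Q where
    Q: "linear Q" "\<And>e. norm e = 1 \<Longrightarrow> second_derivative_at_0 (\<lambda>s. u (geo x e s)) (Q e \<bullet> e)" "d = (\<Sum>b\<in>Basis. Q b \<bullet> b)"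
    unfolding has_hlap_def by blast
  show ?thesis unfolding has_hlap_def
    using Q by (intro exI[of _ "\<lambda>v. c *\<^sub>R Q v"])
      (auto simp: sum_distrib_left linear_compose_scale_right intro: second_derivative_cmult)
qed

lemma has_hlap_diff:
  assumes "has_hlap u x d" "has_hlap w x d'" shows "has_hlap (\<lambda>y. u y - w y) x (d - d')"
  using has_hlap_add[OF assms(1) has_hlap_cmult[OF assms(2), of "-1"]] by simp

lemma basis_norm: "b \<in> Basis \<Longrightarrow> norm (b :: 'a::euclidean_space) = 1"
  by simp

lemma eventually_geo:
  assumes "x \<in> hyp" "norm e = 1" "\<forall>\<^sub>F y in nhds x. P y"
  shows "\<forall>\<^sub>F s in nhds 0. P (geo x e s)"
proof -
  have "filterlim (geo x e) (nhds x) (nhds 0)"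
    using continuous_geo[OF assms(1,2), of 0] geo_0[OF assms(1)]
    by (metis continuous_at_imp_continuous_at_within isCont_def tendsto_at_iff_tendsto_nhds)
  from filterlim_iff[THEN iffD1, OF this] assms(3) show ?thesis by blast
qed

lemma has_hlap_local_min:
  assumes "x \<in> hyp" "has_hlap u x d" "\<forall>\<^sub>F y in nhds x. u x \<le> u y"
  shows "0 \<le> d"
proof -
  from assms obtain Q where
    Q: "linear Q" "\<And>e. norm e = 1 \<Longrightarrow> second_derivative_at_0 (\<lambda>s. u (geo x e s)) (Q e \<bullet> e)" "d = (\<Sum>b\<in>Basis. Q b \<bullet> b)"
    unfolding has_hlap_def by blast
  have "0 \<le> Q b \<bullet> b" if "b \<in> Basis" for b
    using second_derivative_local_min[OF Q(2)[OF basis_norm[OF that]]]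
      eventually_geo[OF assms(1) basis_norm[OF that] assms(3)] geo_0[OF assms(1)] by simp
  then show ?thesis using Q(3) by (simp add: sum_nonneg)
qed

subsection \<open>Isometry invariance\<close>

lemma trace_commute:
  fixes A B :: "'a::euclidean_space \<Rightarrow> 'a"
  assumes "linear A" "linear B"
  shows "(\<Sum>b\<in>Basis. A (B b) \<bullet> b) = (\<Sum>b\<in>Basis. B (A b) \<bullet> b)"
proof -
  have ex: "A (B b) \<bullet> b = (\<Sum>c\<in>Basis. (B b \<bullet> c) * (A c \<bullet> b))" if lin: "linear A" for A B :: "'a \<Rightarrow> 'a" and b
  proof -
    have "A (B b) = A (\<Sum>c\<in>Basis. (B b \<bullet> c) *\<^sub>R c)" by (simp add: euclidean_representation)
    also have "\<dots> = (\<Sum>c\<in>Basis. (B b \<bullet> c) *\<^sub>R A c)" using lin by (simp add: linear_sum linear_cmul)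
    finally show ?thesis by (simp add: inner_sum_left)
  qed
  have "(\<Sum>b\<in>Basis. A (B b) \<bullet> b) = (\<Sum>b\<in>Basis. \<Sum>c\<in>Basis. (B b \<bullet> c) * (A c \<bullet> b))"
    by (rule sum.cong[OF refl ex[OF assms(1)]])
  also have "\<dots> = (\<Sum>b\<in>Basis. \<Sum>c\<in>Basis. (A b \<bullet> c) * (B c \<bullet> b))"
    by (subst sum.swap) (simp add: mult.commute)
  also have "\<dots> = (\<Sum>b\<in>Basis. B (A b) \<bullet> b)"
    by (rule sum.cong[OF refl ex[OF assms(2), symmetric]])
  finally show ?thesis .
qed

text \<open>The differential of \<open>act A\<close> at \<open>x\<close>, expressed in the orthonormal frames at \<open>x\<close> and at its image.\<close>

definition turn :: "('a::euclidean_space \<times> real \<Rightarrow> 'a \<times> real) \<Rightarrow> 'a \<Rightarrow> 'a \<Rightarrow> 'a" where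
  "turn A x e = coframe (act A x) (A (frame x e))"

lemma frame_turn:
  assumes "lorentz A" "x \<in> hyp" shows "frame (act A x) (turn A x e) = A (frame x e)"
  unfolding turn_def
  by (rule frame_coframe[OF act_hyp[OF assms]])
    (simp only: lift_act[OF assms] lorentz_mink[OF assms(1)] mink_lift_frame[OF assms(2)])

lemma turn_inner:
  assumes "lorentz A" "x \<in> hyp" shows "turn A x v \<bullet> turn A x w = v \<bullet> w"
  using mink_frame[OF act_hyp[OF assms], of "turn A x v" "turn A x w"]
  by (simp only: frame_turn[OF assms] lorentz_mink[OF assms(1)] mink_frame[OF assms(2)])

lemma turn_norm:
  assumes "lorentz A" "x \<in> hyp" shows "norm (turn A x v) = norm v"
  using turn_inner[OF assms, of v v] by (simp add: norm_eq_sqrt_inner)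

lemma turn_linear: "lorentz A \<Longrightarrow> linear (turn A x)"
  unfolding turn_def[abs_def]
  using linear_compose[OF linear_compose[OF frame_linear[of x] lorentz_linear[of A]] coframe_linear]
  by (simp add: comp_def)

lemma act_geo:
  assumes A: "lorentz A" and x: "x \<in> hyp" and e: "norm e = 1"
  shows "act A (geo x e s) = geo (act A x) (turn A x e) s"
proof (rule lift_inj)
  have ne: "norm (turn A x e) = 1" using turn_norm[OF A x] e by simp
  show "act A (geo x e s) \<in> hyp" by (rule act_hyp[OF A geo_hyp[OF x e]])
  show "geo (act A x) (turn A x e) s \<in> hyp" by (rule geo_hyp[OF act_hyp[OF A x] ne])
  show "lift (act A (geo x e s)) = lift (geo (act A x) (turn A x e) s)"
    by (simp only: lift_act[OF A geo_hyp[OF x e]] lift_geo[OF x e] lift_geo[OF act_hyp[OF A x] ne]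
      lift_act[OF A x] frame_turn[OF A x] linear_add[OF lorentz_linear[OF A]] linear_cmul[OF lorentz_linear[OF A]])
qed

text \<open>An isometry maps geodesics to geodesics and turns the frames by an orthogonal map, which leaves the trace of
  the Hessian unchanged.\<close>

lemma has_hlap_act:
  assumes A: "lorentz A" and x: "x \<in> hyp" and u: "has_hlap u (act A x) d"
  shows "has_hlap (\<lambda>y. u (act A y)) x d"
proof -
  define T where "T = turn A x"
  have linT: "linear T" unfolding T_def by (rule turn_linear[OF A])
  have nT: "norm (T v) = norm v" for v unfolding T_def by (rule turn_norm[OF A x])
  have ort: "orthogonal_transformation T"
    by (simp add: orthogonal_transformation_def linT) (simp add: T_def turn_inner[OF A x])
  from u obtain Q where
    Q: "linear Q" "\<And>e. norm e = 1 \<Longrightarrow> second_derivative_at_0 (\<lambda>s. u (geo (act A x) e s)) (Q e \<bullet> e)" "d = (\<Sum>b\<in>Basis. Q b \<bullet> b)"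
    unfolding has_hlap_def by blast
  define R where "R v = adjoint T (Q (T v))" for v
  have linR: "linear R" unfolding R_def[abs_def]
    using linear_compose[OF linear_compose[OF linT Q(1)] adjoint_linear[OF linT]] by (simp add: comp_def)
  have TT: "T (adjoint T v) = v" for v
  proof -
    obtain w where w: "v = T w" using orthogonal_transformation_surj[OF ort] by (metis surjD)
    have "adjoint T (T w) = w"
    proof (rule vector_eq_rdot[THEN iffD1], rule allI)
      fix z show "adjoint T (T w) \<bullet> z = w \<bullet> z"
        using adjoint_works[OF linT, of z "T w"] ort by (simp add: orthogonal_transformation_def inner_commute)
    qed
    then show ?thesis by (simp add: w)
  qed
  have "(\<Sum>b\<in>Basis. R b \<bullet> b) = (\<Sum>b\<in>Basis. Q (T (adjoint T b)) \<bullet> b)"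
    unfolding R_def
    using trace_commute[OF adjoint_linear[OF linT] linear_compose[OF linT Q(1)]] by simp
  then have tr: "d = (\<Sum>b\<in>Basis. R b \<bullet> b)" by (simp add: TT Q(3))
  have sd: "second_derivative_at_0 (\<lambda>s. u (act A (geo x e s))) (R e \<bullet> e)" if e: "norm e = 1" for e
  proof -
    have "R e \<bullet> e = Q (T e) \<bullet> T e"
      using adjoint_works[OF linT, of e "Q (T e)"] by (simp add: R_def inner_commute)
    then show ?thesis using Q(2)[of "T e"] nT[of e] e by (simp add: act_geo[OF A x e] T_def)
  qed
  show ?thesis unfolding has_hlap_def
    by (rule exI[of _ R], rule conjI[OF linR conjI[OF _ tr]]) (intro allI impI, erule sd)
qed

subsection \<open>Comparison with the Laplacian in coordinates\<close>

lemma GDERIV_unique: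
  assumes "GDERIV u x :> D" "GDERIV u x :> D'" shows "D = D'"
proof -
  have "(\<lambda>h. h \<bullet> D) = (\<lambda>h. h \<bullet> D')"
    using assms unfolding gderiv_def by (rule has_derivative_unique)
  then have "h \<bullet> D = h \<bullet> D'" for h by (rule fun_cong)
  then have "\<forall>h. h \<bullet> D = h \<bullet> D'" by blast
  then show ?thesis unfolding vector_eq_ldot .
qed

lemma egrad_eq: "GDERIV u x :> G \<Longrightarrow> egrad u x = G"
  unfolding egrad_def by (rule the_equality) (auto intro: GDERIV_unique)

lemma GDERIV_along_curve:
  assumes "GDERIV u (\<gamma> s) :> G" "(\<gamma> has_vector_derivative v) (at s)"
  shows "((\<lambda>s. u (\<gamma> s)) has_real_derivative v \<bullet> G) (at s)"
proof -
  have "(u has_derivative (\<lambda>h. h \<bullet> G)) (at (\<gamma> s))" using assms(1) by (simp add: gderiv_def)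
  from has_derivative_compose[OF assms(2)[unfolded has_vector_derivative_def] this]
  show ?thesis unfolding has_field_derivative_def
    by (rule has_derivative_eq_rhs) (simp add: fun_eq_iff)
qed

text \<open>Along a geodesic the second derivative is the Euclidean Hessian plus the gradient applied to the acceleration,
  which is given by the Christoffel form. The trace of this correction is the first order term that \<open>hdiv\<close> produces
  from the volume density.\<close>

lemma has_hlap_C2:
  fixes u :: "'a::euclidean_space \<Rightarrow> real"
  assumes S: "open S" "S \<subseteq> hyp" "x \<in> S"
    and G: "\<And>y. y \<in> S \<Longrightarrow> GDERIV u y :> G y" and H: "(G has_derivative H) (at x)"
  shows "has_hlap u x (hlaplacian u x)"
proof -
  have x: "x \<in> hyp" using S by blast
  define c where "c = conf x"
  define n where "n = DIM('a)"
  have cp: "0 < c" unfolding c_def by (rule conf_pos[OF x])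
  have linH: "linear H" using H by (rule has_derivative_linear)
  define Q where "Q v = (1 / c\<^sup>2) *\<^sub>R (H v - (2 * c * (x \<bullet> v)) *\<^sub>R G x + (c * (x \<bullet> G x)) *\<^sub>R v)" for v
  have linQ: "linear Q"
    by (rule linearI) (auto simp: Q_def linear_add[OF linH] linear_cmul[OF linH] inner_simps algebra_simps)
  have sd: "second_derivative_at_0 (\<lambda>s. u (geo x e s)) (Q e \<bullet> e)" if e: "norm e = 1" for e
    unfolding second_derivative_at_0_def
  proof (intro exI conjI)
    have "\<forall>\<^sub>F y in nhds x. y \<in> S" using S by (simp add: eventually_nhds_in_open)
    from eventually_geo[OF x e this]
    show "\<forall>\<^sub>F s in nhds 0. ((\<lambda>s. u (geo x e s)) has_real_derivative
         velocity (geo x e) s \<bullet> G (geo x e s)) (at s)"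
      by eventually_elim (rule GDERIV_along_curve[OF G geo_has_derivative[OF x e]])
    have H': "(G has_derivative H) (at (geo x e 0))" by (simp add: geo_0[OF x] H)
    have dG: "((\<lambda>s. G (geo x e s)) has_vector_derivative H (velocity (geo x e) 0)) (at 0)"
      using has_derivative_compose[OF geo_has_derivative[OF x e, of 0, unfolded has_vector_derivative_def] H']
      by (simp add: has_vector_derivative_def linear_cmul[OF linH])
    have "((\<lambda>s. velocity (geo x e) s \<bullet> G (geo x e s)) has_vector_derivative
        (velocity (geo x e) 0 \<bullet> H (velocity (geo x e) 0) +
         (- christoffel (geo x e 0) (velocity (geo x e) 0) (velocity (geo x e) 0)) \<bullet> G (geo x e 0))) (at 0)"
      using bounded_bilinear.has_vector_derivative[OF bounded_bilinear_inner geo_velocity_derivative[OF x e] dG] .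
    moreover have "velocity (geo x e) 0 \<bullet> H (velocity (geo x e) 0) +
         (- christoffel (geo x e 0) (velocity (geo x e) 0) (velocity (geo x e) 0)) \<bullet> G (geo x e 0) = Q e \<bullet> e"
      unfolding geo_velocity[OF x e] geo_0[OF x] christoffel_def linear_cmul[OF linH] Q_def c_def[symmetric]
      using cp e by (simp add: inner_simps inner_commute algebra_simps power2_eq_square dot_square_norm)
    ultimately show "((\<lambda>s. velocity (geo x e) s \<bullet> G (geo x e s)) has_real_derivative Q e \<bullet> e) (at 0)"
      by (simp add: has_real_derivative_iff_has_vector_derivative)
  qed
  have tr: "hlaplacian u x = (\<Sum>b\<in>Basis. Q b \<bullet> b)"
  proof -
    define a where "a y = conf y ^ n / (conf y)\<^sup>2" for y :: 'a
    have q: "1 - (x \<bullet> x) \<noteq> 0" using hyp_norm[OF x] by (simp add: dot_square_norm)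
    have dconf: "(conf has_derivative (\<lambda>v. c\<^sup>2 * (x \<bullet> v))) (at x)"
    proof -
      have c: "c = 2 / (1 - x \<bullet> x)" by (simp add: c_def conf_def dot_square_norm)
      show ?thesis unfolding conf_def[abs_def] dot_square_norm[symmetric]
        using q by (auto intro!: derivative_eq_intros simp: c power2_eq_square inner_commute)
    qed
    have da: "(a has_derivative (\<lambda>v. (real n - 2) * c ^ (n - 1) * (x \<bullet> v))) (at x)"
    proof -
      obtain m where m: "n = Suc m" using DIM_positive[where 'a = 'a] by (metis n_def gr0_implies_Suc)
      have "(a has_derivative (\<lambda>v. - (c ^ n * (inverse (c\<^sup>2) * (2 * (c\<^sup>2 * (x \<bullet> v)) * c) * inverse (c\<^sup>2)))
          + real n * (c\<^sup>2 * (x \<bullet> v)) * c ^ (n - 1) / c\<^sup>2)) (at x)"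
        unfolding a_def[abs_def] using cp
        by (auto intro!: derivative_eq_intros dconf simp: c_def[symmetric] divide_inverse)
      moreover have "- (c ^ n * (inverse (c\<^sup>2) * (2 * (c\<^sup>2 * (x \<bullet> v)) * c) * inverse (c\<^sup>2)))
          + real n * (c\<^sup>2 * (x \<bullet> v)) * c ^ (n - 1) / c\<^sup>2 = (real n - 2) * c ^ (n - 1) * (x \<bullet> v)" for v
        using cp by (simp add: m field_simps power2_eq_square)
      ultimately show ?thesis by simp
    qed
    define F where "F y = conf y ^ n *\<^sub>R hgrad u y" for y
    have "((\<lambda>y. a y *\<^sub>R G y) has_derivative (\<lambda>v. a x *\<^sub>R H v + ((real n - 2) * c ^ (n - 1) * (x \<bullet> v)) *\<^sub>R G x)) (at x)"
      by (rule has_derivative_scaleR[OF da H])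
    then have dF: "(F has_derivative (\<lambda>v. a x *\<^sub>R H v + ((real n - 2) * c ^ (n - 1) * (x \<bullet> v)) *\<^sub>R G x)) (at x)"
      by (rule has_derivative_transform_within_open[OF _ S(1,3)])
        (simp add: F_def a_def hgrad_def egrad_eq[OF G])
    have "hlaplacian u x = (\<Sum>b\<in>Basis. (a x *\<^sub>R H b + ((real n - 2) * c ^ (n - 1) * (x \<bullet> b)) *\<^sub>R G x) \<bullet> b) / c ^ n"
      unfolding hlaplacian_def hdiv_def n_def[symmetric] F_def[symmetric]
        frechet_derivative_at[OF dF, symmetric] c_def[symmetric]
      by (rule refl)
    also have "(\<Sum>b\<in>Basis. (a x *\<^sub>R H b + ((real n - 2) * c ^ (n - 1) * (x \<bullet> b)) *\<^sub>R G x) \<bullet> b)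
       = a x * (\<Sum>b\<in>Basis. H b \<bullet> b) + (real n - 2) * c ^ (n - 1) * (x \<bullet> G x)"
      by (subst (4) euclidean_inner) (simp add: inner_add_left sum.distrib sum_distrib_left mult.assoc)
    also have "\<dots> / c ^ n = (1 / c\<^sup>2) * (\<Sum>b\<in>Basis. H b \<bullet> b) + ((real n - 2) / c) * (x \<bullet> G x)"
    proof -
      obtain m where m: "n = Suc m" using DIM_positive[where 'a = 'a] by (metis n_def gr0_implies_Suc)
      show ?thesis using cp by (simp add: a_def c_def[symmetric] m field_simps)
    qed
    also have "\<dots> = (\<Sum>b\<in>Basis. Q b \<bullet> b)"
    proof -
      have 1: "Q b \<bullet> b = (1 / c\<^sup>2) * (H b \<bullet> b - 2 * c * ((x \<bullet> b) * (G x \<bullet> b)) + c * (x \<bullet> G x))" if "b \<in> Basis" for b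
        using that by (simp add: Q_def inner_simps algebra_simps)
      have "(\<Sum>b\<in>Basis. Q b \<bullet> b) = (1 / c\<^sup>2) * ((\<Sum>b\<in>Basis. H b \<bullet> b) - 2 * c * (\<Sum>b\<in>Basis. (x \<bullet> b) * (G x \<bullet> b)) + n * (c * (x \<bullet> G x)))"
      proof -
        have "(\<Sum>b\<in>Basis. Q b \<bullet> b) = (1 / c\<^sup>2) * (\<Sum>b\<in>Basis. H b \<bullet> b - 2 * c * ((x \<bullet> b) * (G x \<bullet> b)) + c * (x \<bullet> G x))"
          by (subst sum_distrib_left) (rule sum.cong[OF refl 1])
        then show ?thesis
          by (simp only: sum.distrib sum_subtractf sum_distrib_left[symmetric] n_def sum_constant
              mult.left_commute[of c "real DIM('a)"])
      qed
      also have "(\<Sum>b\<in>Basis. (x \<bullet> b) * (G x \<bullet> b)) = x \<bullet> G x" by (rule euclidean_inner[symmetric])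
      finally show ?thesis using cp by (simp add: field_simps power2_eq_square)
    qed
    finally show ?thesis .
  qed
  show ?thesis unfolding has_hlap_def
    by (rule exI[of _ Q], rule conjI[OF linQ conjI[OF _ tr]]) (intro allI impI, erule sd)
qed

subsection \<open>Functions of a single Minkowski coordinate\<close>

lemma frame_trace:
  fixes x :: "'a::euclidean_space"
  assumes "x \<in> hyp"
  shows "(\<Sum>b\<in>Basis. (mink (frame x b) W)\<^sup>2) = mink W W + (mink (lift x) W)\<^sup>2"
proof -
  define \<sigma> where "\<sigma> = mink (lift x) W"
  define W' where "W' = W + \<sigma> *\<^sub>R lift x"
  have o: "mink (lift x) W' = 0" using assms by (simp add: W'_def mink_simps \<sigma>_def del: mem_ball mem_ball_0)
  have "mink (frame x b) W = b \<bullet> coframe x W'" for b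
  proof -
    have "mink (frame x b) W = mink (frame x b) W'"
      using mink_lift_frame[OF assms, of b] by (simp add: W'_def mink_simps mink_commute[of "frame x b" "lift x"])
    also have "\<dots> = mink (frame x b) (frame x (coframe x W'))" using frame_coframe[OF assms o] by simp
    finally show ?thesis by (simp add: mink_frame[OF assms])
  qed
  then have "(\<Sum>b\<in>Basis. (mink (frame x b) W)\<^sup>2) = (\<Sum>b\<in>Basis. (coframe x W' \<bullet> b) * (coframe x W' \<bullet> b))"
    by (simp add: power2_eq_square inner_commute)
  also have "\<dots> = coframe x W' \<bullet> coframe x W'" by (rule euclidean_inner[symmetric])
  also have "\<dots> = mink W' W'" by (rule coframe_inner[OF assms o o])
  also have "\<dots> = mink W W + \<sigma>\<^sup>2"
    using mink_lift_lift[OF assms] mink_commute[of W "lift x"]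
    by (simp add: W'_def mink_simps \<sigma>_def[symmetric] power2_eq_square)
  finally show ?thesis by (simp add: \<sigma>_def)
qed

text \<open>Along a unit speed geodesic a Minkowski coordinate is a combination of \<open>cosh\<close> and \<open>sinh\<close>, hence equal to its own
  second derivative. This gives the Laplacian of a function of one such coordinate in closed form; all comparison
  functions below are built in this way.\<close>

lemma has_hlap_coordinate:
  fixes x :: "'a::euclidean_space"
  assumes x: "x \<in> hyp"
    and 1: "\<forall>\<^sub>F t in nhds (mink (lift x) W). (\<psi> has_real_derivative \<psi>' t) (at t)"
    and 2: "(\<psi>' has_real_derivative \<psi>'') (at (mink (lift x) W))"
  shows "has_hlap (\<lambda>y. \<psi> (mink (lift y) W)) x
     ((mink W W + (mink (lift x) W)\<^sup>2) * \<psi>'' + real DIM('a) * (mink (lift x) W * \<psi>' (mink (lift x) W)))"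
proof -
  define \<sigma> where "\<sigma> = mink (lift x) W"
  define W' where "W' = W + \<sigma> *\<^sub>R lift x"
  have o: "mink (lift x) W' = 0" using x by (simp add: W'_def mink_simps \<sigma>_def del: mem_ball mem_ball_0)
  define w where "w = coframe x W'"
  have fw: "mink (frame x b) W = b \<bullet> w" for b
  proof -
    have "mink (frame x b) W = mink (frame x b) W'"
      using mink_lift_frame[OF x, of b] by (simp add: W'_def mink_simps mink_commute[of "frame x b" "lift x"])
    also have "\<dots> = mink (frame x b) (frame x (coframe x W'))" using frame_coframe[OF x o] by simp
    finally show ?thesis by (simp add: mink_frame[OF x] w_def)
  qed
  define Q where "Q v = (\<psi>'' * (v \<bullet> w)) *\<^sub>R w + (\<sigma> * \<psi>' \<sigma>) *\<^sub>R v" for v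
  have linQ: "linear Q" by (rule linearI) (auto simp: Q_def inner_simps algebra_simps)
  have sd: "second_derivative_at_0 (\<lambda>s. \<psi> (mink (lift (geo x e s)) W)) (Q e \<bullet> e)" if e: "norm e = 1" for e
  proof -
    define h where "h s = cosh s * \<sigma> + sinh s * (e \<bullet> w)" for s
    define h' where "h' s = sinh s * \<sigma> + cosh s * (e \<bullet> w)" for s
    have h: "mink (lift (geo x e s)) W = h s" for s
      by (simp add: lift_geo[OF x e] mink_simps h_def \<sigma>_def fw)
    have dh: "(h has_real_derivative h' s) (at s)" and dh': "(h' has_real_derivative h s) (at s)" for s
      unfolding h_def[abs_def] h'_def[abs_def] by (auto intro!: derivative_eq_intros)
    have h0: "h 0 = \<sigma>" "h' 0 = e \<bullet> w" by (simp_all add: h_def h'_def)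
    have lim: "filterlim h (nhds \<sigma>) (nhds 0)"
      using DERIV_isCont[OF dh, of 0] h0 by (metis isCont_def tendsto_at_iff_tendsto_nhds)
    have "\<forall>\<^sub>F s in nhds 0. (\<psi> has_real_derivative \<psi>' (h s)) (at (h s))"
      using filterlim_iff[THEN iffD1, OF lim] 1 unfolding \<sigma>_def by blast
    then have "\<forall>\<^sub>F s in nhds 0. ((\<lambda>s. \<psi> (h s)) has_real_derivative \<psi>' (h s) * h' s) (at s)"
      by eventually_elim (rule DERIV_chain2[OF _ dh])
    moreover have "((\<lambda>s. \<psi>' (h s) * h' s) has_real_derivative Q e \<bullet> e) (at 0)"
    proof -
      have "(\<psi>' has_real_derivative \<psi>'') (at (h 0))" using 2 by (simp add: h0 \<sigma>_def)
      from DERIV_mult[OF DERIV_chain2[OF this dh] dh'] show ?thesis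
        by (rule DERIV_cong) (simp add: h0 Q_def inner_simps dot_square_norm e inner_commute algebra_simps)
    qed
    ultimately show ?thesis unfolding second_derivative_at_0_def h
      by (intro exI[of _ "\<lambda>s. \<psi>' (h s) * h' s"]) simp
  qed
  have tr: "(mink W W + (mink (lift x) W)\<^sup>2) * \<psi>'' + real DIM('a) * (mink (lift x) W * \<psi>' (mink (lift x) W))
      = (\<Sum>b\<in>Basis. Q b \<bullet> b)"
  proof -
    have 1: "Q b \<bullet> b = \<psi>'' * (mink (frame x b) W)\<^sup>2 + \<sigma> * \<psi>' \<sigma>" if "b \<in> Basis" for b
      using that by (simp add: Q_def inner_simps fw power2_eq_square inner_commute)
    show ?thesis
      by (simp add: 1 sum.distrib sum_distrib_left[symmetric] frame_trace[OF x] \<sigma>_def)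
  qed
  show ?thesis unfolding has_hlap_def
    by (rule exI[of _ Q], rule conjI[OF linQ conjI[OF _ tr]]) (intro allI impI, erule sd)
qed

section \<open>The Hopf lemma and the strong maximum principle\<close>

lemma at_right_slope_ge:
  fixes g :: "real \<Rightarrow> real"
  assumes "(g has_real_derivative D) (at 0)" "g 0 = 0" "\<forall>\<^sub>F s in at_right 0. \<kappa> * s \<le> g s"
  shows "\<kappa> \<le> D"
proof -
  have "((\<lambda>s. g s / s) \<longlongrightarrow> D) (at 0)"
    using assms(1,2) by (simp add: has_field_derivative_iff)
  then have "((\<lambda>s. g s / s) \<longlongrightarrow> D) (at_right 0)"
    by (simp only: filterlim_at_split)
  moreover have "\<forall>\<^sub>F s in at_right 0. \<kappa> \<le> g s / s"
    using assms(3) eventually_at_right_less[of 0] by eventually_elim (simp add: pos_le_divide_eq)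
  ultimately show ?thesis by (rule tendsto_lowerbound) simp
qed

text \<open>The classical comparison function argument. Since \<open>conf x * ((dist x y)\<^sup>2 - R\<^sup>2)\<close> is affine in \<open>lift x\<close>, the
  Euclidean ball is a sublevel set of a Minkowski coordinate. An exponential of this coordinate is a subsolution near
  the boundary sphere, vanishes on it, and has a positive inward slope.\<close>

lemma hopf_lemma:
  fixes w :: "'a::euclidean_space \<Rightarrow> real"
  assumes R: "0 < R" and e: "norm e = 1" and y: "y = z + R *\<^sub>R e"
    and hyp: "cball y R \<subseteq> hyp" and K: "0 \<le> K"
    and cont: "continuous_on (cball y R) w"
    and pos: "\<And>x. x \<in> ball y R \<Longrightarrow> 0 < w x" and z: "w z = 0"
    and lap: "\<And>x. x \<in> ball y R \<Longrightarrow> \<exists>d. has_hlap w x d \<and> d \<le> K * w x"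
  shows "\<exists>\<kappa>>0. \<forall>\<^sub>F s in at_right 0. \<kappa> * s \<le> w (geo z e s)"
proof -
  (* W and k are chosen such that \<zeta> x = conf x * ((dist x y)^2 - R^2); see the fact \<zeta> below. *)
  define k where "k = 1 - (norm y)\<^sup>2 + R\<^sup>2"
  define W where "W = - (2 *\<^sub>R y, 1 + (norm y)\<^sup>2 - R\<^sup>2)"
  define t where "t x = mink (lift x) W" for x
  define \<zeta> where "\<zeta> x = t x - k" for x
  define n where "n = real DIM('a)"
  have "y \<in> cball y R" using R by simp
  then have yh: "y \<in> hyp" using hyp by blast
  have zc: "z \<in> cball y R" using R e by (simp add: y dist_norm)
  then have zh: "z \<in> hyp" using hyp by blast
  have kR: "R\<^sup>2 < k" using yh by (simp add: k_def abs_square_less_1)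
  then have k: "0 < k" using R by (meson less_trans zero_less_power)
  have WW: "mink W W + k\<^sup>2 = 4 * R\<^sup>2"
    by (simp add: W_def k_def mink_def dot_square_norm power2_eq_square algebra_simps)
  have \<zeta>: "\<zeta> x = conf x * ((dist x y)\<^sup>2 - R\<^sup>2)" if "x \<in> hyp" for x
  proof -
    have d: "(dist x y)\<^sup>2 = x \<bullet> x + (norm y)\<^sup>2 - 2 * (x \<bullet> y)"
      by (simp add: dist_norm power2_norm_eq_inner inner_simps inner_commute)
    have "conf x * ((dist x y)\<^sup>2 - R\<^sup>2) = conf x * (x \<bullet> x) + conf x * ((norm y)\<^sup>2 - R\<^sup>2) - 2 * conf x * (x \<bullet> y)"
      unfolding d by (simp add: algebra_simps)
    then show ?thesis
      by (simp add: conf_norm[OF that] \<zeta>_def t_def W_def mink_def lift_def k_def algebra_simps)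
  qed
  have cont_lift: "continuous_on hyp (\<lambda>x::'a. lift x)"
    unfolding lift_def conf_def
    by (intro continuous_intros) (use hyp_norm in force)+
  have cont\<zeta>: "continuous_on (cball y R) \<zeta>"
    unfolding \<zeta>_def[abs_def] t_def
    by (intro continuous_intros continuous_on_subset[OF cont_lift hyp])
  (* On the shell - \<delta> \<le> \<zeta> \<le> 0 the coordinate t is so close to k that mink W W + t^2 \<ge> 2 R^2. *)
  define \<delta> where "\<delta> = R\<^sup>2 / k"
  have \<delta>: "0 < \<delta>" "k * \<delta> = R\<^sup>2" using R k by (auto simp: \<delta>_def)
  define a where "a = max 1 ((n * k + K + 1) / (2 * R\<^sup>2))"
  have a1: "1 \<le> a" by (simp add: a_def)
  have "(n * k + K + 1) / (2 * R\<^sup>2) \<le> a" by (simp add: a_def)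
  then have a2: "n * k + K + 1 \<le> 2 * R\<^sup>2 * a" using R by (simp add: pos_divide_le_eq mult.commute)
  define h where "h x = exp (- a * (t x - k)) - 1" for x
  have lap_h: "\<exists>d'. has_hlap h x d' \<and> K * h x < d'" if x: "x \<in> hyp" "- \<delta> \<le> \<zeta> x" "\<zeta> x \<le> 0" for x
  proof -
    let ?E = "exp (- a * \<zeta> x)"
    have "has_hlap (\<lambda>y. (\<lambda>r. exp (- a * (r - k)) - 1) (mink (lift y) W)) x
       ((mink W W + (mink (lift x) W)\<^sup>2) * (a * a * exp (- a * (mink (lift x) W - k))) +
        real DIM('a) * (mink (lift x) W * (- a * exp (- a * (mink (lift x) W - k)))))"
      by (rule has_hlap_coordinate[OF x(1)]) (auto intro!: derivative_eq_intros always_eventually)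
    then have "has_hlap h x ((mink W W + (t x)\<^sup>2) * (a * a * ?E) + n * (t x * (- a * ?E)))"
      by (simp add: h_def[abs_def] t_def \<zeta>_def n_def)
    moreover have "K * h x < (mink W W + (t x)\<^sup>2) * (a * a * ?E) + n * (t x * (- a * ?E))"
    proof -
      have tx: "t x = k + \<zeta> x" by (simp add: \<zeta>_def)
      have "k * (- \<delta>) \<le> k * \<zeta> x" using x(2) k by (intro mult_left_mono) auto
      then have "- (R\<^sup>2) \<le> k * \<zeta> x" using \<delta>(2) by simp
      then have "k\<^sup>2 - 2 * R\<^sup>2 \<le> (t x)\<^sup>2"
        unfolding tx power2_sum using zero_le_power2[of "\<zeta> x"] by (simp add: algebra_simps)
      then have 1: "2 * R\<^sup>2 \<le> mink W W + (t x)\<^sup>2" using WW by simp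
      have n0: "0 \<le> n" by (simp add: n_def)
      have "n * t x \<le> n * k" using x(3) n0 by (simp add: tx mult_left_mono)
      then have 2: "K + 1 \<le> 2 * R\<^sup>2 * a - n * t x" using a2 by simp
      have "2 * R\<^sup>2 * a \<le> (mink W W + (t x)\<^sup>2) * a" using 1 a1 by (intro mult_right_mono) auto
      then have 3: "K + 1 \<le> (mink W W + (t x)\<^sup>2) * a - n * t x" using 2 by simp
      then have "1 * (K + 1) \<le> a * ((mink W W + (t x)\<^sup>2) * a - n * t x)" using a1 K by (intro mult_mono) auto
      then have "(K + 1) * ?E \<le> a * ((mink W W + (t x)\<^sup>2) * a - n * t x) * ?E" by (intro mult_right_mono) auto
      also have "\<dots> = (mink W W + (t x)\<^sup>2) * (a * a * ?E) + n * (t x * (- a * ?E))"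
        by (simp add: algebra_simps)
      finally have 4: "(K + 1) * ?E \<le> (mink W W + (t x)\<^sup>2) * (a * a * ?E) + n * (t x * (- a * ?E))" .
      have "h x = ?E - 1" by (simp add: h_def \<zeta>_def)
      then have "K * h x \<le> K * ?E" using K by (intro mult_left_mono) auto
      then have "K * h x < (K + 1) * ?E" using exp_gt_zero[of "- a * \<zeta> x"] unfolding distrib_right by linarith
      with 4 show ?thesis by simp
    qed
    ultimately show ?thesis by blast
  qed
  have w0: "0 \<le> w x" if "x \<in> cball y R" for x
  proof -
    have "closure (ball y R) = cball y R" using R by simp
    moreover have "continuous_on (closure (ball y R)) w" using cont R by simp
    ultimately show ?thesis
      using continuous_ge_on_closure[of "ball y R" w x 0] that pos by force
  qed
  have ball\<zeta>: "x \<in> ball y R" if "x \<in> hyp" "\<zeta> x < 0" for x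
  proof -
    have "(dist x y)\<^sup>2 < R\<^sup>2" using that conf_pos[OF that(1)] by (simp add: \<zeta> mult_less_0_iff)
    then show ?thesis using R by (simp add: dist_commute power_less_imp_less_base)
  qed
  define I where "I = {x \<in> cball y R. \<zeta> x \<le> - \<delta>}"
  have "compact I"
  proof -
    have "I = cball y R \<inter> \<zeta> -` {..- \<delta>}" by (auto simp: I_def)
    moreover have "closed (cball y R \<inter> \<zeta> -` {..- \<delta>})"
      by (rule continuous_closed_preimage[OF cont\<zeta> closed_cball closed_atMost])
    moreover have "bounded (cball y R \<inter> \<zeta> -` {..- \<delta>})" by (rule bounded_subset[OF bounded_cball]) auto
    ultimately show ?thesis by (simp only: compact_eq_bounded_closed simp_thms)
  qed
  obtain m where m: "0 < m" "\<And>x. x \<in> I \<Longrightarrow> m \<le> w x"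
  proof (cases "I = {}")
    case True then show ?thesis using that[of 1] by simp
  next
    case False
    have "continuous_on I w" using cont by (rule continuous_on_subset) (auto simp: I_def)
    from continuous_attains_inf[OF \<open>compact I\<close> False this]
    obtain x where x: "x \<in> I" "\<And>x'. x' \<in> I \<Longrightarrow> w x \<le> w x'" by blast
    have "x \<in> ball y R" using x(1) \<delta> hyp by (intro ball\<zeta>) (auto simp: I_def)
    then show ?thesis using that[of "w x"] pos x by blast
  qed
  define \<epsilon> where "\<epsilon> = m / (exp (a * \<delta>) - 1)"
  have H: "0 < exp (a * \<delta>) - 1" using a1 \<delta> by simp
  have \<epsilon>: "0 < \<epsilon>" using m H by (simp add: \<epsilon>_def)
  define A where "A = {x \<in> cball y R. - \<delta> \<le> \<zeta> x}"
  have "compact A"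
  proof -
    have "A = cball y R \<inter> \<zeta> -` {- \<delta>..}" by (auto simp: A_def)
    moreover have "closed (cball y R \<inter> \<zeta> -` {- \<delta>..})"
      by (rule continuous_closed_preimage[OF cont\<zeta> closed_cball closed_atLeast])
    moreover have "bounded (cball y R \<inter> \<zeta> -` {- \<delta>..})" by (rule bounded_subset[OF bounded_cball]) auto
    ultimately show ?thesis by (simp only: compact_eq_bounded_closed simp_thms)
  qed
  have \<zeta>z: "\<zeta> z = 0" using e R by (simp add: \<zeta>[OF zh] y dist_norm)
  have zA: "z \<in> A" using zc \<zeta>z \<delta> by (simp add: A_def)
  have conth: "continuous_on (cball y R) h"
  proof -
    have "continuous_on (cball y R) (\<lambda>x. exp (- a * \<zeta> x) - 1)" by (intro continuous_intros cont\<zeta>)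
    then show ?thesis by (simp add: h_def[abs_def] \<zeta>_def)
  qed
  have claim: "\<epsilon> * h x \<le> w x" if xA: "x \<in> A" for x
  proof (rule ccontr)
    assume neg: "\<not> \<epsilon> * h x \<le> w x"
    have "continuous_on A (\<lambda>x. w x - \<epsilon> * h x)"
      by (rule continuous_on_subset[of "cball y R"]) (auto intro!: continuous_intros cont conth simp: A_def)
    from continuous_attains_inf[OF \<open>compact A\<close> _ this] xA
    obtain x1 where x1: "x1 \<in> A" "\<And>x'. x' \<in> A \<Longrightarrow> w x1 - \<epsilon> * h x1 \<le> w x' - \<epsilon> * h x'" by blast
    have n1: "w x1 < \<epsilon> * h x1" using x1(2)[OF xA] neg by simp
    have x1c: "x1 \<in> cball y R" and x1h: "x1 \<in> hyp" using x1(1) hyp by (auto simp: A_def)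
    have \<zeta>1: "\<zeta> x1 < 0"
    proof (rule ccontr)
      assume "\<not> \<zeta> x1 < 0"
      then have "0 \<le> \<zeta> x1" by simp
      then have "h x1 \<le> 0" using a1 by (simp add: h_def \<zeta>_def[symmetric])
      then have "\<epsilon> * h x1 \<le> 0" using \<epsilon> by (simp add: mult_le_0_iff)
      then show False using w0[OF x1c] n1 by simp
    qed
    then have x1b: "x1 \<in> ball y R" by (rule ball\<zeta>[OF x1h])
    have \<zeta>2: "- \<delta> < \<zeta> x1"
    proof (rule ccontr)
      assume "\<not> - \<delta> < \<zeta> x1"
      then have eq: "\<zeta> x1 = - \<delta>" using x1(1) by (simp add: A_def)
      then have "m \<le> w x1" using m(2) x1c by (simp add: I_def)
      moreover have "\<epsilon> * h x1 = m" using a1 \<delta> eq by (simp add: h_def \<zeta>_def[symmetric] \<epsilon>_def)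
      ultimately show False using n1 by simp
    qed
    have "open {x \<in> ball y R. - \<delta> < \<zeta> x}"
    proof -
      have "open (ball y R \<inter> \<zeta> -` {- \<delta><..})"
        by (rule continuous_open_preimage[OF continuous_on_subset[OF cont\<zeta> ball_subset_cball] open_ball open_greaterThan])
      moreover have "ball y R \<inter> \<zeta> -` {- \<delta><..} = {x \<in> ball y R. - \<delta> < \<zeta> x}" by auto
      ultimately show ?thesis by simp
    qed
    then have "\<forall>\<^sub>F x in nhds x1. x \<in> {x \<in> ball y R. - \<delta> < \<zeta> x}"
      by (rule eventually_nhds_in_open) (use x1b \<zeta>2 in auto)
    then have min: "\<forall>\<^sub>F x in nhds x1. w x1 - \<epsilon> * h x1 \<le> w x - \<epsilon> * h x"
      by eventually_elim (rule x1(2), auto simp: A_def)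
    obtain d where d: "has_hlap w x1 d" "d \<le> K * w x1" using lap[OF x1b] by blast
    obtain d' where d': "has_hlap h x1 d'" "K * h x1 < d'"
      using lap_h[OF x1h] \<zeta>1 \<zeta>2 by force
    have "0 \<le> d - \<epsilon> * d'"
      by (rule has_hlap_local_min[OF x1h has_hlap_diff[OF d(1) has_hlap_cmult[OF d'(1)]] min])
    moreover have "K * w x1 \<le> K * (\<epsilon> * h x1)" using n1 K by (simp add: mult_left_mono)
    moreover have "\<epsilon> * (K * h x1) < \<epsilon> * d'" using d'(2) \<epsilon> by simp
    ultimately show False using d(2) by (simp add: algebra_simps)
  qed
  define g where "g s = \<zeta> (geo z e s)" for s
  have "((\<lambda>s. mink (lift (geo z e s)) W) has_real_derivative mink (frame z e) W) (at 0)"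
    unfolding lift_geo[OF zh e] mink_simps by (auto intro!: derivative_eq_intros)
  moreover have "mink (frame z e) W = - 2 * R"
  proof -
    have yy: "(norm y)\<^sup>2 = z \<bullet> z + 2 * R * (z \<bullet> e) + R\<^sup>2"
    proof -
      have "e \<bullet> e = 1" using e by (simp add: dot_square_norm)
      then show ?thesis
        by (simp add: y power2_norm_eq_inner inner_simps inner_commute algebra_simps) (simp add: power2_eq_square)
    qed
    have "mink (frame z e) W = conf z * (z \<bullet> e) - conf z * (z \<bullet> z) * (z \<bullet> e) - 2 * (z \<bullet> e) - 2 * R"
      using e by (simp add: frame_def W_def mink_def yy) (simp add: y inner_simps inner_commute dot_square_norm algebra_simps)
    then show ?thesis by (simp add: conf_norm[OF zh] algebra_simps)
  qed
  ultimately have dg: "(g has_real_derivative - 2 * R) (at 0)"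
    unfolding g_def[abs_def] \<zeta>_def t_def by (auto intro!: derivative_eq_intros)
  have g0: "g 0 = 0" by (simp add: g_def geo_0[OF zh] \<zeta>z)
  have "((\<lambda>s. g s / s) \<longlongrightarrow> - 2 * R) (at 0)" using dg g0 by (simp add: has_field_derivative_iff)
  then have "\<forall>\<^sub>F s in at 0. g s / s < - R" using R by (intro order_tendstoD) auto
  then have "\<forall>\<^sub>F s in at_right 0. g s / s < - R"
    by (simp only: eventually_at_split)
  moreover have "\<forall>\<^sub>F s in at_right 0. - \<delta> < g s"
  proof -
    have "(g \<longlongrightarrow> g 0) (at 0)" using DERIV_isCont[OF dg] by (simp add: isCont_def)
    then have "(g \<longlongrightarrow> 0) (at_right 0)" unfolding g0 by (simp only: filterlim_at_split)
    then show ?thesis using \<delta> by (intro order_tendstoD) auto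
  qed
  ultimately have "\<forall>\<^sub>F s in at_right 0. \<epsilon> * a * R * s \<le> w (geo z e s)"
    using eventually_at_right_less[of 0]
  proof eventually_elim
    case (elim s)
    have gh: "geo z e s \<in> hyp" by (rule geo_hyp[OF zh e])
    have gs: "g s < - R * s" using elim by (simp add: pos_divide_less_eq)
    moreover have "0 < R * s" using elim R by simp
    ultimately have "g s < 0" by simp
    then have "geo z e s \<in> ball y R" using ball\<zeta>[OF gh] by (simp add: g_def)
    then have "geo z e s \<in> A" using elim by (simp add: A_def g_def)
    from claim[OF this] have "\<epsilon> * (exp (- a * g s) - 1) \<le> w (geo z e s)" by (simp add: h_def g_def \<zeta>_def)
    moreover have "a * (R * s) \<le> a * (- g s)" using gs a1 by (intro mult_left_mono) auto
    moreover have "1 + (- a * g s) \<le> exp (- a * g s)" by (rule exp_ge_add_one_self)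
    ultimately have le: "\<epsilon> * (exp (- a * g s) - 1) \<le> w (geo z e s)" and "a * (R * s) \<le> exp (- a * g s) - 1"
      by auto
    from mult_left_mono[OF this(2), of \<epsilon>] \<epsilon> le have "\<epsilon> * (a * (R * s)) \<le> w (geo z e s)"
      by linarith
    then show ?case by (simp add: mult.assoc)
  qed
  moreover have "0 < \<epsilon> * a * R" using \<epsilon> a1 R by simp
  ultimately show ?thesis by blast
qed

text \<open>If the zero set were not open, a ball in the positivity set would touch it at a point where \<open>w\<close> has a minimum.
  Its slope there is zero, against the Hopf lemma.\<close>

lemma strong_maximum_principle:
  fixes w :: "'a::euclidean_space \<Rightarrow> real"
  assumes D: "open D" "connected D" "D \<subseteq> hyp" and K: "0 \<le> K"
    and nonneg: "\<And>x. x \<in> D \<Longrightarrow> 0 \<le> w x"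
    and cont: "continuous_on D w"
    and lap: "\<And>x. x \<in> D \<Longrightarrow> \<exists>d. has_hlap w x d \<and> d \<le> K * w x"
    and x0: "x0 \<in> D" "w x0 = 0" and x: "x \<in> D"
  shows "w x = 0"
proof -
  define Z where "Z = {x \<in> D. w x = 0}"
  have clo: "closedin (top_of_set D) Z"
    unfolding Z_def using continuous_closedin_preimage_constant[OF cont, of 0] by simp
  have "open Z"
  proof (rule ccontr)
    assume "\<not> open Z"
    then obtain x where xZ: "x \<in> Z" and no: "\<not> (\<exists>T. open T \<and> x \<in> T \<and> T \<subseteq> Z)"
      using open_subopen[of Z] by blast
    then have xD: "x \<in> D" "w x = 0" by (auto simp: Z_def)
    obtain r where r: "0 < r" "cball x r \<subseteq> D" using D(1) xD(1) open_contains_cball by blast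
    have "\<not> ball x (r / 2) \<subseteq> Z" using no r by (metis centre_in_ball half_gt_zero open_ball)
    then obtain y where y: "dist x y < r / 2" "y \<notin> Z" by (meson mem_ball subsetI)
    have yc: "y \<in> cball x r" using y r by simp
    have yD: "y \<in> D" using yc r(2) by blast
    have wy: "w y \<noteq> 0" using y yD by (simp add: Z_def)
    define S where "S = {z \<in> cball x r. w z = 0}"
    have "closed S"
      unfolding S_def by (rule continuous_closed_preimage_constant[OF continuous_on_subset[OF cont r(2)] closed_cball])
    moreover have xS: "x \<in> S" using xD r by (simp add: S_def)
    ultimately obtain z where z: "z \<in> S" "infdist y S = dist y z"
      using infdist_attains_inf[of S y] by blast
    (* The largest ball around y without a zero of w touches the zero set at z. *)
    define R where "R = dist y z"
    have Rle: "R \<le> dist y s" if "s \<in> S" for s unfolding R_def z(2)[symmetric] by (rule infdist_le[OF that])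
    have Rr: "R < r / 2" using Rle[OF xS] y by (simp add: dist_commute)
    have zy: "z \<noteq> y" using z(1) wy by (auto simp: S_def)
    then have R: "0 < R" by (simp add: R_def)
    define e where "e = (1 / R) *\<^sub>R (y - z)"
    have e: "norm e = 1" using R by (simp add: e_def R_def dist_norm)
    have yz: "y = z + R *\<^sub>R e" using R by (simp add: e_def)
    have sub: "cball y R \<subseteq> cball x r"
    proof
      fix p assume "p \<in> cball y R"
      then have "dist x p \<le> dist x y + R" using dist_triangle[of x p y] by simp
      then show "p \<in> cball x r" using y Rr by simp
    qed
    have zD: "z \<in> D" "w z = 0" using z(1) r by (auto simp: S_def)
    have "\<exists>\<kappa>>0. \<forall>\<^sub>F s in at_right 0. \<kappa> * s \<le> w (geo z e s)"
    proof (rule hopf_lemma[OF R e yz _ K])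
      show "cball y R \<subseteq> hyp" using sub r D by blast
      show "continuous_on (cball y R) w" by (rule continuous_on_subset[OF cont]) (use sub r in blast)
      fix p assume p: "p \<in> ball y R"
      then have pc: "p \<in> cball x r" using sub by (meson ball_subset_cball subsetD)
      then have pD: "p \<in> D" using r by blast
      have "p \<notin> S" using Rle[of p] p by auto
      then show "0 < w p" using nonneg[OF pD] pc by (simp add: S_def)
      show "\<exists>d. has_hlap w p d \<and> d \<le> K * w p" by (rule lap[OF pD])
    qed (rule zD(2))
    then obtain \<kappa> where \<kappa>: "0 < \<kappa>" "\<forall>\<^sub>F s in at_right 0. \<kappa> * s \<le> w (geo z e s)" by blast
    have zh: "z \<in> hyp" using zD D by blast
    obtain d where "has_hlap w z d" using lap[OF zD(1)] by blast
    then obtain D' where D': "((\<lambda>s. w (geo z e s)) has_real_derivative D') (at 0)"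
      using has_hlap_derivative[OF _ e] by blast
    have "\<forall>\<^sub>F x in nhds z. x \<in> D" using D(1) zD(1) by (simp add: eventually_nhds_in_open)
    from eventually_geo[OF zh e this] obtain r' where r': "0 < r'" "\<And>s. \<bar>s\<bar> < r' \<Longrightarrow> geo z e s \<in> D"
      unfolding eventually_nhds_metric dist_real_def by auto
    have "D' = 0"
      by (rule DERIV_local_min[OF D' r'(1)]) (use r'(2) nonneg in \<open>simp add: geo_0[OF zh] zD(2)\<close>)
    with D' have "((\<lambda>s. w (geo z e s)) has_real_derivative 0) (at 0)" by simp
    from at_right_slope_ge[OF this _ \<kappa>(2)] show False using \<kappa>(1) by (simp add: geo_0[OF zh] zD(2))
  qed
  then have "openin (top_of_set D) Z" by (simp add: openin_open_eq[OF D(1)] Z_def)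
  then have "Z = {} \<or> Z = D" using D(2) clo unfolding connected_clopen by blast
  then have "Z = D" using x0 by (auto simp: Z_def)
  then show ?thesis using x by (auto simp: Z_def)
qed

section \<open>A superharmonic function that blows up along an equator\<close>

text \<open>With \<open>s\<close> the signed distance to \<open>plane M\<close> and \<open>d\<close> the distance in the plane from \<open>proj T\<close> to the foot point,
  the coordinates are \<open>sinh s\<close> and \<open>cosh s * cosh d\<close>. So the two logarithms add up to \<open>ln (cosh d)\<close>, which tends to
  infinity at the equator from all directions, even tangentially to the sphere. The last summand makes the function
  strictly superharmonic.\<close>

definition barrier :: "'a::euclidean_space \<times> real \<Rightarrow> 'a \<times> real \<Rightarrow> 'a \<Rightarrow> real" where
  "barrier M T x = ln (mink (lift x) (- T))
     + (- (ln (1 + (mink (lift x) M)\<^sup>2) / 2) + 4 * real DIM('a) * (1 + (mink (lift x) M)\<^sup>2) powr (- 1 / 4))"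

text \<open>After removing the \<open>M\<close> component and normalising, \<open>X\<close> is again a point of the hyperboloid, and its product with
  \<open>T\<close> is at most \<open>-1\<close>.\<close>

lemma hyperboloid_coordinates:
  assumes X: "X \<in> hyperboloid" and T: "T \<in> hyperboloid" and M: "mink T M = 0" "mink M M = 1"
  shows "1 + (mink X M)\<^sup>2 \<le> (mink X (- T))\<^sup>2" and "0 < mink X (- T)"
proof -
  show p: "0 < mink X (- T)" using mink_future_neg[OF X hyperboloid_future[OF T]] by (simp add: mink_simps)
  define y where "y = 1 + (mink X M)\<^sup>2"
  have y: "0 < y" by (simp add: y_def add_pos_nonneg)
  define X' where "X' = (1 / sqrt y) *\<^sub>R (X - mink X M *\<^sub>R M)"
  have TX: "mink T X' = mink X T / sqrt y"
    using M by (simp add: X'_def mink_simps mink_commute[of T X])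
  have "mink (X - mink X M *\<^sub>R M) (X - mink X M *\<^sub>R M) = - y"
    using X M mink_commute[of M X] by (simp add: mink_simps y_def hyperboloid_def power2_eq_square)
  then have "mink X' X' = (1 / sqrt y * (1 / sqrt y)) * (- y)" by (simp add: X'_def mink_scale_left mink_scale_right)
  also have "\<dots> = -1" using y by simp
  finally have "mink X' X' = -1" .
  then have "X' \<in> hyperboloid" using p y by (intro hyperboloidI[OF T]) (auto simp: TX mink_simps divide_neg_pos)
  from mink_hyperboloid_le(1)[OF T this] have "1 \<le> mink X (- T) / sqrt y" by (simp add: TX mink_simps)
  then have "sqrt y \<le> mink X (- T)" using y by (simp add: le_divide_eq_1)
  then have "(sqrt y)\<^sup>2 \<le> (mink X (- T))\<^sup>2" using y by (intro power_mono) auto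
  then show "1 + (mink X M)\<^sup>2 \<le> (mink X (- T))\<^sup>2" using y by (simp add: y_def)
qed

lemma barrier_ge:
  assumes x: "x \<in> hyp" and T: "T \<in> hyperboloid" and M: "mink T M = 0" "mink M M = 1"
  shows "ln ((mink (lift x) T)\<^sup>2 / (1 + (mink (lift x) M)\<^sup>2)) / 2 \<le> barrier M T x" and "0 < barrier M T x"
proof -
  note c = hyperboloid_coordinates[OF lift_hyperboloid[OF x] T M]
  define y where "y = 1 + (mink (lift x) M)\<^sup>2"
  have y: "0 < y" by (simp add: y_def add_pos_nonneg)
  have t: "(mink (lift x) T)\<^sup>2 = (mink (lift x) (- T))\<^sup>2" by (simp add: mink_simps)
  have "ln ((mink (lift x) T)\<^sup>2 / y) / 2 = ln (mink (lift x) (- T)) - ln y / 2"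
    unfolding t using c y by (simp add: ln_div ln_realpow)
  moreover have "0 < 4 * real DIM('a) * y powr (- 1 / 4)" using y by simp
  ultimately have 1: "ln ((mink (lift x) T)\<^sup>2 / y) / 2 < barrier M T x"
    by (simp add: barrier_def y_def)
  then show "ln ((mink (lift x) T)\<^sup>2 / (1 + (mink (lift x) M)\<^sup>2)) / 2 \<le> barrier M T x" by (simp add: y_def)
  have "1 \<le> (mink (lift x) T)\<^sup>2 / y" unfolding t using c y by (simp add: y_def)
  then have "0 \<le> ln ((mink (lift x) T)\<^sup>2 / y)" by simp
  then show "0 < barrier M T x" using 1 by simp
qed

text \<open>The logarithms contribute at most \<open>(n - 1) / y\<close> with \<open>y = 1 + \<sigma>\<^sup>2\<close>, because \<open>y \<le> \<tau>\<^sup>2\<close>. The power contributes at most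
  \<open>- n * y powr (- 1 / 4)\<close>, which dominates since \<open>y \<ge> 1\<close>.\<close>

lemma barrier_superharmonic:
  fixes x :: "'a::euclidean_space"
  assumes dim: "2 \<le> DIM('a)" and x: "x \<in> hyp" and T: "T \<in> hyperboloid" and M: "mink T M = 0" "mink M M = 1"
  shows "\<exists>d<0. has_hlap (barrier M T) x d"
proof -
  note c = hyperboloid_coordinates[OF lift_hyperboloid[OF x] T M]
  define n where "n = real DIM('a)"
  have n: "2 \<le> n" using dim by (simp add: n_def)
  define \<tau> where "\<tau> = mink (lift x) (- T)"
  define \<sigma> where "\<sigma> = mink (lift x) M"
  define y where "y = 1 + \<sigma>\<^sup>2"
  have y1: "1 \<le> y" by (simp add: y_def)
  have \<tau>: "0 < \<tau>" "y \<le> \<tau>\<^sup>2" using c by (simp_all add: \<tau>_def \<sigma>_def y_def)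
  define q where "q = y powr (- 1 / 4)"
  have pp: "0 < 1 + s\<^sup>2" for s :: real by (simp add: add_pos_nonneg)
  have h1: "has_hlap (\<lambda>z. ln (mink (lift z) (- T))) x
     ((mink (- T) (- T) + (mink (lift x) (- T))\<^sup>2) * (- (1 / \<tau>\<^sup>2)) + real DIM('a) * (mink (lift x) (- T) * (1 / mink (lift x) (- T))))"
  proof (rule has_hlap_coordinate[OF x, where \<psi>' = "\<lambda>t. 1 / t"])
    have "\<forall>\<^sub>F t in nhds (mink (lift x) (- T)). t \<in> {0<..}"
      using \<tau>(1) by (intro eventually_nhds_in_open) (simp_all add: \<tau>_def)
    then show "\<forall>\<^sub>F t in nhds (mink (lift x) (- T)). (ln has_real_derivative 1 / t) (at t)"
      by eventually_elim (auto intro!: derivative_eq_intros)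
    show "((\<lambda>t. 1 / t) has_real_derivative - (1 / \<tau>\<^sup>2)) (at (mink (lift x) (- T)))"
      using \<tau>(1) by (auto intro!: derivative_eq_intros simp: \<tau>_def power2_eq_square)
  qed
  define \<psi> where "\<psi> s = - (ln (1 + s\<^sup>2) / 2) + 4 * n * (1 + s\<^sup>2) powr (- 1 / 4)" for s :: real
  define \<psi>1 where "\<psi>1 s = - (s / (1 + s\<^sup>2)) - 2 * n * (s * (1 + s\<^sup>2) powr (- 5 / 4))" for s :: real
  define \<psi>2 where "\<psi>2 = - ((1 - \<sigma>\<^sup>2) / y\<^sup>2) - 2 * n * (q / y) + 5 * n * (\<sigma>\<^sup>2 * (q / y\<^sup>2))"
  have q1: "y powr (- 5 / 4) = q / y"
    using powr_diff[of y "- 1 / 4" 1] y1 by (simp add: q_def)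
  have q2: "y powr (- 9 / 4) = q / y\<^sup>2"
    using powr_diff[of y "- 1 / 4" 2] y1 by (simp add: q_def powr_numeral)
  have h2: "has_hlap (\<lambda>z. \<psi> (mink (lift z) M)) x
     ((mink M M + (mink (lift x) M)\<^sup>2) * \<psi>2 + real DIM('a) * (mink (lift x) M * \<psi>1 (mink (lift x) M)))"
  proof (rule has_hlap_coordinate[OF x])
    have "(\<psi> has_real_derivative \<psi>1 s) (at s)" for s
    proof -
      have "((\<lambda>s. - (ln (1 + s\<^sup>2) / 2)) has_real_derivative - (s / (1 + s\<^sup>2))) (at s)"
        using pp[of s] by (auto intro!: derivative_eq_intros) (simp add: field_simps)
      moreover have "((\<lambda>s. 4 * n * (1 + s\<^sup>2) powr (- 1 / 4)) has_real_derivative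
          - (2 * n * (s * (1 + s\<^sup>2) powr (- 5 / 4)))) (at s)"
        using pp[of s] by (auto intro!: derivative_eq_intros)
      ultimately show ?thesis
        unfolding \<psi>_def[abs_def] \<psi>1_def using DERIV_add by fastforce
    qed
    then show "\<forall>\<^sub>F s in nhds (mink (lift x) M). (\<psi> has_real_derivative \<psi>1 s) (at s)"
      by (intro always_eventually allI)
    have d1: "((\<lambda>s. - (s / (1 + s\<^sup>2))) has_real_derivative - ((1 - \<sigma>\<^sup>2) / y\<^sup>2)) (at \<sigma>)"
      using pp[of \<sigma>] y1 unfolding y_def
      by (auto intro!: derivative_eq_intros simp: power2_eq_square algebra_simps)
    have d2: "((\<lambda>s. s * (1 + s\<^sup>2) powr (- 5 / 4)) has_real_derivative
         y powr (- 5 / 4) + \<sigma> * ((- 5 / 4) * y powr (- 9 / 4) * (2 * \<sigma>))) (at \<sigma>)"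
      using pp[of \<sigma>] unfolding y_def
      by (auto intro!: derivative_eq_intros)
    from DERIV_diff[OF d1 DERIV_cmult[OF d2, of "2 * n"]]
    show "(\<psi>1 has_real_derivative \<psi>2) (at (mink (lift x) M))"
      unfolding \<psi>1_def[abs_def] \<sigma>_def[symmetric]
      by (rule DERIV_cong) (unfold q1 q2 \<psi>2_def, simp add: algebra_simps power2_eq_square)
  qed
  define d where "d = ((mink (- T) (- T) + (mink (lift x) (- T))\<^sup>2) * (- (1 / \<tau>\<^sup>2)) + real DIM('a) * (mink (lift x) (- T) * (1 / mink (lift x) (- T))))
     + ((mink M M + (mink (lift x) M)\<^sup>2) * \<psi>2 + real DIM('a) * (mink (lift x) M * \<psi>1 (mink (lift x) M)))"
  have "has_hlap (barrier M T) x d"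
    using has_hlap_add[OF h1 h2] unfolding d_def barrier_def[abs_def] \<psi>_def n_def .
  moreover have "d < 0"
  proof -
    have TT: "mink (- T) (- T) = -1" using T by (simp add: hyperboloid_def mink_simps)
    have qy: "1 / y \<le> q"
      using powr_mono[of "-1" "- 1 / 4" y] y1 by (simp add: q_def powr_minus_divide)
    have e1: "(-1 + \<tau>\<^sup>2) * (- (1 / \<tau>\<^sup>2)) + n * (\<tau> * (1 / \<tau>)) = n - 1 + 1 / \<tau>\<^sup>2"
      using \<tau>(1) by (simp add: field_simps)
    have s2: "\<sigma>\<^sup>2 = y - 1" by (simp add: y_def)
    have "y * \<psi>2 + n * (\<sigma> * \<psi>1 \<sigma>) =
       - ((1 - \<sigma>\<^sup>2) / y) - n * (\<sigma>\<^sup>2 / y) - 2 * n * q + 5 * n * (\<sigma>\<^sup>2 * (q / y)) - 2 * n * n * (\<sigma>\<^sup>2 * (q / y))"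
      using y1 unfolding \<psi>2_def \<psi>1_def y_def[symmetric] q1 by (simp add: field_simps power2_eq_square)
    also have "\<dots> = - (n - 1) + (n - 2) / y + n * (q / y) * (- 2 * y + 5 * \<sigma>\<^sup>2 - 2 * n * \<sigma>\<^sup>2)"
      using y1 unfolding s2 by (simp add: field_simps)
    finally have e2: "y * \<psi>2 + n * (\<sigma> * \<psi>1 \<sigma>) =
       - (n - 1) + (n - 2) / y + n * (q / y) * (- 2 * y + 5 * \<sigma>\<^sup>2 - 2 * n * \<sigma>\<^sup>2)" .
    have "- 2 * y + 5 * \<sigma>\<^sup>2 - 2 * n * \<sigma>\<^sup>2 \<le> - y"
    proof -
      have "4 * \<sigma>\<^sup>2 \<le> 2 * n * \<sigma>\<^sup>2" using n by (intro mult_right_mono) auto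
      then show ?thesis by (simp add: y_def)
    qed
    then have "n * (q / y) * (- 2 * y + 5 * \<sigma>\<^sup>2 - 2 * n * \<sigma>\<^sup>2) \<le> n * (q / y) * (- y)"
      using n y1 by (intro mult_left_mono) (auto simp: q_def)
    also have "\<dots> = - n * q" using y1 by simp
    also have "\<dots> \<le> - n * (1 / y)" using mult_left_mono[OF qy, of n] n by simp
    finally have e3: "n * (q / y) * (- 2 * y + 5 * \<sigma>\<^sup>2 - 2 * n * \<sigma>\<^sup>2) \<le> - n * (1 / y)" .
    have "1 / \<tau>\<^sup>2 \<le> 1 / y" using \<tau> y1 by (intro divide_left_mono) auto
    moreover have "d = n - 1 + 1 / \<tau>\<^sup>2 + (y * \<psi>2 + n * (\<sigma> * \<psi>1 \<sigma>))"
      unfolding d_def TT M(2) \<tau>_def[symmetric] \<sigma>_def[symmetric] n_def[symmetric] y_def[symmetric] e1 ..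
    moreover have "1 / y + (n - 2) / y - n * (1 / y) = - 1 / y" by (simp add: diff_divide_distrib)
    moreover have "- 1 / y < 0" using y1 by simp
    ultimately show "d < 0" unfolding e2 using e3 by linarith
  qed
  ultimately show ?thesis by blast
qed

text \<open>Multiplying numerator and denominator by \<open>(1 - (norm x)\<^sup>2)\<^sup>2\<close> turns the quotient of the coordinates into one of
  functions that are continuous up to the sphere; there the denominator vanishes exactly on the equator.\<close>

lemma barrier_blow_up:
  assumes T: "T \<in> hyperboloid" and M: "mink T M = 0" "mink M M = 1"
    and X: "\<And>k. X k \<in> hyp" "X \<longlonglongrightarrow> \<xi>" "norm \<xi> = 1" "mink (conevec \<xi>) M = 0"
  shows "filterlim (\<lambda>k::nat. barrier M T (X k)) at_top sequentially"
proof -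
  define q where "q k = 1 - (norm (X k))\<^sup>2" for k
  have q: "0 < q k" for k unfolding q_def by (rule hyp_norm[OF X(1)])
  have ql: "q \<longlonglongrightarrow> 0"
    unfolding q_def[abs_def] using tendsto_diff[OF tendsto_const[of 1] tendsto_power[OF tendsto_norm[OF X(2)], of 2]] X(3) by simp
  have cl: "(\<lambda>k. conevec (X k)) \<longlonglongrightarrow> conevec \<xi>" by (rule tendsto_conevec[OF X(2)])
  have num: "(\<lambda>k. (mink (conevec (X k)) T)\<^sup>2) \<longlonglongrightarrow> (mink (conevec \<xi>) T)\<^sup>2"
    by (intro tendsto_intros cl)
  have den: "(\<lambda>k. (q k)\<^sup>2 + (mink (conevec (X k)) M)\<^sup>2) \<longlonglongrightarrow> 0"
    using tendsto_add[OF tendsto_power[OF ql, of 2] tendsto_power[OF tendsto_mink[OF cl tendsto_const[of M]], of 2]] X(4) by simp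
  have "mink T (conevec \<xi>) < 0" by (rule mink_future_neg[OF T conevec_future]) (simp add: X(3))
  then have pos: "0 < (mink (conevec \<xi>) T)\<^sup>2" by (simp add: mink_commute)
  have "filterlim (\<lambda>k. (mink (conevec (X k)) T)\<^sup>2 / ((q k)\<^sup>2 + (mink (conevec (X k)) M)\<^sup>2)) at_top sequentially"
    by (rule LIM_at_top_divide[OF num pos den]) (use q in \<open>auto intro!: always_eventually add_pos_nonneg simp: less_le\<close>)
  moreover have "(mink (conevec (X k)) T)\<^sup>2 / ((q k)\<^sup>2 + (mink (conevec (X k)) M)\<^sup>2)
      = (mink (lift (X k)) T)\<^sup>2 / (1 + (mink (lift (X k)) M)\<^sup>2)" for k
  proof -
    have e: "mink (conevec (X k)) W = q k * mink (lift (X k)) W" for W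
      by (simp only: conevec_lift[OF X(1)] mink_simps q_def)
    have "(q k)\<^sup>2 + (mink (conevec (X k)) M)\<^sup>2 = (q k)\<^sup>2 * (1 + (mink (lift (X k)) M)\<^sup>2)"
      by (simp add: e power_mult_distrib algebra_simps)
    then show ?thesis using q[of k] by (simp add: e power_mult_distrib)
  qed
  ultimately have "filterlim (\<lambda>k. (mink (lift (X k)) T)\<^sup>2 / (1 + (mink (lift (X k)) M)\<^sup>2)) at_top sequentially" by simp
  from filterlim_compose[OF ln_at_top this]
  have l: "filterlim (\<lambda>k. ln ((mink (lift (X k)) T)\<^sup>2 / (1 + (mink (lift (X k)) M)\<^sup>2))) at_top sequentially" .
  have "filterlim (\<lambda>k. ln ((mink (lift (X k)) T)\<^sup>2 / (1 + (mink (lift (X k)) M)\<^sup>2)) * (1 / 2)) at_top sequentially"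
    by (rule filterlim_at_top_mult_tendsto_pos[OF tendsto_const _ l]) simp
  then show ?thesis
    by (rule filterlim_at_top_mono) (use barrier_ge(1)[OF X(1) T M] in \<open>auto intro!: always_eventually\<close>)
qed

section \<open>Boundary points of a smooth domain\<close>

lemma C2_domain_local:
  assumes dom: "C2_domain \<Omega>" and p: "p \<in> hboundary \<Omega>"
  obtains U \<phi> G H where "p \<in> U" "open U" "U \<subseteq> hyp" "\<And>x. x \<in> U \<Longrightarrow> GDERIV \<phi> x :> G x" "(G has_derivative H) (at p)"
    "G p \<noteq> 0" "\<And>x. x \<in> U \<Longrightarrow> x \<in> \<Omega> \<longleftrightarrow> \<phi> x < 0" "\<And>x. x \<in> U \<Longrightarrow> x \<in> hboundary \<Omega> \<longleftrightarrow> \<phi> x = 0"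
    "\<And>x. x \<in> U \<Longrightarrow> 0 < \<phi> x \<Longrightarrow> x \<notin> closure \<Omega>"
proof -
  obtain U \<phi> where U: "p \<in> U" "regular_C2_on U \<phi>"
    "\<Omega> \<inter> U = {x \<in> U. \<phi> x < 0}" "hboundary \<Omega> \<inter> U = {x \<in> U. \<phi> x = 0}"
    using dom p unfolding C2_domain_def by blast
  have op: "open U" "U \<subseteq> hyp" and C2: "C2_on U \<phi>" and nz: "egrad \<phi> p \<noteq> 0"
    using U(1,2) by (auto simp: regular_C2_on_def)
  obtain G H where GH: "\<And>x. x \<in> U \<Longrightarrow> GDERIV \<phi> x :> G x" "\<And>x. x \<in> U \<Longrightarrow> (G has_derivative blinfun_apply (H x)) (at x)"
    using C2 unfolding C2_on_def by blast
  have i1: "x \<in> \<Omega> \<longleftrightarrow> \<phi> x < 0" and i2: "x \<in> hboundary \<Omega> \<longleftrightarrow> \<phi> x = 0" if "x \<in> U" for x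
    using U(3,4) that by auto
  have i3: "x \<notin> closure \<Omega>" if "x \<in> U" "0 < \<phi> x" for x
  proof
    assume "x \<in> closure \<Omega>"
    moreover have "x \<notin> \<Omega>" using i1 that by force
    moreover have "interior \<Omega> \<subseteq> \<Omega>" by (rule interior_subset)
    ultimately have "x \<in> hboundary \<Omega>" using that op by (auto simp: hboundary_def frontier_def)
    then show False using i2 that by force
  qed
  show ?thesis
    using that[of U \<phi> G "blinfun_apply (H p)"] U(1) op GH nz i1 i2 i3 egrad_eq[OF GH(1)[OF U(1)]] by simp
qed

lemma GDERIV_sign_along_curve:
  fixes \<gamma> :: "real \<Rightarrow> 'a::euclidean_space"
  assumes "GDERIV \<phi> (\<gamma> 0) :> G" "(\<gamma> has_vector_derivative v) (at 0)" "\<phi> (\<gamma> 0) = 0"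
  shows "v \<bullet> G < 0 \<Longrightarrow> \<forall>\<^sub>F s in at_right 0. \<phi> (\<gamma> s) < 0"
    and "0 < v \<bullet> G \<Longrightarrow> \<forall>\<^sub>F s in at_right 0. 0 < \<phi> (\<gamma> s)"
proof -
  have d: "((\<lambda>s. \<phi> (\<gamma> s)) has_real_derivative v \<bullet> G) (at 0)" by (rule GDERIV_along_curve[OF assms(1,2)])
  then have l: "((\<lambda>s. \<phi> (\<gamma> s) / s) \<longlongrightarrow> v \<bullet> G) (at_right 0)"
    using assms(3) by (simp add: has_field_derivative_iff filterlim_at_split)
  show "\<forall>\<^sub>F s in at_right 0. \<phi> (\<gamma> s) < 0" if "v \<bullet> G < 0"
    using order_tendstoD(2)[OF l that] eventually_at_right_less[of 0]
    by eventually_elim (simp add: divide_less_0_iff)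
  show "\<forall>\<^sub>F s in at_right 0. 0 < \<phi> (\<gamma> s)" if "0 < v \<bullet> G"
    using order_tendstoD(1)[OF l that] eventually_at_right_less[of 0]
    by eventually_elim (simp add: zero_less_divide_iff)
qed

lemma eventually_at_right_geo:
  assumes "x \<in> hyp" "norm e = 1" "open U" "x \<in> U"
  shows "\<forall>\<^sub>F s in at_right 0. geo x e s \<in> U"
proof -
  have "\<forall>\<^sub>F y in nhds x. y \<in> U" using assms by (simp add: eventually_nhds_in_open)
  from eventually_geo[OF assms(1,2) this] show ?thesis
    unfolding eventually_at_filter by eventually_elim simp
qed

text \<open>Near \<open>p\<close> the function differs from its linear part by at most \<open>B * (norm h)\<^sup>2\<close>, and on a tangent ball of radius \<open>R\<close>
  the linear part is at most \<open>- norm (G p) * (norm h)\<^sup>2 / (2 * R)\<close>. So every small radius works.\<close>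

lemma interior_sphere:
  fixes \<phi> :: "'a::euclidean_space \<Rightarrow> real"
  assumes U: "open U" "p \<in> U" and G: "\<And>x. x \<in> U \<Longrightarrow> GDERIV \<phi> x :> G x"
    and H: "(G has_derivative H) (at p)" and Gp: "G p \<noteq> 0" and p0: "\<phi> p = 0"
  defines "\<nu> \<equiv> (1 / norm (G p)) *\<^sub>R G p"
  obtains R where "0 < R" "cball (p - R *\<^sub>R \<nu>) R \<subseteq> U" "\<And>x. x \<in> cball (p - R *\<^sub>R \<nu>) R \<Longrightarrow> x \<noteq> p \<Longrightarrow> \<phi> x < 0"
proof -
  obtain r1 where r1: "0 < r1" "ball p r1 \<subseteq> U" using U open_contains_ball by blast
  have blH: "bounded_linear H" using H by (rule has_derivative_bounded_linear)
  have "\<exists>d>0. \<forall>y. norm (y - p) < d \<longrightarrow> norm (G y - G p - H (y - p)) \<le> 1 * norm (y - p)"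
    using H unfolding has_derivative_at_alt by (meson zero_less_one)
  then obtain r2 where r2: "0 < r2" "\<And>y. norm (y - p) < r2 \<Longrightarrow> norm (G y - G p - H (y - p)) \<le> norm (y - p)"
    by auto
  define B where "B = onorm H + 1"
  have B: "0 < B" using onorm_pos_le[OF blH] by (simp add: B_def)
  define r where "r = min r1 r2"
  have r: "0 < r" using r1 r2 by (simp add: r_def)
  have GB: "norm (G y - G p) \<le> B * norm (y - p)" if "norm (y - p) < r" for y
  proof -
    have "norm (G y - G p) \<le> norm (G y - G p - H (y - p)) + norm (H (y - p))"
      using norm_triangle_ineq[of "G y - G p - H (y - p)" "H (y - p)"] by simp
    also have "\<dots> \<le> norm (y - p) + onorm H * norm (y - p)"
      using r2(2)[of y] that onorm[OF blH, of "y - p"] by (simp add: r_def)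
    finally show ?thesis by (simp add: B_def algebra_simps)
  qed
  define g where "g = norm (G p)"
  have g: "0 < g" using Gp by (simp add: g_def)
  define R where "R = min (r / 4) (g / (4 * B))"
  have R: "0 < R" using r g B by (simp add: R_def)
  have "R \<le> g / (4 * B)" by (simp add: R_def)
  then have RB: "4 * B * R \<le> g" using B by (simp add: pos_le_divide_eq mult.commute)
  have \<nu>: "norm \<nu> = 1" using Gp by (simp add: \<nu>_def)
  have small: "norm (x - p) < r" if "x \<in> cball (p - R *\<^sub>R \<nu>) R" for x
  proof -
    have "norm (x - p) \<le> norm (x - (p - R *\<^sub>R \<nu>)) + norm (R *\<^sub>R \<nu>)"
      using norm_triangle_ineq[of "x - (p - R *\<^sub>R \<nu>)" "- (R *\<^sub>R \<nu>)"] by simp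
    also have "\<dots> \<le> R + R" using that R \<nu> by (simp add: dist_norm norm_minus_commute)
    also have "\<dots> < r" using r by (simp add: R_def min_def)
    finally show ?thesis .
  qed
  have inU: "x \<in> U" if "norm (x - p) < r" for x
    using that r1(2) by (auto simp: r_def dist_norm norm_minus_commute)
  show ?thesis
  proof (rule that[of R, OF R])
    show "cball (p - R *\<^sub>R \<nu>) R \<subseteq> U" using small inU by blast
    fix x assume x: "x \<in> cball (p - R *\<^sub>R \<nu>) R" "x \<noteq> p"
    define h where "h = x - p"
    have h: "norm h < r" "h \<noteq> 0" using small[OF x(1)] x(2) by (auto simp: h_def)
    have "norm (h + R *\<^sub>R \<nu>) \<le> R" using x(1) by (simp add: h_def dist_norm norm_minus_commute algebra_simps)
    then have "(norm (h + R *\<^sub>R \<nu>))\<^sup>2 \<le> R\<^sup>2" by (intro power_mono) auto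
    moreover have "(norm (h + R *\<^sub>R \<nu>))\<^sup>2 = (norm h)\<^sup>2 + 2 * R * (h \<bullet> \<nu>) + R\<^sup>2"
    proof -
      have "\<nu> \<bullet> \<nu> = 1" using \<nu> by (simp add: dot_square_norm)
      then show ?thesis
        by (simp add: power2_norm_eq_inner inner_simps inner_commute algebra_simps) (simp add: power2_eq_square)
    qed
    ultimately have 1: "(norm h)\<^sup>2 \<le> - (2 * R * (h \<bullet> \<nu>))" by simp
    have seg: "norm (t *\<^sub>R h) < r" if "0 \<le> t" "t \<le> 1" for t
    proof -
      have "t * norm h \<le> 1 * norm h" using that by (intro mult_right_mono) auto
      then show ?thesis using h(1) that by simp
    qed
    have der: "((\<lambda>t. \<phi> (p + t *\<^sub>R h)) has_real_derivative h \<bullet> G (p + t *\<^sub>R h)) (at t)" if "0 \<le> t" "t \<le> 1" for t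
    proof (rule GDERIV_along_curve)
      show "GDERIV \<phi> (p + t *\<^sub>R h) :> G (p + t *\<^sub>R h)" by (rule G, rule inU) (use seg[OF that] in simp)
      show "((\<lambda>t. p + t *\<^sub>R h) has_vector_derivative h) (at t)" by (auto intro!: derivative_eq_intros)
    qed
    have "\<exists>t>0. t < 1 \<and> \<phi> (p + 1 *\<^sub>R h) - \<phi> (p + 0 *\<^sub>R h) = (1 - 0) * (h \<bullet> G (p + t *\<^sub>R h))"
      using der by (intro MVT2) auto
    then obtain t where t: "0 < t" "t < 1" "\<phi> x = h \<bullet> G (p + t *\<^sub>R h)" using p0 by (auto simp: h_def)
    have "h \<bullet> (G (p + t *\<^sub>R h) - G p) \<le> norm h * norm (G (p + t *\<^sub>R h) - G p)" by (rule norm_cauchy_schwarz)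
    also have "\<dots> \<le> norm h * (B * norm (t *\<^sub>R h))"
      using GB[of "p + t *\<^sub>R h"] seg[of t] t by (intro mult_left_mono) auto
    also have "\<dots> \<le> norm h * (B * norm h)"
      using t B by (intro mult_left_mono) (auto simp: mult_left_le_one_le)
    finally have 2: "\<phi> x \<le> h \<bullet> G p + B * (norm h)\<^sup>2"
      by (simp add: t(3) inner_diff_right power2_eq_square algebra_simps)
    have "h \<bullet> G p = g * (h \<bullet> \<nu>)" using g by (simp add: \<nu>_def g_def)
    then have "2 * R * \<phi> x \<le> g * (2 * R * (h \<bullet> \<nu>)) + 2 * R * B * (norm h)\<^sup>2"
      using mult_left_mono[OF 2, of "2 * R"] R by (simp add: algebra_simps)
    also have "g * (2 * R * (h \<bullet> \<nu>)) \<le> g * (- (norm h)\<^sup>2)" using 1 g by (intro mult_left_mono) auto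
    also have "g * (- (norm h)\<^sup>2) + 2 * R * B * (norm h)\<^sup>2 = (2 * B * R - g) * (norm h)\<^sup>2" by (simp add: algebra_simps)
    also have "\<dots> < 0"
    proof (rule mult_neg_pos)
      show "2 * B * R - g < 0" using RB mult_pos_pos[OF B R] by simp
      show "0 < (norm h)\<^sup>2" using h(2) by simp
    qed
    finally have "2 * R * \<phi> x < 0" by simp
    then show "\<phi> x < 0" using R by (simp add: mult_less_0_iff)
  qed
qed

text \<open>What the comparison at a contact point needs of the boundary: the outward normal \<open>\<nu>\<close>, an interior tangent ball, and
  the behaviour of geodesics that leave the boundary transversally. The last two conditions on directions characterise
  \<open>\<nu>\<close> without reference to a defining function, hence in an isometry invariant way.\<close>

lemma boundary_point:
  assumes dom: "C2_domain \<Omega>" and p: "p \<in> hboundary \<Omega>"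
  obtains \<nu> R where "norm \<nu> = 1" "0 < R" "cball (p - R *\<^sub>R \<nu>) R \<subseteq> hyp" "cball (p - R *\<^sub>R \<nu>) R - {p} \<subseteq> \<Omega>"
    "\<And>e. norm e = 1 \<Longrightarrow> e \<bullet> \<nu> < 0 \<Longrightarrow> \<forall>\<^sub>F s in at_right 0. geo p e s \<in> \<Omega>"
    "\<And>e. norm e = 1 \<Longrightarrow> 0 < e \<bullet> \<nu> \<Longrightarrow> \<forall>\<^sub>F s in at_right 0. geo p e s \<notin> closure \<Omega>"
    "outward_unit_normal \<Omega> p ((1 / conf p) *\<^sub>R \<nu>)"
proof (rule C2_domain_local[OF dom p])
  fix U \<phi> G H
  assume U: "p \<in> U" "open U" "U \<subseteq> hyp" and G: "\<And>x. x \<in> U \<Longrightarrow> GDERIV \<phi> x :> G x"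
    and H: "(G has_derivative H) (at p)" and nz: "G p \<noteq> 0" and i1: "\<And>x. x \<in> U \<Longrightarrow> x \<in> \<Omega> \<longleftrightarrow> \<phi> x < 0"
    and i2: "\<And>x. x \<in> U \<Longrightarrow> x \<in> hboundary \<Omega> \<longleftrightarrow> \<phi> x = 0"
    and i3: "\<And>x. x \<in> U \<Longrightarrow> 0 < \<phi> x \<Longrightarrow> x \<notin> closure \<Omega>"
  have ph: "p \<in> hyp" using U by blast
  have p0: "\<phi> p = 0" using i2 U(1) p by blast
  define \<nu> where "\<nu> = (1 / norm (G p)) *\<^sub>R G p"
  have \<nu>: "norm \<nu> = 1" using nz by (simp add: \<nu>_def)
  have G\<nu>: "G p = norm (G p) *\<^sub>R \<nu>" using nz by (simp add: \<nu>_def)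
  have c: "0 < conf p" by (rule conf_pos[OF ph])
  have sgn: "((1 / conf p) *\<^sub>R e) \<bullet> G p = (norm (G p) / conf p) * (e \<bullet> \<nu>)" for e
    by (subst G\<nu>) simp
  have gp: "0 < norm (G p) / conf p" using nz c by simp
  obtain R where R: "0 < R" "cball (p - R *\<^sub>R \<nu>) R \<subseteq> U" "\<And>x. x \<in> cball (p - R *\<^sub>R \<nu>) R \<Longrightarrow> x \<noteq> p \<Longrightarrow> \<phi> x < 0"
    using interior_sphere[OF U(2,1) G H nz p0] unfolding \<nu>_def by blast
  have der: "(geo p e has_vector_derivative (1 / conf p) *\<^sub>R e) (at 0)" if "norm e = 1" for e
    using geo_has_derivative[OF ph that, of 0] by (simp add: geo_velocity[OF ph that])
  have Gp: "GDERIV \<phi> (geo p e 0) :> G p" for e by (simp add: geo_0[OF ph] G U(1))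
  have z: "\<phi> (geo p e 0) = 0" for e by (simp add: geo_0[OF ph] p0)
  show ?thesis
  proof (rule that[OF \<nu> R(1)])
    show "cball (p - R *\<^sub>R \<nu>) R \<subseteq> hyp" using R(2) U(3) by blast
    show "cball (p - R *\<^sub>R \<nu>) R - {p} \<subseteq> \<Omega>" using R(2,3) i1 by blast
    show "\<forall>\<^sub>F s in at_right 0. geo p e s \<in> \<Omega>" if e: "norm e = 1" "e \<bullet> \<nu> < 0" for e
    proof -
      have "((1 / conf p) *\<^sub>R e) \<bullet> G p < 0" unfolding sgn using gp e(2) by (rule mult_pos_neg)
      from GDERIV_sign_along_curve(1)[OF Gp der[OF e(1)] z this] eventually_at_right_geo[OF ph e(1) U(2,1)]
      show ?thesis by eventually_elim (use i1 in blast)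
    qed
    show "\<forall>\<^sub>F s in at_right 0. geo p e s \<notin> closure \<Omega>" if e: "norm e = 1" "0 < e \<bullet> \<nu>" for e
    proof -
      have "0 < ((1 / conf p) *\<^sub>R e) \<bullet> G p" unfolding sgn using gp e(2) by (rule mult_pos_pos)
      from GDERIV_sign_along_curve(2)[OF Gp der[OF e(1)] z this] eventually_at_right_geo[OF ph e(1) U(2,1)]
      show ?thesis by eventually_elim (use i3 in blast)
    qed
    show "outward_unit_normal \<Omega> p ((1 / conf p) *\<^sub>R \<nu>)"
      unfolding outward_unit_normal_def unit_normal_at_def
    proof (intro conjI ballI)
      show "hnorm p ((1 / conf p) *\<^sub>R \<nu>) = 1"
        using c \<nu> by (simp add: hnorm_def hinner_def dot_square_norm power2_eq_square)
      fix w assume "w \<in> tangent_space (hboundary \<Omega>) p"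
      then obtain k where k: "\<And>t. k t \<in> hboundary \<Omega>" "k 0 = p" "(k has_vector_derivative w) (at 0)"
        unfolding tangent_space_def by blast
      have "((\<lambda>s. \<phi> (k s)) has_real_derivative w \<bullet> G p) (at 0)"
        by (rule GDERIV_along_curve[OF _ k(3)]) (simp add: k(2) G U(1))
      moreover have "\<forall>\<^sub>F s in nhds 0. \<phi> (k s) = 0"
      proof -
        have "isCont k 0" using k(3) by (rule has_vector_derivative_continuous)
        then have "(k \<longlongrightarrow> k 0) (nhds 0)" by (simp only: isCont_def tendsto_at_iff_tendsto_nhds)
        then have "(k \<longlongrightarrow> p) (nhds 0)" by (simp only: k(2))
        then have "\<forall>\<^sub>F s in nhds 0. k s \<in> U" using U by (auto intro: topological_tendstoD)
        then show ?thesis by eventually_elim (use i2 k(1) in blast)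
      qed
      ultimately have "((\<lambda>s. 0) has_real_derivative w \<bullet> G p) (at (0::real))"
        by (subst (asm) DERIV_cong_ev[OF refl _ refl]) auto
      then have "w \<bullet> G p = 0" using DERIV_unique[OF DERIV_const[of 0]] by metis
      then show "hinner p ((1 / conf p) *\<^sub>R \<nu>) w = 0"
        by (simp add: hinner_def \<nu>_def inner_commute)
    next
      have d: "((\<lambda>t. p + t *\<^sub>R ((1 / conf p) *\<^sub>R \<nu>)) has_vector_derivative (1 / conf p) *\<^sub>R \<nu>) (at 0)"
        by (rule has_vector_derivative_eq_rhs[OF has_vector_derivative_add[OF has_vector_derivative_const
              has_vector_derivative_scaleR[OF DERIV_ident has_vector_derivative_const]]]) simp
      have "0 < ((1 / conf p) *\<^sub>R \<nu>) \<bullet> G p" unfolding sgn using mult_pos_pos[OF gp, of "\<nu> \<bullet> \<nu>"] \<nu> by (simp add: dot_square_norm)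
      then have 1: "\<forall>\<^sub>F t in at_right 0. 0 < \<phi> (p + t *\<^sub>R ((1 / conf p) *\<^sub>R \<nu>))"
        using GDERIV_sign_along_curve(2)[OF _ d] G[OF U(1)] p0 by simp
      have "((\<lambda>t. p + t *\<^sub>R ((1 / conf p) *\<^sub>R \<nu>)) \<longlongrightarrow> p + 0 *\<^sub>R ((1 / conf p) *\<^sub>R \<nu>)) (at_right 0)"
        by (intro tendsto_intros)
      then have "\<forall>\<^sub>F t in at_right 0. p + t *\<^sub>R ((1 / conf p) *\<^sub>R \<nu>) \<in> U"
        using U by (auto intro: topological_tendstoD)
      with 1 show "\<forall>\<^sub>F t in at_right 0. p + t *\<^sub>R ((1 / conf p) *\<^sub>R \<nu>) \<notin> closure \<Omega>"
        by eventually_elim (use i3 in blast)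
    qed
  qed
qed

lemma hyperbolic_distance_to_set_unbounded:
  assumes S: "S \<noteq> {}" "S \<subseteq> hyp" and \<xi>: "norm \<xi> = 1" "\<xi> \<notin> closure S"
    and X: "\<And>k::nat. X k \<in> hyp" "X \<longlonglongrightarrow> \<xi>"
  shows "\<forall>\<^sub>F k in sequentially. R < hdist_set (X k) S"
proof -
  obtain \<delta> where \<delta>: "0 < \<delta>" "\<And>y. y \<in> S \<Longrightarrow> \<delta> \<le> dist \<xi> y"
    using \<xi>(2) unfolding closure_approachable by (force simp: not_less dist_commute)
  define q where "q k = 1 - (norm (X k))\<^sup>2" for k
  have q: "0 < q k" for k unfolding q_def by (rule hyp_norm[OF X(1)])
  have ql: "q \<longlonglongrightarrow> 0"
    unfolding q_def[abs_def] using tendsto_diff[OF tendsto_const[of 1] tendsto_power[OF tendsto_norm[OF X(2)], of 2]] \<xi>(1) by simp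
  define L where "L = max R 0 + 1"
  define c where "c = \<delta>\<^sup>2 / (2 * cosh L)"
  have c: "0 < c" using \<delta> cosh_real_pos[of L] by (simp add: c_def)
  have "\<forall>\<^sub>F k in sequentially. q k < c" by (rule order_tendstoD(2)[OF ql c])
  moreover have "\<forall>\<^sub>F k in sequentially. dist (X k) \<xi> < \<delta> / 2"
    using X(2) \<delta>(1) by (intro tendstoD) auto
  ultimately show ?thesis
  proof eventually_elim
    case (elim k)
    have "L \<le> hdist (X k) y" if y: "y \<in> S" for y
    proof -
      have yh: "y \<in> hyp" using y S by blast
      have "\<delta> \<le> dist \<xi> (X k) + dist (X k) y" using \<delta>(2)[OF y] dist_triangle[of \<xi> y "X k"] by simp
      then have "\<delta> / 2 \<le> dist (X k) y" using elim(2) by (simp add: dist_commute)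
      then have d2: "(\<delta> / 2)\<^sup>2 \<le> (dist (X k) y)\<^sup>2" using \<delta>(1) by (intro power_mono) auto
      have qy: "0 < 1 - (norm y)\<^sup>2" "1 - (norm y)\<^sup>2 \<le> 1" using hyp_norm[OF yh] by auto
      have "cosh L * (q k * (1 - (norm y)\<^sup>2)) \<le> cosh L * (c * 1)"
        using elim(1) q[of k] qy cosh_real_pos[of L] by (intro mult_left_mono mult_mono) auto
      also have "\<dots> = 2 * (\<delta> / 2)\<^sup>2" using cosh_real_pos[of L] by (simp add: c_def power2_eq_square)
      also have "\<dots> \<le> 2 * (dist (X k) y)\<^sup>2" using d2 by simp
      finally have "cosh L \<le> 2 * (dist (X k) y)\<^sup>2 / (q k * (1 - (norm y)\<^sup>2))"
        using mult_pos_pos[OF q[of k] qy(1)] by (simp add: pos_le_divide_eq)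
      then have le: "cosh L \<le> 1 + 2 * (dist (X k) y)\<^sup>2 / (q k * (1 - (norm y)\<^sup>2))" by simp
      have "L = arcosh (cosh L)" by (simp add: arcosh_cosh_real L_def)
      also have "\<dots> \<le> arcosh (1 + 2 * (dist (X k) y)\<^sup>2 / (q k * (1 - (norm y)\<^sup>2)))"
        using le cosh_real_ge_1[of L] by (metis arcosh_real_strict_mono less_eq_real_def)
      finally show ?thesis by (simp add: hdist_def q_def)
    qed
    then have "L \<le> hdist_set (X k) S" unfolding hdist_set_def by (intro cINF_greatest S(1)) auto
    then show ?case by (simp add: L_def)
  qed
qed

section \<open>The overdetermined problem over an equator\<close>

text \<open>The problem in Minkowski coordinates: \<open>M\<close> is the unit normal of the hyperplane that points to the side of the
  hemisphere, and \<open>T\<close> is a point of the hyperplane.\<close>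

locale equator_oep =
  fixes f :: "real \<Rightarrow> real" and \<Omega> :: "'a::euclidean_space set" and u :: "'a \<Rightarrow> real"
    and M T :: "'a \<times> real" and C \<alpha> K :: real
  assumes dim: "2 \<le> DIM('a)"
    and K: "0 \<le> K" "\<And>a b. \<bar>f a - f b\<bar> \<le> K * \<bar>a - b\<bar>"
    and anti: "antimono f"
    and T: "T \<in> hyperboloid" and TM: "mink T M = 0" and MM: "mink M M = 1"
    and dom: "C2_domain \<Omega>"
    and ideal_bd: "ideal_boundary (hboundary \<Omega>) = {\<xi> \<in> sphere 0 1. mink (conevec \<xi>) M = 0}"
    and ideal: "ideal_boundary \<Omega> = {\<xi> \<in> sphere 0 1. 0 \<le> mink (conevec \<xi>) M}"
    and reg: "C2_upto_boundary \<Omega> u"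
    and pde: "\<And>x. x \<in> \<Omega> \<Longrightarrow> hlaplacian u x + f (u x) = 0"
    and u_pos: "\<And>x. x \<in> \<Omega> \<Longrightarrow> 0 < u x"
    and u_bdd: "bounded (u ` \<Omega>)"
    and u_zero: "\<And>x. x \<in> hboundary \<Omega> \<Longrightarrow> u x = 0"
    and u_lim: "\<And>\<epsilon>. 0 < \<epsilon> \<Longrightarrow> \<exists>R. \<forall>p\<in>\<Omega>. R < hdist_set p (hboundary \<Omega>) \<longrightarrow> \<bar>u p - C\<bar> < \<epsilon>"
    and neumann: "\<And>p v. p \<in> hboundary \<Omega> \<Longrightarrow> outward_unit_normal \<Omega> p v \<Longrightarrow>
          hinner p (Lim (at p within \<Omega>) (hgrad u)) v = \<alpha>"
begin

lemma Omega: "open \<Omega>" "connected \<Omega>" "\<Omega> \<noteq> {}" "\<Omega> \<subseteq> hyp"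
  using dom by (simp_all add: C2_domain_def)

lemma hboundary_hyp: "x \<in> hboundary \<Omega> \<Longrightarrow> x \<in> hyp"
  by (simp add: hboundary_def)

lemma hboundary_closure: "x \<in> hboundary \<Omega> \<Longrightarrow> x \<in> closure \<Omega>"
  by (simp add: hboundary_def frontier_def)

lemma hboundary_not: "x \<in> hboundary \<Omega> \<Longrightarrow> x \<notin> \<Omega>"
  using Omega(1) by (simp add: hboundary_def frontier_def interior_open)

lemma closure_hyp: "x \<in> closure \<Omega> \<Longrightarrow> x \<in> hyp \<Longrightarrow> x \<in> \<Omega> \<or> x \<in> hboundary \<Omega>"
  using Omega(1) by (simp add: hboundary_def frontier_def interior_open)

lemma closure_cball: "x \<in> closure \<Omega> \<Longrightarrow> x \<in> cball 0 1"
  using closure_mono[OF Omega(4)] by auto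

lemma closure_sphere:
  assumes "x \<in> closure \<Omega>" "x \<notin> hyp"
  shows "norm x = 1" "0 \<le> mink (conevec x) M"
proof -
  show n: "norm x = 1" using closure_cball[OF assms(1)] assms(2) by simp
  have "x \<in> ideal_boundary \<Omega>" using assms(1) n by (simp add: ideal_boundary_def)
  then show "0 \<le> mink (conevec x) M" using ideal by auto
qed

lemma not_closure_hboundary: "norm \<xi> = 1 \<Longrightarrow> 0 < mink (conevec \<xi>) M \<Longrightarrow> \<xi> \<notin> closure (hboundary \<Omega>)"
proof
  assume n: "norm \<xi> = 1" and "0 < mink (conevec \<xi>) M" "\<xi> \<in> closure (hboundary \<Omega>)"
  then have "\<xi> \<in> ideal_boundary (hboundary \<Omega>)" by (simp add: ideal_boundary_def)
  then have "mink (conevec \<xi>) M = 0" unfolding ideal_bd by simp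
  then show False using \<open>0 < mink (conevec \<xi>) M\<close> by simp
qed

text \<open>A small half ball at an ideal point off the equator is connected and meets \<open>\<Omega>\<close> but not its boundary.\<close>

lemma ideal_neighbourhood:
  assumes "norm \<xi> = 1" "0 < mink (conevec \<xi>) M"
  shows "\<forall>\<^sub>F x in nhds \<xi>. x \<in> hyp \<longrightarrow> x \<in> \<Omega>"
proof -
  have "\<xi> \<in> - closure (hboundary \<Omega>)" using not_closure_hboundary[OF assms] by simp
  then obtain d where d: "0 < d" "ball \<xi> d \<subseteq> - closure (hboundary \<Omega>)"
    by (meson open_Compl closed_closure open_contains_ball)
  have "\<xi> \<in> ideal_boundary \<Omega>" using assms ideal by auto
  then have "\<xi> \<in> closure \<Omega>" by (simp add: ideal_boundary_def)
  then obtain z where z: "z \<in> \<Omega>" "dist z \<xi> < d" using d(1) by (auto simp: closure_approachable)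
  define S where "S = ball \<xi> d \<inter> (hyp :: 'a set)"
  have "connected S" unfolding S_def by (intro convex_connected convex_Int convex_ball)
  moreover have "z \<in> S \<inter> \<Omega>" using z Omega(4) by (auto simp: S_def dist_commute)
  moreover have "S \<inter> frontier \<Omega> = {}"
  proof -
    have "x \<notin> frontier \<Omega>" if "x \<in> S" for x
    proof
      assume "x \<in> frontier \<Omega>"
      then have "x \<in> hboundary \<Omega>" using that by (simp add: S_def hboundary_def)
      then have "x \<in> closure (hboundary \<Omega>)" by (rule subsetD[OF closure_subset])
      then show False using d(2) that by (auto simp: S_def)
    qed
    then show ?thesis by blast
  qed
  ultimately have "S - \<Omega> = {}" using connected_Int_frontier[of S \<Omega>] by blast
  then have S: "S \<subseteq> \<Omega>" by blast
  have "\<forall>\<^sub>F x in nhds \<xi>. x \<in> ball \<xi> d" using d(1) by (intro eventually_nhds_in_open) auto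
  then show ?thesis by eventually_elim (use S in \<open>auto simp: S_def\<close>)
qed

lemma equator_nonempty: "\<exists>\<xi>. norm \<xi> = 1 \<and> mink (conevec \<xi>) M = 0"
proof -
  define x where "x = (proj T :: 'a)"
  have x: "x \<in> hyp" and lx: "lift x = T" unfolding x_def by (rule proj_hyp[OF T], rule lift_proj[OF T])
  obtain v where v: "v \<noteq> 0" "orthogonal (coframe x M) v" using orthogonal_to_vector_exists[OF dim] .
  define e where "e = (1 / norm v) *\<^sub>R v"
  have e: "e \<bullet> e = 1" "coframe x M \<bullet> e = 0"
    using v by (simp_all add: e_def orthogonal_def dot_square_norm power2_eq_square)
  define V where "V = frame x e"
  have VV: "mink V V = 1" unfolding V_def mink_frame[OF x] by (rule e)
  have TV: "mink T V = 0" unfolding V_def lx[symmetric] by (rule mink_lift_frame[OF x])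
  have "mink V M = mink (frame x e) (frame x (coframe x M))"
    using frame_coframe[OF x, of M] by (simp add: V_def lx TM)
  then have VM: "mink V M = 0" using e(2) by (simp add: mink_frame[OF x] inner_commute)
  have TT: "mink T T = -1" using T by (simp add: hyperboloid_def)
  define Z where "Z = T + V"
  have ZZ: "mink Z Z = 0" using TV VV TT by (simp add: Z_def mink_simps mink_commute[of V T])
  have "Z \<in> future" by (rule futureI[OF T]) (simp_all add: ZZ, simp add: Z_def mink_simps TT TV)
  then have s: "0 < snd Z" by (simp add: future_def)
  define \<xi> where "\<xi> = (1 / snd Z) *\<^sub>R fst Z"
  have "(norm (fst Z))\<^sup>2 = (snd Z)\<^sup>2" using ZZ by (simp add: mink_self)
  then have "norm (fst Z) = snd Z" using s by (metis less_eq_real_def norm_ge_zero power2_eq_imp_eq)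
  then have n: "norm \<xi> = 1" using s by (simp add: \<xi>_def)
  have "conevec \<xi> = (2 / snd Z) *\<^sub>R Z"
    unfolding conevec_def n using s by (simp add: prod_eq_iff \<xi>_def)
  then have "mink (conevec \<xi>) M = 0" using TM VM by (simp add: Z_def mink_simps)
  with n show ?thesis by blast
qed

lemma hboundary_nonempty: "hboundary \<Omega> \<noteq> {}"
  using equator_nonempty ideal_bd by (auto simp: ideal_boundary_def)

lemma u_limit:
  assumes "\<And>k. X k \<in> \<Omega>" "X \<longlonglongrightarrow> \<xi>" "norm \<xi> = 1" "0 < mink (conevec \<xi>) M"
  shows "(\<lambda>k::nat. u (X k)) \<longlonglongrightarrow> C"
proof (rule tendstoI)
  fix \<epsilon> :: real assume "0 < \<epsilon>"
  from u_lim[OF this] obtain R where R: "\<And>p. p \<in> \<Omega> \<Longrightarrow> R < hdist_set p (hboundary \<Omega>) \<Longrightarrow> \<bar>u p - C\<bar> < \<epsilon>" by blast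
  have "\<forall>\<^sub>F k in sequentially. R < hdist_set (X k) (hboundary \<Omega>)"
  proof (rule hyperbolic_distance_to_set_unbounded[OF hboundary_nonempty _ assms(3) not_closure_hboundary[OF assms(3,4)] _ assms(2)])
    show "hboundary \<Omega> \<subseteq> hyp" by (simp add: hboundary_def)
    show "X k \<in> hyp" for k using assms(1) Omega(4) by blast
  qed
  then show "\<forall>\<^sub>F k in sequentially. dist (u (X k)) C < \<epsilon>"
    by eventually_elim (use R assms(1) in \<open>simp add: dist_real_def\<close>)
qed

lemma u_continuous: "continuous_on (hclosure \<Omega>) u"
  using reg by (simp add: C2_upto_boundary_def)

lemma u_tendsto:
  assumes "\<And>k. X k \<in> \<Omega>" "X \<longlonglongrightarrow> z" "z \<in> hyp"
  shows "(\<lambda>k::nat. u (X k)) \<longlonglongrightarrow> u z"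
proof -
  have "z \<in> closure \<Omega>" using assms(1,2) closure_sequential by blast
  then have "z \<in> hclosure \<Omega>" using assms(3) by (simp add: hclosure_def)
  moreover have "X k \<in> hclosure \<Omega>" for k using assms(1)[of k] Omega(4) closure_subset by (auto simp: hclosure_def)
  ultimately show ?thesis using u_continuous assms(2) by (auto simp: continuous_on_sequentially comp_def)
qed

lemma u_hlap: "x \<in> \<Omega> \<Longrightarrow> has_hlap u x (- f (u x))"
proof -
  assume x: "x \<in> \<Omega>"
  obtain G H where GH: "\<forall>x\<in>\<Omega>. GDERIV u x :> G x \<and> (G has_derivative blinfun_apply (H x)) (at x)"
    using reg unfolding C2_upto_boundary_def by blast
  have "has_hlap u x (hlaplacian u x)"
    by (rule has_hlap_C2[OF Omega(1,4) x]) (use GH x in auto)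
  moreover have "hlaplacian u x = - f (u x)" using pde[OF x] by linarith
  ultimately show ?thesis by simp
qed

text \<open>The overdetermined condition in the form that is used at a contact point. By l'Hopital's rule the slope is the
  limit of the derivative along the geodesic, which is a pairing of the gradient with the inner normal.\<close>

lemma u_slope:
  assumes p: "p \<in> hboundary \<Omega>" and \<nu>: "norm \<nu> = 1" "outward_unit_normal \<Omega> p ((1 / conf p) *\<^sub>R \<nu>)"
    and inside: "\<forall>\<^sub>F s in at_right 0. geo p (- \<nu>) s \<in> \<Omega>"
  shows "((\<lambda>s. u (geo p (- \<nu>) s) / s) \<longlongrightarrow> - \<alpha>) (at_right 0)"
proof -
  have ph: "p \<in> hyp" by (rule hboundary_hyp[OF p])
  have ne: "norm (- \<nu>) = 1" using \<nu> by simp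
  define \<gamma> where "\<gamma> = geo p (- \<nu>)"
  obtain G H where GH: "\<forall>x\<in>\<Omega>. GDERIV u x :> G x \<and> (G has_derivative blinfun_apply (H x)) (at x)"
    and contG: "continuous_on (hclosure \<Omega>) G"
    using reg unfolding C2_upto_boundary_def by blast
  have pc: "p \<in> hclosure \<Omega>" using hboundary_closure[OF p] ph by (simp add: hclosure_def)
  have sub: "\<Omega> \<subseteq> hclosure \<Omega>" using Omega(4) closure_subset by (auto simp: hclosure_def)
  have Glim: "(G \<longlongrightarrow> G p) (at p within \<Omega>)"
    using contG pc sub by (meson continuous_on tendsto_within_subset)
  have c: "0 < conf p" by (rule conf_pos[OF ph])
  have "isCont conf p"
    unfolding conf_def[abs_def] using hyp_norm[OF ph] by (intro continuous_intros) auto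
  then have clim: "(conf \<longlongrightarrow> conf p) (at p within \<Omega>)"
    by (simp add: continuous_at_imp_continuous_at_within continuous_within[symmetric])
  have "((\<lambda>x. (1 / (conf x)\<^sup>2) *\<^sub>R G x) \<longlongrightarrow> (1 / (conf p)\<^sup>2) *\<^sub>R G p) (at p within \<Omega>)"
    using c by (intro tendsto_intros Glim clim) auto
  then have "(hgrad u \<longlongrightarrow> (1 / (conf p)\<^sup>2) *\<^sub>R G p) (at p within \<Omega>)"
  proof (rule Lim_transform_eventually)
    show "\<forall>\<^sub>F x in at p within \<Omega>. (1 / (conf x)\<^sup>2) *\<^sub>R G x = hgrad u x"
      unfolding eventually_at_filter using GH by (auto intro!: always_eventually simp: hgrad_def egrad_eq)
  qed
  moreover have "at p within \<Omega> \<noteq> bot"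
    using hboundary_closure[OF p] hboundary_not[OF p] by (simp add: trivial_limit_within islimpt_in_closure)
  ultimately have "Lim (at p within \<Omega>) (hgrad u) = (1 / (conf p)\<^sup>2) *\<^sub>R G p" by (intro tendsto_Lim)
  then have "hinner p ((1 / (conf p)\<^sup>2) *\<^sub>R G p) ((1 / conf p) *\<^sub>R \<nu>) = \<alpha>" using neumann[OF p \<nu>(2)] by simp
  then have G\<nu>: "((1 / conf p) *\<^sub>R (- \<nu>)) \<bullet> G p = - \<alpha>" using c by (simp add: hinner_def inner_commute power2_eq_square)
  have \<gamma>0: "\<gamma> 0 = p" unfolding \<gamma>_def by (rule geo_0[OF ph])
  have "(\<gamma> \<longlongrightarrow> \<gamma> 0) (at 0)" using continuous_geo[OF ph ne, of 0] by (simp add: \<gamma>_def isCont_def)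
  then have \<gamma>lim: "(\<gamma> \<longlongrightarrow> p) (at_right 0)" unfolding \<gamma>0 by (simp only: filterlim_at_split)
  have inc: "\<forall>\<^sub>F s in at_right 0. \<gamma> s \<in> hclosure \<Omega>"
    using inside unfolding \<gamma>_def by eventually_elim (use sub in blast)
  have comp: "((\<lambda>s. F (\<gamma> s)) \<longlongrightarrow> F p) (at_right 0)" if "continuous_on (hclosure \<Omega>) F" for F :: "'a \<Rightarrow> 'b::topological_space"
    by (rule continuous_on_tendsto_compose[OF that \<gamma>lim pc inc])
  have 1: "((\<lambda>s. u (\<gamma> s)) \<longlongrightarrow> 0) (at_right 0)" using comp[OF u_continuous] u_zero[OF p] by simp
  have "(velocity \<gamma> \<longlongrightarrow> velocity \<gamma> 0) (at 0)"
    using has_vector_derivative_continuous[OF geo_velocity_derivative[OF ph ne, of 0]] by (simp add: \<gamma>_def isCont_def)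
  then have "(velocity \<gamma> \<longlongrightarrow> velocity \<gamma> 0) (at_right 0)" by (simp only: filterlim_at_split)
  moreover have "velocity \<gamma> 0 = (1 / conf p) *\<^sub>R (- \<nu>)" unfolding \<gamma>_def by (rule geo_velocity[OF ph ne])
  ultimately have "((\<lambda>s. velocity \<gamma> s \<bullet> G (\<gamma> s)) \<longlongrightarrow> ((1 / conf p) *\<^sub>R (- \<nu>)) \<bullet> G p) (at_right 0)"
    using comp[OF contG] by (intro tendsto_inner) auto
  then have 2: "((\<lambda>s. velocity \<gamma> s \<bullet> G (\<gamma> s) / 1) \<longlongrightarrow> - \<alpha>) (at_right 0)" unfolding G\<nu> by simp
  have "((\<lambda>s. u (\<gamma> s) / s) \<longlongrightarrow> - \<alpha>) (at_right 0)"
  proof (rule lhopital_right_0[OF 1 _ _ _ _ _ 2])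
    show "((\<lambda>s. s) \<longlongrightarrow> 0) (at_right (0::real))" by (rule tendsto_ident_at)
    show "\<forall>\<^sub>F s in at_right 0. s \<noteq> (0::real)" using eventually_at_right_less[of 0] by eventually_elim simp
    show "\<forall>\<^sub>F s in at_right (0::real). (1::real) \<noteq> 0" by simp
    show "\<forall>\<^sub>F s in at_right 0. ((\<lambda>s. u (\<gamma> s)) has_real_derivative velocity \<gamma> s \<bullet> G (\<gamma> s)) (at s)"
      using inside unfolding \<gamma>_def[symmetric]
    proof eventually_elim
      case (elim s)
      show ?case
        by (rule GDERIV_along_curve) (use GH elim geo_has_derivative[OF ph ne, of s] in \<open>auto simp: \<gamma>_def\<close>)
    qed
    show "\<forall>\<^sub>F s in at_right 0. ((\<lambda>s. s) has_real_derivative 1) (at (s::real))" by simp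
  qed
  then show ?thesis by (simp add: \<gamma>_def)
qed

subsection \<open>Comparison with a moved copy\<close>

text \<open>Isometries that map \<open>\<Omega>\<close> into itself and the closed hemisphere into its relative interior.\<close>

definition moves_in :: "('a \<times> real \<Rightarrow> 'a \<times> real) \<Rightarrow> bool" where
  "moves_in A \<longleftrightarrow> lorentz A \<and> (\<forall>x\<in>\<Omega>. act A x \<in> \<Omega>) \<and>
     (\<forall>\<xi>. norm \<xi> = 1 \<longrightarrow> 0 \<le> mink (conevec \<xi>) M \<longrightarrow> 0 < mink (A (conevec \<xi>)) M)"

lemma act_ideal:
  assumes "lorentz A" "norm \<xi> = 1" "0 < mink (A (conevec \<xi>)) M"
  shows "norm (act A \<xi>) = 1" "0 < mink (conevec (act A \<xi>)) M"
proof -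
  have s: "\<xi> \<in> sphere 0 1" using assms(2) by simp
  show "norm (act A \<xi>) = 1" using act_sphere(1)[OF assms(1) s] by simp
  obtain r where "0 < r" "conevec (act A \<xi>) = r *\<^sub>R A (conevec \<xi>)" using act_sphere(2)[OF assms(1) s] by blast
  then show "0 < mink (conevec (act A \<xi>)) M" using assms(3) by (simp add: mink_simps)
qed

text \<open>The function \<open>g = u \<circ> act A - u + \<epsilon> * barrier\<close> has no negative minimum. In \<open>\<Omega>\<close> its Laplacian would be negative there,
  because \<open>f\<close> is non-increasing and the barrier is strictly superharmonic. A minimising sequence cannot leave \<open>\<Omega>\<close>
  either: at the boundary \<open>u\<close> vanishes, at the equator the barrier is infinite, and at the other points of the
  hemisphere both values of \<open>u\<close> tend to the same constant.\<close>

lemma comparison: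
  assumes A: "moves_in A" and x0: "x0 \<in> \<Omega>"
  shows "u x0 \<le> u (act A x0)"
proof (rule ccontr)
  assume neg: "\<not> u x0 \<le> u (act A x0)"
  have lor: "lorentz A" and sub: "\<And>x. x \<in> \<Omega> \<Longrightarrow> act A x \<in> \<Omega>"
    and str: "\<And>\<xi>. norm \<xi> = 1 \<Longrightarrow> 0 \<le> mink (conevec \<xi>) M \<Longrightarrow> 0 < mink (A (conevec \<xi>)) M"
    using A by (auto simp: moves_in_def)
  define b where "b = barrier M T"
  have bpos: "0 < b x" if "x \<in> \<Omega>" for x
    unfolding b_def using barrier_ge(2)[OF _ T TM MM] that Omega(4) by blast
  define \<epsilon> where "\<epsilon> = (u x0 - u (act A x0)) / (2 * b x0)"
  have \<epsilon>: "0 < \<epsilon>" using neg bpos[OF x0] by (simp add: \<epsilon>_def)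
  define g where "g x = u (act A x) - u x + \<epsilon> * b x" for x
  have "\<epsilon> * b x0 = (u x0 - u (act A x0)) / 2" using bpos[OF x0] by (simp add: \<epsilon>_def)
  then have g0: "g x0 < 0" using neg by (simp add: g_def)
  define S where "S = {x \<in> \<Omega>. g x \<le> g x0}"
  obtain B where B: "\<And>x. x \<in> \<Omega> \<Longrightarrow> \<bar>u x\<bar> \<le> B" using u_bdd unfolding bounded_iff by auto
  have gcont: "continuous_on \<Omega> g"
  proof -
    have cu: "continuous_on \<Omega> u" using u_continuous Omega(4) closure_subset
      by (auto simp: hclosure_def intro: continuous_on_subset)
    have ca: "continuous_on \<Omega> (act A)"
      unfolding continuous_on_def using tendsto_act[OF lor] Omega(4) by force
    have cua: "continuous_on \<Omega> (\<lambda>x. u (act A x))"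
      by (rule continuous_on_compose2[OF cu ca]) (use sub in auto)
    have cb: "continuous_on \<Omega> b"
    proof -
      have cl: "continuous_on \<Omega> lift"
        unfolding lift_def[abs_def] conf_def using hyp_norm Omega(4) by (intro continuous_intros) force+
      have "0 < mink (lift x) (- T)" if "x \<in> \<Omega>" for x
        by (rule hyperboloid_coordinates(2)[OF _ T TM MM]) (use lift_hyperboloid that Omega(4) in blast)
      moreover have "0 < 1 + (mink (lift x) M)\<^sup>2" for x :: 'a by (simp add: add_pos_nonneg)
      ultimately show ?thesis unfolding b_def barrier_def[abs_def]
        by (intro continuous_intros cl) (auto simp: less_imp_neq[symmetric])
    qed
    show ?thesis unfolding g_def[abs_def] by (intro continuous_intros cu cua cb)
  qed
  (* The cases below are the possible limits of a sequence on which g stays below its negative value at x0. *)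
  have "closed S"
    unfolding closed_sequential_limits
  proof (intro allI impI, elim conjE)
    fix X z assume X: "\<forall>k. X k \<in> S" and lim: "X \<longlonglongrightarrow> z"
    have X\<Omega>: "X k \<in> \<Omega>" and Xg: "g (X k) \<le> g x0" for k using X by (auto simp: S_def)
    have zc: "z \<in> closure \<Omega>" using X\<Omega> lim closure_sequential by blast
    have AX: "act A (X k) \<in> \<Omega>" for k by (rule sub[OF X\<Omega>])
    have Alim: "(\<lambda>k. act A (X k)) \<longlonglongrightarrow> act A z" by (rule tendsto_act[OF lor closure_cball[OF zc] lim])
    consider "z \<in> \<Omega>" | "z \<in> hboundary \<Omega>" | "z \<notin> hyp" using closure_hyp[OF zc] by blast
    then show "z \<in> S"
    proof cases
      case 1
      have "(\<lambda>k. g (X k)) \<longlonglongrightarrow> g z" using gcont 1 X\<Omega> lim by (auto simp: continuous_on_sequentially comp_def)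
      then have "g z \<le> g x0" by (rule LIMSEQ_le_const2) (use Xg in blast)
      then show ?thesis using 1 by (simp add: S_def)
    next
      case 2
      have "(\<lambda>k. u (X k)) \<longlonglongrightarrow> 0" using u_tendsto[OF X\<Omega> lim hboundary_hyp[OF 2]] u_zero[OF 2] by simp
      then have "(\<lambda>k. - u (X k)) \<longlonglongrightarrow> - 0" by (rule tendsto_minus)
      moreover have "- u (X k) \<le> g x0" for k
        using Xg[of k] u_pos[OF AX, of k] mult_pos_pos[OF \<epsilon> bpos[OF X\<Omega>, of k]] by (simp add: g_def)
      ultimately have "- 0 \<le> g x0" by (intro LIMSEQ_le_const2) auto
      then show ?thesis using g0 by simp
    next
      case 3
      note n = closure_sphere[OF zc 3]
      show ?thesis
      proof (cases "mink (conevec z) M = 0")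
        case True
        have "filterlim (\<lambda>k. b (X k)) at_top sequentially"
          unfolding b_def by (rule barrier_blow_up[OF T TM MM _ lim n(1) True]) (use X\<Omega> Omega(4) in blast)
        then have "\<forall>\<^sub>F k in sequentially. 2 * B / \<epsilon> \<le> b (X k)" by (simp add: filterlim_at_top)
        then obtain k where "2 * B / \<epsilon> \<le> b (X k)" by (auto simp: eventually_sequentially)
        then have "2 * B \<le> \<epsilon> * b (X k)" using \<epsilon> by (simp add: pos_divide_le_eq mult.commute)
        then have "0 \<le> g (X k)" using B[OF X\<Omega>, of k] B[OF AX, of k] by (simp add: g_def)
        then show ?thesis using Xg[of k] g0 by simp
      next
        case False
        then have pz: "0 < mink (conevec z) M" using n by simp
        have "(\<lambda>k. u (act A (X k)) - u (X k)) \<longlonglongrightarrow> C - C"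
          using act_ideal[OF lor n(1) str[OF n]]
          by (intro tendsto_diff u_limit[OF AX Alim] u_limit[OF X\<Omega> lim n(1) pz])
        moreover have "u (act A (X k)) - u (X k) \<le> g x0" for k
          using Xg[of k] mult_pos_pos[OF \<epsilon> bpos[OF X\<Omega>, of k]] by (simp add: g_def)
        ultimately have "C - C \<le> g x0" by (intro LIMSEQ_le_const2) auto
        then show ?thesis using g0 by simp
      qed
    qed
  qed
  moreover have "bounded S"
    using Omega(4) by (intro bounded_subset[OF bounded_ball[of 0 1]]) (auto simp: S_def)
  ultimately have "compact S" by (simp add: compact_eq_bounded_closed)
  moreover have "S \<noteq> {}" using x0 by (auto simp: S_def)
  moreover have "continuous_on S g" by (rule continuous_on_subset[OF gcont]) (auto simp: S_def)
  ultimately obtain z where z: "z \<in> S" "\<And>y. y \<in> S \<Longrightarrow> g z \<le> g y" using continuous_attains_inf by meson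
  have z\<Omega>: "z \<in> \<Omega>" using z(1) by (simp add: S_def)
  have zh: "z \<in> hyp" using z\<Omega> Omega(4) by blast
  have gz: "g z < 0" using z(1) g0 by (simp add: S_def)
  have "g z \<le> g y" if "y \<in> \<Omega>" for y
    using z(2)[of y] z(1) that by (cases "y \<in> S") (auto simp: S_def)
  moreover have "\<forall>\<^sub>F y in nhds z. y \<in> \<Omega>" using z\<Omega> Omega(1) by (simp add: eventually_nhds_in_open)
  ultimately have min: "\<forall>\<^sub>F y in nhds z. g z \<le> g y" by (auto elim: eventually_mono)
  obtain d where d: "d < 0" "has_hlap b z d"
    using barrier_superharmonic[OF dim zh T TM MM] unfolding b_def by blast
  have "has_hlap (\<lambda>y. u (act A y)) z (- f (u (act A z)))"
    by (rule has_hlap_act[OF lor zh u_hlap[OF sub[OF z\<Omega>]]])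
  from has_hlap_add[OF has_hlap_diff[OF this u_hlap[OF z\<Omega>]] has_hlap_cmult[OF d(2), of \<epsilon>]]
  have "has_hlap g z (- f (u (act A z)) - - f (u z) + \<epsilon> * d)" by (simp add: g_def[abs_def])
  then have "0 \<le> - f (u (act A z)) - - f (u z) + \<epsilon> * d" by (rule has_hlap_local_min[OF zh _ min])
  moreover have "u (act A z) \<le> u z" using gz mult_pos_pos[OF \<epsilon> bpos[OF z\<Omega>]] by (simp add: g_def)
  then have "f (u z) \<le> f (u (act A z))" using anti by (simp add: antimono_def)
  moreover have "\<epsilon> * d < 0" using \<epsilon> d(1) by (rule mult_pos_neg)
  ultimately show False by simp
qed

end

lemma closure_limit:
  fixes X :: "nat \<Rightarrow> 'a::first_countable_topology"
  assumes "\<And>k. X k \<in> S" "X \<longlonglongrightarrow> x" shows "x \<in> closure S"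
  unfolding closure_sequential using assms by (intro exI[of _ X]) simp

context equator_oep
begin

lemma act_closure:
  assumes A: "lorentz A" and sub: "\<And>x. x \<in> \<Omega> \<Longrightarrow> act A x \<in> closure \<Omega>" and z: "z \<in> closure \<Omega>"
  shows "act A z \<in> closure \<Omega>"
proof -
  obtain X where X: "\<And>k. X k \<in> \<Omega>" "X \<longlonglongrightarrow> z" using z closure_sequential by metis
  have "(\<lambda>k. act A (X k)) \<longlonglongrightarrow> act A z" by (rule tendsto_act[OF A closure_cball[OF z] X(2)])
  from closure_limit[OF sub[OF X(1)] this] show ?thesis by simp
qed

lemma hboundary_outside:
  assumes p: "p \<in> hboundary \<Omega>"
  obtains Y where "\<forall>k::nat. Y k \<in> hyp \<and> Y k \<notin> closure \<Omega>" "Y \<longlonglongrightarrow> p"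
proof (rule boundary_point[OF dom p])
  have ph: "p \<in> hyp" by (rule hboundary_hyp[OF p])
  fix \<nu> assume \<nu>: "norm \<nu> = 1"
    and out: "\<And>e. norm e = 1 \<Longrightarrow> 0 < e \<bullet> \<nu> \<Longrightarrow> \<forall>\<^sub>F s in at_right 0. geo p e s \<notin> closure \<Omega>"
  have "0 < \<nu> \<bullet> \<nu>" using \<nu> by (simp add: dot_square_norm)
  from out[OF \<nu> this] have "\<exists>b>0. \<forall>s>0. s < b \<longrightarrow> geo p \<nu> s \<notin> closure \<Omega>"
    unfolding eventually_at_right_field .
  then obtain d where d: "0 < d" "\<forall>s>0. s < d \<longrightarrow> geo p \<nu> s \<notin> closure \<Omega>" by blast
  define t where "t k = d / 2 / real (Suc k)" for k
  have t: "0 < t k" "t k < d" for k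
  proof -
    show "0 < t k" using d(1) by (simp add: t_def)
    have "t k \<le> d / 2" using d(1) by (simp add: t_def divide_le_eq)
    then show "t k < d" using d(1) by simp
  qed
  have t0: "t \<longlonglongrightarrow> 0"
    unfolding t_def[abs_def] divide_inverse[of _ "real (Suc _)"]
    using tendsto_mult[OF tendsto_const[of "d / 2"] LIMSEQ_inverse_real_of_nat] by (simp only: mult_zero_right)
  have "isCont (geo p \<nu>) 0" by (rule continuous_geo[OF ph \<nu>])
  then have "(\<lambda>k. geo p \<nu> (t k)) \<longlonglongrightarrow> geo p \<nu> 0" by (rule isCont_tendsto_compose[OF _ t0])
  then have "(\<lambda>k. geo p \<nu> (t k)) \<longlonglongrightarrow> p" by (simp only: geo_0[OF ph])
  show ?thesis
  proof (rule that)
    show "\<forall>k. geo p \<nu> (t k) \<in> hyp \<and> geo p \<nu> (t k) \<notin> closure \<Omega>"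
    proof (intro allI conjI)
      show "geo p \<nu> (t k) \<in> hyp" for k by (rule geo_hyp[OF ph \<nu>])
      show "geo p \<nu> (t k) \<notin> closure \<Omega>" for k using d(2) t[of k] by simp
    qed
  qed fact
qed

text \<open>If an interior point were sent to the boundary, nearby points outside the closure would pull back into
  \<open>\<Omega>\<close>, because the inverse isometry is continuous; this contradicts the assumption at these points.\<close>

lemma act_into_interior:
  assumes A: "lorentz A" and sub: "\<And>x. x \<in> \<Omega> \<Longrightarrow> act A x \<in> closure \<Omega>" and x: "x \<in> \<Omega>"
  shows "act A x \<in> \<Omega>"
proof (rule ccontr)
  assume no: "act A x \<notin> \<Omega>"
  have xh: "x \<in> hyp" using x Omega(4) by blast
  have "act A x \<in> hboundary \<Omega>" using closure_hyp[OF sub[OF x] act_hyp[OF A xh]] no by blast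
  then obtain Y where Y': "\<forall>k::nat. Y k \<in> hyp \<and> Y k \<notin> closure \<Omega>" and Y: "Y \<longlonglongrightarrow> act A x"
    by (rule hboundary_outside)
  obtain B where B: "lorentz B" "\<And>X. B (A X) = X" "\<And>X. A (B X) = X" using lorentz_inverse[OF A] by blast
  have AB: "act A (act B y) = y" if "y \<in> hyp" for y
    by (rule lift_inj) (use that in \<open>simp_all add: lift_act A B act_hyp del: mem_ball mem_ball_0\<close>)
  have BA: "act B (act A x) = x"
    by (rule lift_inj) (use xh in \<open>simp_all add: lift_act A B act_hyp del: mem_ball mem_ball_0\<close>)
  have "act A x \<in> cball 0 1" using act_hyp[OF A xh] ball_subset_cball by blast
  from tendsto_act[OF B(1) this Y] have "(\<lambda>k. act B (Y k)) \<longlonglongrightarrow> x" by (simp only: BA)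
  then have "\<forall>\<^sub>F k in sequentially. act B (Y k) \<in> \<Omega>" using x Omega(1) by (simp add: topological_tendstoD)
  then obtain k where "act B (Y k) \<in> \<Omega>" by (auto simp: eventually_sequentially)
  from sub[OF this] AB Y' show False by simp
qed

lemma moved_hlap:
  assumes A: "moves_in A" and x: "x \<in> \<Omega>"
  shows "\<exists>d. has_hlap (\<lambda>y. u (act A y) - u y) x d \<and> d \<le> K * (u (act A x) - u x)"
proof -
  have lor: "lorentz A" and sub: "\<And>x. x \<in> \<Omega> \<Longrightarrow> act A x \<in> \<Omega>" using A by (auto simp: moves_in_def)
  have xh: "x \<in> hyp" using x Omega(4) by blast
  have "has_hlap (\<lambda>y. u (act A y)) x (- f (u (act A x)))"
    by (rule has_hlap_act[OF lor xh u_hlap[OF sub[OF x]]])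
  from has_hlap_diff[OF this u_hlap[OF x]]
  have "has_hlap (\<lambda>y. u (act A y) - u y) x (- f (u (act A x)) - - f (u x))" .
  moreover have "- f (u (act A x)) - - f (u x) \<le> K * (u (act A x) - u x)"
    using K(2)[of "u x" "u (act A x)"] comparison[OF A x] by (simp add: abs_le_iff abs_if split: if_splits)
  ultimately show ?thesis by blast
qed

lemma act_continuous:
  assumes "lorentz A" "S \<subseteq> cball 0 1" shows "continuous_on S (act A)"
  unfolding continuous_on_def
proof
  fix x assume "x \<in> S"
  then have "x \<in> cball 0 1" using assms(2) by blast
  then show "(act A \<longlongrightarrow> act A x) (at x within S)" by (rule tendsto_act[OF assms(1) _ tendsto_ident_at])
qed

lemma moved_continuous:
  assumes A: "moves_in A"
  shows "continuous_on (hclosure \<Omega>) (\<lambda>y. u (act A y) - u y)"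
proof -
  have lor: "lorentz A" and sub: "\<And>x. x \<in> \<Omega> \<Longrightarrow> act A x \<in> closure \<Omega>"
    using A closure_subset by (auto simp: moves_in_def)
  have "continuous_on (hclosure \<Omega>) (act A)"
    by (rule act_continuous[OF lor]) (auto simp: hclosure_def)
  moreover have "act A ` hclosure \<Omega> \<subseteq> hclosure \<Omega>"
    using act_closure[OF lor sub] act_hyp[OF lor] by (auto simp: hclosure_def simp del: mem_ball mem_ball_0)
  ultimately have "continuous_on (hclosure \<Omega>) (\<lambda>y. u (act A y))"
    by (intro continuous_on_compose2[OF u_continuous])
  then show ?thesis by (intro continuous_intros u_continuous)
qed

lemma Omega_hclosure: "\<Omega> \<subseteq> hclosure \<Omega>"
  using Omega(4) closure_subset by (auto simp: hclosure_def)

text \<open>If equality held at one point, it would hold everywhere by the strong maximum principle. Then the boundary, which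
  is where \<open>u\<close> vanishes, would be mapped into itself, and so would the equator; but the equator is moved off itself.\<close>

lemma comparison_strict:
  assumes A: "moves_in A" and x: "x \<in> \<Omega>"
  shows "u x < u (act A x)"
proof (rule ccontr)
  assume "\<not> u x < u (act A x)"
  then have eq: "u (act A x) - u x = 0" using comparison[OF A x] by simp
  have lor: "lorentz A" and sub: "\<And>x. x \<in> \<Omega> \<Longrightarrow> act A x \<in> \<Omega>"
    and str: "\<And>\<xi>. norm \<xi> = 1 \<Longrightarrow> 0 \<le> mink (conevec \<xi>) M \<Longrightarrow> 0 < mink (A (conevec \<xi>)) M"
    using A by (auto simp: moves_in_def)
  have zero: "u (act A y) - u y = 0" if "y \<in> \<Omega>" for y
  proof (rule strong_maximum_principle[where w = "\<lambda>y. u (act A y) - u y", OF Omega(1,2,4) K(1) _ _ _ x eq that])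
    show "0 \<le> u (act A y) - u y" if "y \<in> \<Omega>" for y using comparison[OF A that] by simp
    show "continuous_on \<Omega> (\<lambda>y. u (act A y) - u y)"
      by (rule continuous_on_subset[OF moved_continuous[OF A] Omega_hclosure])
    show "\<exists>d. has_hlap (\<lambda>y. u (act A y) - u y) y d \<and> d \<le> K * (u (act A y) - u y)" if "y \<in> \<Omega>" for y
      by (rule moved_hlap[OF A that])
  qed
  have bd: "act A p \<in> hboundary \<Omega>" if p: "p \<in> hboundary \<Omega>" for p
  proof -
    have ph: "p \<in> hyp" by (rule hboundary_hyp[OF p])
    obtain X where X: "\<And>k. X k \<in> \<Omega>" "X \<longlonglongrightarrow> p" using hboundary_closure[OF p] closure_sequential by metis
    have Alim: "(\<lambda>k. act A (X k)) \<longlonglongrightarrow> act A p"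
      by (rule tendsto_act[OF lor _ X(2)]) (use ph ball_subset_cball in blast)
    have "(\<lambda>k. u (act A (X k))) \<longlonglongrightarrow> u (act A p)" by (rule u_tendsto[OF sub[OF X(1)] Alim act_hyp[OF lor ph]])
    moreover have "(\<lambda>k. u (act A (X k))) \<longlonglongrightarrow> 0"
      using u_tendsto[OF X ph] zero[OF X(1)] u_zero[OF p] by simp
    ultimately have "u (act A p) = 0" by (rule LIMSEQ_unique)
    then have "act A p \<notin> \<Omega>" using u_pos by force
    moreover have "act A p \<in> closure \<Omega>"
      by (rule act_closure[OF lor _ hboundary_closure[OF p]]) (use sub closure_subset in blast)
    ultimately show ?thesis using closure_hyp[OF _ act_hyp[OF lor ph]] by blast
  qed
  obtain \<xi> where \<xi>: "norm \<xi> = 1" "mink (conevec \<xi>) M = 0" using equator_nonempty by blast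
  then have "\<xi> \<in> closure (hboundary \<Omega>)" using ideal_bd by (auto simp: ideal_boundary_def)
  then obtain X where X: "\<And>k. X k \<in> hboundary \<Omega>" "X \<longlonglongrightarrow> \<xi>" using closure_sequential by metis
  have "(\<lambda>k. act A (X k)) \<longlonglongrightarrow> act A \<xi>" by (rule tendsto_act[OF lor _ X(2)]) (simp add: \<xi>)
  from closure_limit[OF bd[OF X(1)] this] have "act A \<xi> \<in> closure (hboundary \<Omega>)" .
  moreover have "0 < mink (A (conevec \<xi>)) M" by (rule str[OF \<xi>(1)]) (simp add: \<xi>(2))
  note i = act_ideal[OF lor \<xi>(1) this]
  ultimately show False using not_closure_hboundary[OF i] by simp
qed

text \<open>At a contact point the isometry maps the inner normal to the inner normal, because it maps inward directions to
  inward ones. Hence \<open>u \<circ> act A\<close> and \<open>u\<close> have the same slope there, as the Neumann datum is the same constant. This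
  contradicts the Hopf lemma for their positive difference.\<close>

lemma no_contact:
  assumes A: "moves_in A" and p: "p \<in> hboundary \<Omega>" and q: "act A p \<in> hboundary \<Omega>"
  shows False
proof -
  have lor: "lorentz A" and sub: "\<And>x. x \<in> \<Omega> \<Longrightarrow> act A x \<in> \<Omega>" using A by (auto simp: moves_in_def)
  have ph: "p \<in> hyp" by (rule hboundary_hyp[OF p])
  show False
  proof (rule boundary_point[OF dom p], rule boundary_point[OF dom q])
    fix \<nu> R assume \<nu>: "norm \<nu> = 1" and R: "0 < R" "cball (p - R *\<^sub>R \<nu>) R \<subseteq> hyp" "cball (p - R *\<^sub>R \<nu>) R - {p} \<subseteq> \<Omega>"
      and inn: "\<And>e. norm e = 1 \<Longrightarrow> e \<bullet> \<nu> < 0 \<Longrightarrow> \<forall>\<^sub>F s in at_right 0. geo p e s \<in> \<Omega>"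
      and nor: "outward_unit_normal \<Omega> p ((1 / conf p) *\<^sub>R \<nu>)"
    fix \<mu> assume \<mu>: "norm \<mu> = 1"
      and out': "\<And>e. norm e = 1 \<Longrightarrow> 0 < e \<bullet> \<mu> \<Longrightarrow> \<forall>\<^sub>F s in at_right 0. geo (act A p) e s \<notin> closure \<Omega>"
      and nor': "outward_unit_normal \<Omega> (act A p) ((1 / conf (act A p)) *\<^sub>R \<mu>)"
    define t where "t = turn A p"
    have tlin: "linear t" unfolding t_def by (rule turn_linear[OF lor])
    have tn: "norm (t v) = norm v" for v unfolding t_def by (rule turn_norm[OF lor ph])
    have ti: "t v \<bullet> t w = v \<bullet> w" for v w unfolding t_def by (rule turn_inner[OF lor ph])
    have ag: "act A (geo p e s) = geo (act A p) (t e) s" if "norm e = 1" for e s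
      unfolding t_def by (rule act_geo[OF lor ph that])
    have cone: "t e \<bullet> \<mu> \<le> 0" if e: "norm e = 1" "e \<bullet> \<nu> < 0" for e
    proof (rule ccontr)
      assume "\<not> t e \<bullet> \<mu> \<le> 0"
      then have "\<forall>\<^sub>F s in at_right 0. geo (act A p) (t e) s \<notin> closure \<Omega>"
        by (intro out') (simp_all add: tn e)
      with inn[OF e] have "\<forall>\<^sub>F s in at_right (0::real). False"
      proof eventually_elim
        case (elim s)
        then show False using sub[of "geo p e s"] closure_subset[of \<Omega>] by (auto simp: ag[OF e(1)])
      qed
      then show False by simp
    qed
    have "t \<nu> = \<mu>"
    proof (rule ccontr)
      assume ne: "t \<nu> \<noteq> \<mu>"
      have surj: "surj t"
        by (rule orthogonal_transformation_surj) (simp add: orthogonal_transformation_def tlin ti)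
      then obtain m where m: "t m = \<mu>" by (metis surjD)
      have mn: "norm m = 1" using tn[of m] m \<mu> by simp
      have ne': "m \<noteq> \<nu>" using ne m by auto
      have lt: "m \<bullet> \<nu> < 1"
      proof -
        have "0 < (norm (m - \<nu>))\<^sup>2" using ne' by simp
        also have "(norm (m - \<nu>))\<^sup>2 = 2 - 2 * (m \<bullet> \<nu>)"
        proof -
          have "m \<bullet> m = 1" "\<nu> \<bullet> \<nu> = 1" using mn \<nu> by (simp_all add: dot_square_norm)
          then show ?thesis by (simp add: power2_norm_eq_inner inner_simps inner_commute)
        qed
        finally show ?thesis by simp
      qed
      (* This direction is inward for \<nu>, while its image is outward for \<mu>. *)
      define e where "e = (1 / norm (m - \<nu>)) *\<^sub>R (m - \<nu>)"
      have e: "norm e = 1" using ne' by (simp add: e_def)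
      have "e \<bullet> \<nu> = (1 / norm (m - \<nu>)) * (m \<bullet> \<nu> - 1)"
        using \<nu> by (simp add: e_def inner_simps dot_square_norm)
      then have 1: "e \<bullet> \<nu> < 0" using lt ne' by (simp add: divide_less_0_iff)
      have "t e \<bullet> \<mu> = e \<bullet> m" using ti[of e m] m by simp
      also have "\<dots> = (1 / norm (m - \<nu>)) * (1 - m \<bullet> \<nu>)"
        using mn by (simp add: e_def inner_simps dot_square_norm inner_commute)
      also have "\<dots> > 0" using lt ne' by simp
      finally show False using cone[OF e 1] by simp
    qed
    then have t\<nu>: "t (- \<nu>) = - \<mu>" using linear_neg[OF tlin] by simp
    have en: "norm (- \<nu>) = 1" using \<nu> by simp
    have ins: "\<forall>\<^sub>F s in at_right 0. geo p (- \<nu>) s \<in> \<Omega>"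
      by (rule inn[OF en]) (use \<nu> in \<open>simp add: dot_square_norm\<close>)
    have moved: "act A (geo p (- \<nu>) s) = geo (act A p) (- \<mu>) s" for s using ag[OF en] t\<nu> by simp
    have ins': "\<forall>\<^sub>F s in at_right 0. geo (act A p) (- \<mu>) s \<in> \<Omega>"
      using ins by eventually_elim (use sub moved in metis)
    have "((\<lambda>s. u (geo (act A p) (- \<mu>) s) / s - u (geo p (- \<nu>) s) / s) \<longlongrightarrow> - \<alpha> - - \<alpha>) (at_right 0)"
      by (intro tendsto_diff u_slope[OF p \<nu> nor ins] u_slope[OF q \<mu> nor' ins'])
    then have lim: "((\<lambda>s. (u (act A (geo p (- \<nu>) s)) - u (geo p (- \<nu>) s)) / s) \<longlongrightarrow> 0) (at_right 0)"
      by (simp add: moved diff_divide_distrib)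
    have "\<exists>\<kappa>>0. \<forall>\<^sub>F s in at_right 0. \<kappa> * s \<le> u (act A (geo p (- \<nu>) s)) - u (geo p (- \<nu>) s)"
    proof (rule hopf_lemma[where w = "\<lambda>y. u (act A y) - u y" and R = R and K = K and y = "p - R *\<^sub>R \<nu>" and e = "- \<nu>"])
      have cb: "cball (p - R *\<^sub>R \<nu>) R \<subseteq> hclosure \<Omega>"
      proof
        fix x assume x: "x \<in> cball (p - R *\<^sub>R \<nu>) R"
        show "x \<in> hclosure \<Omega>"
        proof (cases "x = p")
          case True
          then show ?thesis using hboundary_closure[OF p] ph by (simp add: hclosure_def)
        next
          case False
          then show ?thesis using x R(3) Omega_hclosure by blast
        qed
      qed
      show "continuous_on (cball (p - R *\<^sub>R \<nu>) R) (\<lambda>y. u (act A y) - u y)"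
        by (rule continuous_on_subset[OF moved_continuous[OF A] cb])
      have b: "x \<in> \<Omega>" if "x \<in> ball (p - R *\<^sub>R \<nu>) R" for x
      proof -
        have "x \<noteq> p" using that \<nu> R(1) by (auto simp: dist_norm)
        moreover have "x \<in> cball (p - R *\<^sub>R \<nu>) R" using that ball_subset_cball by blast
        ultimately show ?thesis using R(3) by blast
      qed
      show "0 < u (act A x) - u x" if "x \<in> ball (p - R *\<^sub>R \<nu>) R" for x
        using comparison_strict[OF A b[OF that]] by simp
      show "\<exists>d. has_hlap (\<lambda>y. u (act A y) - u y) x d \<and> d \<le> K * (u (act A x) - u x)"
        if "x \<in> ball (p - R *\<^sub>R \<nu>) R" for x
        by (rule moved_hlap[OF A b[OF that]])
      show "u (act A p) - u p = 0" using u_zero[OF p] u_zero[OF q] by simp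
    qed (use R en K(1) in auto)
    then obtain \<kappa> where \<kappa>: "0 < \<kappa>" "\<forall>\<^sub>F s in at_right 0. \<kappa> * s \<le> u (act A (geo p (- \<nu>) s)) - u (geo p (- \<nu>) s)"
      by blast
    have "\<forall>\<^sub>F s in at_right 0. \<kappa> \<le> (u (act A (geo p (- \<nu>) s)) - u (geo p (- \<nu>) s)) / s"
      using \<kappa>(2) eventually_at_right_less[of 0] by eventually_elim (simp add: pos_le_divide_eq)
    from tendsto_lowerbound[OF lim this] have "\<kappa> \<le> 0" by simp
    then show False using \<kappa>(1) by simp
  qed
qed

subsection \<open>Moving the domain towards the equator\<close>

text \<open>Translation along the geodesic that is orthogonal to the hyperplane at \<open>T\<close>, after an isometry that preserves the
  hyperplane and its sides. For \<open>t > 0\<close> it maps the closed hemisphere into its interior.\<close>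

definition shift :: "('a \<times> real \<Rightarrow> 'a \<times> real) \<Rightarrow> real \<Rightarrow> 'a \<times> real \<Rightarrow> 'a \<times> real" where
  "shift g t = boost T M t \<circ> g"

context
  fixes g assumes g: "lorentz g" and gM: "g M = M"
begin

lemma shift_lorentz: "lorentz (shift g t)"
  unfolding shift_def by (rule lorentz_compose[OF boost_lorentz[OF T TM MM] g])

lemma height_g: "mink (g X) M = mink X M"
  using lorentz_mink[OF g, of X M] by (simp add: gM)

lemma shift_strict:
  assumes "0 < t" "norm \<xi> = 1" "0 \<le> mink (conevec \<xi>) M"
  shows "0 < mink (shift g t (conevec \<xi>)) M"
proof -
  have "g (conevec \<xi>) \<in> future" by (rule lorentz_future[OF g conevec_future]) (simp add: assms(2))
  from mink_future_neg[OF T this] have "mink (g (conevec \<xi>)) T < 0" by (simp add: mink_commute)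
  moreover have "0 < sinh t" using assms(1) by simp
  ultimately have "sinh t * mink (g (conevec \<xi>)) T < 0" by (intro mult_pos_neg)
  moreover have "0 \<le> cosh t * mink (g (conevec \<xi>)) M" using assms(3) cosh_real_pos[of t] by (simp add: height_g)
  ultimately show ?thesis by (simp add: shift_def mink_boost_V[OF TM MM])
qed

lemma shift_moves_in: "0 < t \<Longrightarrow> (\<And>x. x \<in> \<Omega> \<Longrightarrow> act (shift g t) x \<in> \<Omega>) \<Longrightarrow> moves_in (shift g t)"
  by (simp add: moves_in_def shift_lorentz shift_strict)

lemma shift_tendsto:
  assumes "X \<longlonglongrightarrow> x" "x \<in> cball 0 1" "t \<longlonglongrightarrow> \<tau>"
  shows "(\<lambda>k. act (shift g (t k)) (X k)) \<longlonglongrightarrow> act (shift g \<tau>) x"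
  unfolding shift_def by (rule tendsto_act_boost[OF T TM MM g assms(2,1,3)])

lemma shift_ideal:
  assumes "0 < t" "z \<in> closure \<Omega>" "z \<notin> hyp"
  shows "norm (act (shift g t) z) = 1" "0 < mink (conevec (act (shift g t) z)) M"
  using act_ideal[OF shift_lorentz closure_sphere(1)[OF assms(2,3)] shift_strict[OF assms(1) closure_sphere[OF assms(2,3)]]]
  by auto

text \<open>For large \<open>t\<close> the boost moves everything except the repelling ideal point to the attracting one. The repelling
  point is not in the closure of \<open>\<Omega>\<close>, and the attracting one has a neighbourhood in \<open>\<Omega>\<close>. In coordinates,
  \<open>exp (- t)\<close> times the image converges to a positive multiple of the null vector \<open>T + M\<close>.\<close>

lemma shift_sequence_escapes:
  assumes X: "\<And>k. X k \<in> \<Omega>" "X \<longlonglongrightarrow> x" and t: "filterlim t at_top sequentially"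
  shows "\<forall>\<^sub>F k::nat in sequentially. act (shift g (t k)) (X k) \<in> \<Omega>"
proof -
  have xc: "x \<in> closure \<Omega>" by (rule closure_limit[OF X])
  have xb: "x \<in> cball 0 1" by (rule closure_cball[OF xc])
  define Z where "Z k = g (conevec (X k))" for k
  define Z0 where "Z0 = g (conevec x)"
  have Zl: "Z \<longlonglongrightarrow> Z0"
    unfolding Z_def[abs_def] Z0_def by (intro tendsto_linear[OF lorentz_linear[OF g]] tendsto_conevec X(2))
  define a where "a = - mink Z0 T"
  define b where "b = mink Z0 M"
  have ab: "0 < a + b"
  proof (cases "x \<in> hyp")
    case True
    have L: "g (lift x) \<in> hyperboloid" by (rule lorentz_hyperboloid[OF g lift_hyperboloid[OF True]])
    note c = hyperboloid_coordinates[OF L T TM MM]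
    have "(mink (g (lift x)) M)\<^sup>2 < (mink (g (lift x)) (- T))\<^sup>2" using c(1) by simp
    then have "\<bar>mink (g (lift x)) M\<bar> < \<bar>mink (g (lift x)) (- T)\<bar>"
      unfolding not_le[symmetric] abs_le_square_iff .
    then have "\<bar>mink (g (lift x)) M\<bar> < mink (g (lift x)) (- T)" using c(2) by simp
    then have "0 < mink (g (lift x)) M - mink (g (lift x)) T" by (simp add: mink_simps)
    moreover have Zx: "Z0 = (1 - (norm x)\<^sup>2) *\<^sub>R g (lift x)"
      unfolding Z0_def conevec_lift[OF True] by (rule linear_cmul[OF lorentz_linear[OF g]])
    have "a + b = (1 - (norm x)\<^sup>2) * (mink (g (lift x)) M - mink (g (lift x)) T)"
      unfolding a_def b_def Zx mink_scale_left right_diff_distrib by simp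
    ultimately show ?thesis using hyp_norm[OF True] \<open>a + b = _\<close> by simp
  next
    case False
    have "Z0 \<in> future" unfolding Z0_def by (rule lorentz_future[OF g conevec_future[OF xb]])
    from mink_future_neg[OF T this] have "0 < a" by (simp add: a_def mink_commute)
    moreover have "0 \<le> b" using closure_sphere(2)[OF xc False] by (simp add: b_def Z0_def height_g)
    ultimately show ?thesis by simp
  qed
  define N where "N = T + M"
  have TT: "mink T T = -1" using T by (simp add: hyperboloid_def)
  have NN: "mink N N = 0" by (simp add: N_def mink_simps TT TM MM mink_commute[of M T])
  have "N \<in> future" by (rule futureI[OF T]) (simp_all add: NN, simp add: N_def mink_simps TT TM)
  then have sN: "0 < snd N" by (simp add: future_def)
  define \<xi> where "\<xi> = (1 / snd N) *\<^sub>R fst N"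
  have "(norm (fst N))\<^sup>2 = (snd N)\<^sup>2" using NN by (simp add: mink_self)
  then have "norm (fst N) = snd N" using sN by (metis less_eq_real_def norm_ge_zero power2_eq_imp_eq)
  then have n: "norm \<xi> = 1" using sN by (simp add: \<xi>_def)
  have "conevec \<xi> = (2 / snd N) *\<^sub>R N"
    unfolding conevec_def n using sN by (simp add: prod_eq_iff \<xi>_def)
  moreover have "mink N M = 1" by (simp add: N_def mink_simps TM MM)
  ultimately have pos: "0 < mink (conevec \<xi>) M" using sN by (simp add: mink_simps)
  (* The factor exp (- t) cancels in act, and it makes the numerator and the denominator converge. *)
  define l where "l k = exp (- t k)" for k
  have l0: "l \<longlonglongrightarrow> 0"
    unfolding l_def[abs_def]
    by (rule filterlim_compose[OF exp_at_bot]) (use t in \<open>simp add: filterlim_uminus_at_bot\<close>)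
  have lc: "l k * cosh (t k) = (1 + l k * l k) / 2" and ls: "l k * sinh (t k) = (1 - l k * l k) / 2" for k
    by (simp_all add: l_def cosh_def sinh_def algebra_simps flip: exp_add)
  define W where "W k = l k *\<^sub>R shift g (t k) (conevec (X k))" for k
  have W: "W k = l k *\<^sub>R Z k - mink (Z k) T *\<^sub>R ((l k * cosh (t k) - l k) *\<^sub>R T + (l k * sinh (t k)) *\<^sub>R M)
                     + mink (Z k) M *\<^sub>R ((l k * sinh (t k)) *\<^sub>R T + (l k * cosh (t k) - l k) *\<^sub>R M)" for k
    by (simp add: W_def shift_def boost_def Z_def[symmetric] algebra_simps)
  have W1: "W \<longlonglongrightarrow> 0 *\<^sub>R Z0 - mink Z0 T *\<^sub>R (((1 + 0 * 0) / 2 - 0) *\<^sub>R T + ((1 - 0 * 0) / 2) *\<^sub>R M)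
                     + mink Z0 M *\<^sub>R (((1 - 0 * 0) / 2) *\<^sub>R T + ((1 + 0 * 0) / 2 - 0) *\<^sub>R M)"
    unfolding W[abs_def] lc ls by (intro tendsto_intros Zl l0) simp_all
  have W2: "0 *\<^sub>R Z0 - mink Z0 T *\<^sub>R (((1 + 0 * 0) / 2 - 0) *\<^sub>R T + ((1 - 0 * 0) / 2) *\<^sub>R M)
                     + mink Z0 M *\<^sub>R (((1 - 0 * 0) / 2) *\<^sub>R T + ((1 + 0 * 0) / 2 - 0) *\<^sub>R M) = ((a + b) / 2) *\<^sub>R N"
    by (simp add: a_def b_def N_def algebra_simps add_divide_distrib diff_divide_distrib)
  have Wl: "W \<longlonglongrightarrow> ((a + b) / 2) *\<^sub>R N" using W1 unfolding W2 .
  have d: "snd (((a + b) / 2) *\<^sub>R N) + 0 * (1 - (norm x)\<^sup>2) \<noteq> 0" using ab sN by simp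
  have "(\<lambda>k. (1 / (snd (W k) + l k * (1 - (norm (X k))\<^sup>2))) *\<^sub>R fst (W k)) \<longlonglongrightarrow>
     (1 / (snd (((a + b) / 2) *\<^sub>R N) + 0 * (1 - (norm x)\<^sup>2))) *\<^sub>R fst (((a + b) / 2) *\<^sub>R N)"
    by (intro tendsto_intros Wl l0 X(2) d)
  moreover have "(1 / (snd (W k) + l k * (1 - (norm (X k))\<^sup>2))) *\<^sub>R fst (W k) = act (shift g (t k)) (X k)" for k
  proof -
    have "l k \<noteq> 0" by (simp add: l_def)
    moreover have "snd (W k) + l k * (1 - (norm (X k))\<^sup>2) = l k * (snd (shift g (t k) (conevec (X k))) + (1 - (norm (X k))\<^sup>2))"
      by (simp add: W_def algebra_simps)
    ultimately show ?thesis by (simp add: act_def W_def)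
  qed
  moreover have "(1 / (snd (((a + b) / 2) *\<^sub>R N) + 0 * (1 - (norm x)\<^sup>2))) *\<^sub>R fst (((a + b) / 2) *\<^sub>R N) = \<xi>"
  proof -
    have "(1 / (snd (r *\<^sub>R N) + 0 * z)) *\<^sub>R fst (r *\<^sub>R N) = \<xi>" if "0 < r" for r z
      using that sN by (simp add: \<xi>_def)
    then show ?thesis using ab by (simp only: half_gt_zero)
  qed
  ultimately have "(\<lambda>k. act (shift g (t k)) (X k)) \<longlonglongrightarrow> \<xi>" by (simp only:)
  from filterlim_iff[THEN iffD1, OF this] ideal_neighbourhood[OF n pos]
  have "\<forall>\<^sub>F k in sequentially. act (shift g (t k)) (X k) \<in> hyp \<longrightarrow> act (shift g (t k)) (X k) \<in> \<Omega>" by blast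
  then show ?thesis
    by eventually_elim (use act_hyp[OF shift_lorentz] X(1) Omega(4) in blast)
qed

lemma Omega_subsequence:
  assumes "\<And>k::nat. X k \<in> \<Omega>"
  shows "\<exists>x\<in>closure \<Omega>. \<exists>r. strict_mono r \<and> (X \<circ> r) \<longlonglongrightarrow> x"
proof -
  have "bounded (closure \<Omega>)" using bounded_subset[OF bounded_cball, of "closure \<Omega>" 0 1] closure_cball by blast
  then have "compact (closure \<Omega>)" by (simp add: compact_eq_bounded_closed)
  moreover have "\<forall>n. X n \<in> closure \<Omega>" using assms closure_subset by blast
  ultimately show ?thesis unfolding compact_def by (elim allE[of _ X]) simp
qed

lemma shift_eventually_inside: "\<exists>t0>0. \<forall>t\<ge>t0. \<forall>x\<in>\<Omega>. act (shift g t) x \<in> \<Omega>"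
proof (rule ccontr)
  assume no: "\<not> ?thesis"
  have "\<exists>t x. real (Suc k) \<le> t \<and> x \<in> \<Omega> \<and> act (shift g t) x \<notin> \<Omega>" for k
  proof -
    have "0 < real (Suc k)" by simp
    with no show ?thesis by blast
  qed
  then obtain t X where tX: "\<And>k. real (Suc k) \<le> t k" "\<And>k. X k \<in> \<Omega>" "\<And>k. act (shift g (t k)) (X k) \<notin> \<Omega>"
    by metis
  obtain x r where r: "strict_mono r" "(X \<circ> r) \<longlonglongrightarrow> x" using Omega_subsequence[of X, OF tX(2)] by blast
  have "filterlim t at_top sequentially"
  proof (rule filterlim_at_top_mono[OF filterlim_real_sequentially])
    show "\<forall>\<^sub>F k in sequentially. real k \<le> t k"
    proof (rule always_eventually, rule allI)
      show "real k \<le> t k" for k using tX(1)[of k] by simp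
    qed
  qed
  then have "filterlim (t \<circ> r) at_top sequentially"
    unfolding comp_def by (rule filterlim_compose[OF _ filterlim_subseq[OF r(1)]])
  from shift_sequence_escapes[OF _ r(2) this] tX(2)
  have "\<forall>\<^sub>F k in sequentially. act (shift g ((t \<circ> r) k)) ((X \<circ> r) k) \<in> \<Omega>" by simp
  then show False using tX(3) by (auto simp: eventually_sequentially)
qed

text \<open>Decrease \<open>t\<close> from infinity to the first time \<open>t0\<close> at which the image of \<open>\<Omega>\<close> is about to leave \<open>\<Omega>\<close>. If \<open>t0 > 0\<close>,
  the image touches the boundary of \<open>\<Omega>\<close> at a point, which is not ideal since the ideal boundary has moved into the
  interior of the hemisphere. This is excluded by \<open>no_contact\<close>.\<close>

lemma shift_inside:
  assumes "0 < t" "x \<in> \<Omega>" shows "act (shift g t) x \<in> \<Omega>"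
proof -
  define S where "S = {t. 0 < t \<and> (\<forall>s\<ge>t. \<forall>x\<in>\<Omega>. act (shift g s) x \<in> \<Omega>)}"
  have ne: "S \<noteq> {}" using shift_eventually_inside by (auto simp: S_def)
  have bdd: "bdd_below S" by (rule bdd_belowI[of _ 0]) (auto simp: S_def)
  define t0 where "t0 = Inf S"
  have t0: "0 \<le> t0" unfolding t0_def by (rule cInf_greatest[OF ne]) (auto simp: S_def)
  have above: "act (shift g s) x \<in> \<Omega>" if "t0 < s" "x \<in> \<Omega>" for s x
  proof -
    from that(1) obtain t where "t \<in> S" "t < s" using cInf_lessD[OF ne] unfolding t0_def by blast
    then show ?thesis using that(2) by (simp add: S_def)
  qed
  have "t0 = 0"
  proof (rule ccontr)
    assume "t0 \<noteq> 0"
    then have p0: "0 < t0" using t0 by simp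
    have at0: "act (shift g t0) x \<in> \<Omega>" if x: "x \<in> \<Omega>" for x
    proof (rule act_into_interior[OF shift_lorentz _ x])
      fix x assume x: "x \<in> \<Omega>"
      have "(\<lambda>k. t0 + inverse (real (Suc k))) \<longlonglongrightarrow> t0 + 0"
        by (intro tendsto_intros LIMSEQ_inverse_real_of_nat)
      then have "(\<lambda>k. act (shift g (t0 + inverse (real (Suc k)))) x) \<longlonglongrightarrow> act (shift g t0) x"
        using closure_cball x closure_subset by (intro shift_tendsto tendsto_const) auto
      moreover have "act (shift g (t0 + inverse (real (Suc k)))) x \<in> \<Omega>" for k by (rule above[OF _ x]) simp
      ultimately show "act (shift g t0) x \<in> closure \<Omega>" by (rule closure_limit[rotated])
    qed
    have mov: "moves_in (shift g t0)" by (rule shift_moves_in[OF p0 at0])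
    have "\<exists>s x. t0 - t0 / 2 * inverse (real (Suc k)) \<le> s \<and> s \<le> t0 \<and> x \<in> \<Omega> \<and> act (shift g s) x \<notin> \<Omega>" for k
    proof (rule ccontr)
      define r where "r = t0 - t0 / 2 * inverse (real (Suc k))"
      assume no: "\<not> ?thesis"
      have "inverse (real (Suc k)) \<le> 1" by (rule inverse_le_1_iff[THEN iffD2]) simp
      then have "t0 / 2 * inverse (real (Suc k)) \<le> t0 / 2 * 1" using p0 by (intro mult_left_mono) auto
      moreover have "0 < t0 / 2 * inverse (real (Suc k))" using p0 by simp
      ultimately have r: "0 < r" "r < t0" using p0 unfolding r_def by linarith+
      have "r \<in> S"
      proof -
        have "act (shift g s) x \<in> \<Omega>" if "r \<le> s" "x \<in> \<Omega>" for s x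
        proof (cases "s \<le> t0")
          case True
          then show ?thesis using no that by (auto simp: r_def)
        next
          case False
          then show ?thesis using above that(2) by simp
        qed
        then show ?thesis using r by (simp add: S_def)
      qed
      then have "t0 \<le> r" unfolding t0_def by (rule cInf_lower[OF _ bdd])
      then show False using r by simp
    qed
    then obtain s X where sX: "\<And>k. t0 - t0 / 2 * inverse (real (Suc k)) \<le> s k" "\<And>k. s k \<le> t0" "\<And>k. X k \<in> \<Omega>"
      "\<And>k. act (shift g (s k)) (X k) \<notin> \<Omega>" by metis
    obtain x r where x: "x \<in> closure \<Omega>" and r: "strict_mono r" "(X \<circ> r) \<longlonglongrightarrow> x"
      using Omega_subsequence[of X, OF sX(3)] by blast
    have xb: "x \<in> cball 0 1" by (rule closure_cball[OF x])
    have "s \<longlonglongrightarrow> t0"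
    proof (rule tendsto_sandwich[OF _ _ _ tendsto_const])
      have "(\<lambda>k. t0 - t0 / 2 * inverse (real (Suc k))) \<longlonglongrightarrow> t0 - t0 / 2 * 0"
        by (intro tendsto_intros LIMSEQ_inverse_real_of_nat)
      then show "(\<lambda>k. t0 - t0 / 2 * inverse (real (Suc k))) \<longlonglongrightarrow> t0" by (simp only: mult_zero_right diff_zero)
    qed (use sX(1,2) in \<open>auto intro!: always_eventually\<close>)
    then have "(s \<circ> r) \<longlonglongrightarrow> t0" by (rule LIMSEQ_subseq_LIMSEQ[OF _ r(1)])
    from shift_tendsto[OF r(2) xb this]
    have lim: "(\<lambda>k. act (shift g ((s \<circ> r) k)) ((X \<circ> r) k)) \<longlonglongrightarrow> act (shift g t0) x" .
    have out: "act (shift g ((s \<circ> r) k)) ((X \<circ> r) k) \<notin> \<Omega>" for k using sX(4) by simp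
    have notin: "act (shift g t0) x \<notin> \<Omega>"
    proof
      assume "act (shift g t0) x \<in> \<Omega>"
      with lim Omega(1) have "\<forall>\<^sub>F k in sequentially. act (shift g ((s \<circ> r) k)) ((X \<circ> r) k) \<in> \<Omega>"
        by (rule topological_tendstoD)
      then show False using out by (auto simp: eventually_sequentially)
    qed
    have "x \<in> hyp"
    proof (rule ccontr)
      assume xh: "x \<notin> hyp"
      from filterlim_iff[THEN iffD1, OF lim] ideal_neighbourhood[OF shift_ideal[OF p0 x xh]]
      have "\<forall>\<^sub>F k in sequentially. act (shift g ((s \<circ> r) k)) ((X \<circ> r) k) \<in> hyp \<longrightarrow>
          act (shift g ((s \<circ> r) k)) ((X \<circ> r) k) \<in> \<Omega>" by blast
      then obtain k where k: "act (shift g ((s \<circ> r) k)) ((X \<circ> r) k) \<in> hyp \<longrightarrow>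
          act (shift g ((s \<circ> r) k)) ((X \<circ> r) k) \<in> \<Omega>" by (auto simp: eventually_sequentially)
      have "(X \<circ> r) k \<in> hyp" unfolding comp_def using sX(3)[of "r k"] Omega(4) by blast
      from act_hyp[OF shift_lorentz this] k out show False by blast
    qed
    moreover have "x \<notin> \<Omega>" using at0 notin by blast
    ultimately have xbd: "x \<in> hboundary \<Omega>" using closure_hyp[OF x] by blast
    have "act (shift g t0) x \<in> closure \<Omega>"
      by (rule act_closure[OF shift_lorentz _ x]) (use at0 closure_subset in blast)
    then have "act (shift g t0) x \<in> hboundary \<Omega>"
      using closure_hyp[OF _ act_hyp[OF shift_lorentz \<open>x \<in> hyp\<close>]] notin by blast
    from no_contact[OF mov xbd this] show False .
  qed
  then show ?thesis using above assms by simp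
qed

text \<open>The limit \<open>t \<rightarrow> 0\<close> of the comparison with the shifted copies.\<close>

lemma stabilizer_monotone:
  assumes x: "x \<in> \<Omega>" shows "act g x \<in> \<Omega>" "u x \<le> u (act g x)"
proof -
  have sg: "shift g 0 = g" by (rule ext) (simp add: shift_def boost_0)
  have lim: "(\<lambda>k. act (shift g (inverse (real (Suc k)))) y) \<longlonglongrightarrow> act g y" if "y \<in> \<Omega>" for y
    using shift_tendsto[OF tendsto_const _ LIMSEQ_inverse_real_of_nat, of y] closure_cball[OF subsetD[OF closure_subset that]]
    by (simp only: sg)
  have ins: "act (shift g (inverse (real (Suc k)))) y \<in> \<Omega>" if "y \<in> \<Omega>" for k y
    by (rule shift_inside[OF _ that]) simp
  show gx: "act g x \<in> \<Omega>"
  proof (rule act_into_interior[OF g _ x])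
    fix y assume y: "y \<in> \<Omega>"
    show "act g y \<in> closure \<Omega>" by (rule closure_limit[OF ins[OF y] lim[OF y]])
  qed
  have "(\<lambda>k. u (act (shift g (inverse (real (Suc k)))) x)) \<longlonglongrightarrow> u (act g x)"
    by (rule u_tendsto[OF ins[OF x] lim[OF x]]) (use gx Omega(4) in blast)
  moreover have "u x \<le> u (act (shift g (inverse (real (Suc k)))) x)" for k
    by (rule comparison[OF shift_moves_in x]) (use shift_inside in auto)
  ultimately show "u x \<le> u (act g x)" by (intro LIMSEQ_le_const) auto
qed

end

subsection \<open>The solution depends on the height only\<close>

text \<open>Two points of equal height are exchanged by a reflection that fixes \<open>M\<close>. Monotonicity under this reflection and
  its inverse gives equality.\<close>

lemma same_height:
  assumes x: "x \<in> \<Omega>" and y: "y \<in> hyp" and h: "mink (lift x) M = mink (lift y) M"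
  shows "y \<in> \<Omega>" "u x = u y"
proof -
  have le: "b \<in> \<Omega> \<and> u a \<le> u b" if ab: "a \<in> \<Omega>" "b \<in> hyp" "mink (lift a) M = mink (lift b) M" for a b
  proof -
    have ah: "a \<in> hyp" using ab Omega(4) by blast
    obtain g where g: "lorentz g" "g M = M" "g (lift a) = lift b"
      by (rule exists_lorentz_swap[OF lift_hyperboloid[OF ah] lift_hyperboloid[OF ab(2)] ab(3)])
    have "act g a = b" by (rule lift_inj[OF act_hyp[OF g(1) ah] ab(2)]) (simp only: lift_act[OF g(1) ah] g(3))
    then show ?thesis using stabilizer_monotone[OF g(1,2) ab(1)] by simp
  qed
  show y\<Omega>: "y \<in> \<Omega>" using le[OF x y h] by blast
  show "u x = u y"
  proof (rule antisym)
    show "u x \<le> u y" using le[OF x y h] by blast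
    have "x \<in> hyp" using x Omega(4) by blast
    from le[OF y\<Omega> this h[symmetric]] show "u y \<le> u x" by blast
  qed
qed

lemma continuous_height: "continuous_on hyp (\<lambda>x::'a. mink (lift x) M)"
proof -
  have "continuous_on hyp (\<lambda>x::'a. lift x)"
    unfolding lift_def conf_def by (intro continuous_intros) (use hyp_norm in force)+
  then show ?thesis by (intro continuous_intros)
qed

text \<open>By \<open>same_height\<close> the domain is determined by its set of heights, which is an interval. It is unbounded above, by
  \<open>shift_inside\<close>, and no height of a boundary point belongs to it. So all boundary points have the same height, the
  infimum.\<close>

lemma Omega_height: "\<exists>k. \<Omega> = {x \<in> hyp. k < mink (lift x) M}"
proof -
  define h where "h x = mink (lift x) M" for x :: 'a
  have hc: "continuous_on hyp h" unfolding h_def[abs_def] by (rule continuous_height)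
  define I where "I = h ` \<Omega>"
  have "connected I" unfolding I_def
    by (rule connected_continuous_image[OF continuous_on_subset[OF hc Omega(4)] Omega(2)])
  then have iv: "z \<in> I" if "a \<in> I" "b \<in> I" "a \<le> z" "z \<le> b" for a b z
    using that unfolding connected_iff_interval by blast
  have mem: "x \<in> \<Omega>" if "x \<in> hyp" "h x \<in> I" for x
  proof -
    from that(2) obtain y where "y \<in> \<Omega>" "h y = h x" by (auto simp: I_def)
    then show ?thesis using same_height(1) that(1) by (simp add: h_def)
  qed
  have up: "\<exists>b\<in>I. a \<le> b" for a
  proof -
    obtain x where x: "x \<in> \<Omega>" using Omega(3) by blast
    have xh: "x \<in> hyp" using x Omega(4) by blast
    note c = hyperboloid_coordinates[OF lift_hyperboloid[OF xh] T TM MM]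
    have "(h x)\<^sup>2 < (mink (lift x) (- T))\<^sup>2" using c(1) by (simp add: h_def)
    then have "\<bar>h x\<bar> < \<bar>mink (lift x) (- T)\<bar>" unfolding not_le[symmetric] abs_le_square_iff .
    then have d: "0 < h x - mink (lift x) T" using c(2) by (simp add: mink_simps)
    define d where "d = h x - mink (lift x) T"
    define t where "t = arsinh ((\<bar>a\<bar> + \<bar>h x\<bar> + 1) / d)"
    have t: "0 < t" using d by (simp add: t_def d_def)
    have lid: "lorentz (id :: 'a \<times> real \<Rightarrow> _)" by (simp add: lorentz_def linear_id)
    have "act (shift id t) x \<in> \<Omega>" by (rule shift_inside[OF lid _ t x]) simp
    moreover have "h (act (shift id t) x) = sinh t * d + h x * exp (- t)"
    proof -
      have "h (act (shift id t) x) = cosh t * h x - sinh t * mink (lift x) T"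
        unfolding h_def lift_act[OF shift_lorentz[OF lid id_apply] xh] by (simp add: shift_def mink_boost_V[OF TM MM])
      also have "cosh t = sinh t + exp (- t)" using cosh_minus_sinh[of t] by linarith
      finally show ?thesis by (simp only: d_def algebra_simps)
    qed
    moreover have "sinh t * d = \<bar>a\<bar> + \<bar>h x\<bar> + 1" using d by (simp add: t_def d_def)
    moreover have "- \<bar>h x\<bar> \<le> h x * exp (- t)"
    proof -
      have "\<bar>h x * exp (- t)\<bar> \<le> \<bar>h x\<bar> * 1" unfolding abs_mult using t by (intro mult_left_mono) auto
      then show ?thesis by linarith
    qed
    ultimately have "a \<le> h (act (shift id t) x)" by linarith
    then show ?thesis using \<open>act (shift id t) x \<in> \<Omega>\<close> by (auto simp: I_def)
  qed
  obtain p where p: "p \<in> hboundary \<Omega>" using hboundary_nonempty by blast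
  have ph: "p \<in> hyp" by (rule hboundary_hyp[OF p])
  have pI: "h p \<notin> I" using mem[OF ph] hboundary_not[OF p] by blast
  have lower: "h p < z" if "z \<in> I" for z
  proof (rule ccontr)
    assume "\<not> h p < z"
    moreover obtain b where "b \<in> I" "h p \<le> b" using up by blast
    ultimately show False using iv[OF that, of b "h p"] pI by simp
  qed
  have "\<Omega> = {x \<in> hyp. h p < h x}"
  proof (intro equalityI subsetI)
    fix x assume "x \<in> \<Omega>"
    then show "x \<in> {x \<in> hyp. h p < h x}" using lower[of "h x"] Omega(4) by (auto simp: I_def)
  next
    fix x assume "x \<in> {x \<in> hyp. h p < h x}"
    then have x: "x \<in> hyp" "h p < h x" by auto
    obtain X where X: "\<And>k. X k \<in> \<Omega>" "X \<longlonglongrightarrow> p" using hboundary_closure[OF p] closure_sequential by metis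
    have "(\<lambda>k. h (X k)) \<longlonglongrightarrow> h p"
      using hc ph X Omega(4) by (auto simp: continuous_on_sequentially comp_def simp del: mem_ball mem_ball_0)
    then have "\<forall>\<^sub>F k in sequentially. h (X k) < h x" using x(2) by (rule order_tendstoD)
    then obtain k where k: "h (X k) < h x" by (auto simp: eventually_sequentially)
    obtain b where b: "b \<in> I" "h x \<le> b" using up by blast
    have "h x \<in> I" by (rule iv[of "h (X k)" b]) (use k b X(1) in \<open>auto simp: I_def\<close>)
    then show "x \<in> \<Omega>" by (rule mem[OF x(1)])
  qed
  then show ?thesis unfolding h_def by blast
qed

end

section \<open>Totally geodesic hyperplanes\<close>

lemma C2_hypersurface_local:
  assumes S: "C2_hypersurface S" and p: "p \<in> S"
  shows "\<exists>U \<phi> G. p \<in> U \<and> open U \<and> U \<subseteq> hyp \<and> (\<forall>x\<in>U. GDERIV \<phi> x :> G x) \<and> continuous_on U G \<and>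
    G p \<noteq> 0 \<and> (\<forall>x\<in>U. x \<in> S \<longleftrightarrow> \<phi> x = 0)"
proof -
  obtain U \<phi> where U: "p \<in> U" "regular_C2_on U \<phi>" "S \<inter> U = {x \<in> U. \<phi> x = 0}"
    using S p unfolding C2_hypersurface_def by blast
  have op: "open U" "U \<subseteq> hyp" and C2: "C2_on U \<phi>" and nz: "egrad \<phi> p \<noteq> 0"
    using U(1,2) by (auto simp: regular_C2_on_def)
  obtain G H where GH: "\<forall>x\<in>U. GDERIV \<phi> x :> G x \<and> (G has_derivative blinfun_apply (H x)) (at x)"
    using C2 unfolding C2_on_def by blast
  have "continuous_on U G"
    by (rule continuous_at_imp_continuous_on) (use GH has_derivative_continuous in blast)
  moreover have "G p \<noteq> 0" using GH U(1) egrad_eq[of \<phi> p "G p"] nz by auto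
  moreover have "\<forall>x\<in>U. x \<in> S \<longleftrightarrow> \<phi> x = 0" using U(3) by auto
  ultimately show ?thesis using U(1) op GH by blast
qed

text \<open>The intermediate value theorem on the segment through \<open>p + t *\<^sub>R v\<close> in the normal direction, with the first order
  expansion of \<open>\<phi>\<close> at \<open>p\<close>.\<close>

lemma level_set_near_tangent_line:
  fixes \<phi> :: "'a::euclidean_space \<Rightarrow> real"
  assumes U: "open U" "p \<in> U" and G: "\<And>x. x \<in> U \<Longrightarrow> GDERIV \<phi> x :> G x" and nz: "G p \<noteq> 0"
    and p0: "\<phi> p = 0" and v: "v \<bullet> G p = 0" and \<epsilon>: "0 < \<epsilon>"
  shows "\<exists>d>0. \<forall>t. t \<noteq> 0 \<longrightarrow> \<bar>t\<bar> < d \<longrightarrow> (\<exists>y\<in>U. \<phi> y = 0 \<and> norm (y - (p + t *\<^sub>R v)) \<le> \<epsilon> * \<bar>t\<bar>)"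
proof -
  define n where "n = (1 / norm (G p)) *\<^sub>R G p"
  define g where "g = norm (G p)"
  have g: "0 < g" using nz by (simp add: g_def)
  have n1: "norm n = 1" using nz by (simp add: n_def)
  have vn: "v \<bullet> n = 0" using v by (simp add: n_def)
  have nn: "n \<bullet> n = 1" using n1 by (simp add: dot_square_norm)
  have Gn: "h \<bullet> G p = g * (h \<bullet> n)" for h using g by (simp add: n_def g_def)
  define c where "c = norm v + \<epsilon>"
  have c: "0 < c" using \<epsilon> by (simp add: c_def add_nonneg_pos)
  define \<eta> where "\<eta> = g * \<epsilon> / (2 * c)"
  have \<eta>: "0 < \<eta>" using g \<epsilon> c by (simp add: \<eta>_def)
  obtain r where r: "0 < r" "ball p r \<subseteq> U" using U open_contains_ball by blast
  have "(\<phi> has_derivative (\<lambda>h. h \<bullet> G p)) (at p)" using G[OF U(2)] by (simp add: gderiv_def)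
  then have "\<exists>d>0. \<forall>y. norm (y - p) < d \<longrightarrow> norm (\<phi> y - \<phi> p - (y - p) \<bullet> G p) \<le> \<eta> * norm (y - p)"
    using \<eta> unfolding has_derivative_at_alt by blast
  then obtain d0 where d0: "0 < d0" "\<And>y. norm (y - p) < d0 \<Longrightarrow> \<bar>\<phi> y - (y - p) \<bullet> G p\<bar> \<le> \<eta> * norm (y - p)"
    using p0 by auto
  define d where "d = min d0 r / c"
  have d: "0 < d" using d0 r c by (simp add: d_def)
  show ?thesis
  proof (intro exI[of _ d] conjI allI impI d)
    fix t :: real assume t: "t \<noteq> 0" "\<bar>t\<bar> < d"
    have tc: "\<bar>t\<bar> * c < min d0 r" using t(2) c by (simp add: d_def pos_less_divide_eq)
    define k where "k s = p + t *\<^sub>R v + s *\<^sub>R n" for s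
    have kn: "norm (k s - p) \<le> \<bar>t\<bar> * c" if "\<bar>s\<bar> \<le> \<epsilon> * \<bar>t\<bar>" for s
    proof -
      have "norm (k s - p) \<le> norm (t *\<^sub>R v) + norm (s *\<^sub>R n)"
        unfolding k_def using norm_triangle_ineq[of "t *\<^sub>R v" "s *\<^sub>R n"] by (simp add: algebra_simps)
      also have "\<dots> \<le> \<bar>t\<bar> * norm v + \<epsilon> * \<bar>t\<bar>" using that n1 by simp
      finally show ?thesis by (simp add: c_def algebra_simps)
    qed
    have kU: "k s \<in> U" if "\<bar>s\<bar> \<le> \<epsilon> * \<bar>t\<bar>" for s
      using kn[OF that] tc r(2) by (auto simp: dist_norm norm_minus_commute)
    have est: "\<bar>\<phi> (k s) - g * s\<bar> \<le> g * \<epsilon> * \<bar>t\<bar> / 2" if "\<bar>s\<bar> \<le> \<epsilon> * \<bar>t\<bar>" for s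
    proof -
      have "(k s - p) \<bullet> G p = g * s" by (simp add: Gn k_def inner_simps vn nn)
      moreover have "norm (k s - p) < d0" using kn[OF that] tc by simp
      ultimately have "\<bar>\<phi> (k s) - g * s\<bar> \<le> \<eta> * norm (k s - p)" using d0(2)[of "k s"] by simp
      also have "\<dots> \<le> \<eta> * (\<bar>t\<bar> * c)" using kn[OF that] \<eta> by (intro mult_left_mono) auto
      also have "\<dots> = g * \<epsilon> * \<bar>t\<bar> / 2" using c by (simp add: \<eta>_def)
      finally show ?thesis .
    qed
    have pos: "0 < g * \<epsilon> * \<bar>t\<bar>" using g \<epsilon> t(1) by simp
    have e0: "0 \<le> \<epsilon> * \<bar>t\<bar>" using \<epsilon> by simp
    have "\<bar>\<phi> (k (\<epsilon> * \<bar>t\<bar>)) - g * (\<epsilon> * \<bar>t\<bar>)\<bar> \<le> g * \<epsilon> * \<bar>t\<bar> / 2" by (rule est) (use e0 in simp)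
    moreover have "g * (\<epsilon> * \<bar>t\<bar>) = g * \<epsilon> * \<bar>t\<bar>" by (rule mult.assoc[symmetric])
    ultimately have up: "0 \<le> \<phi> (k (\<epsilon> * \<bar>t\<bar>))" using pos unfolding abs_le_iff by linarith
    have "\<bar>\<phi> (k (- (\<epsilon> * \<bar>t\<bar>))) - g * (- (\<epsilon> * \<bar>t\<bar>))\<bar> \<le> g * \<epsilon> * \<bar>t\<bar> / 2" by (rule est) (use e0 in simp)
    moreover have "g * (- (\<epsilon> * \<bar>t\<bar>)) = - (g * \<epsilon> * \<bar>t\<bar>)" by (simp only: mult_minus_right mult.assoc)
    ultimately have dn: "\<phi> (k (- (\<epsilon> * \<bar>t\<bar>))) \<le> 0" using pos unfolding abs_le_iff by linarith
    have "\<exists>s\<ge>- (\<epsilon> * \<bar>t\<bar>). s \<le> \<epsilon> * \<bar>t\<bar> \<and> \<phi> (k s) = 0"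
    proof (rule IVT)
      show "\<forall>s. - (\<epsilon> * \<bar>t\<bar>) \<le> s \<and> s \<le> \<epsilon> * \<bar>t\<bar> \<longrightarrow> isCont (\<lambda>s. \<phi> (k s)) s"
      proof (intro allI impI)
        fix s assume "- (\<epsilon> * \<bar>t\<bar>) \<le> s \<and> s \<le> \<epsilon> * \<bar>t\<bar>"
        then have "k s \<in> U" by (intro kU) (simp add: abs_le_iff)
        then have c1: "isCont \<phi> (k s)" using G has_derivative_continuous unfolding gderiv_def by blast
        have c2: "isCont k s" unfolding k_def[abs_def] by (intro continuous_intros)
        show "isCont (\<lambda>s. \<phi> (k s)) s" by (rule isCont_o2[OF c2 c1])
      qed
    qed (use up dn e0 in auto)
    then obtain s where s: "- (\<epsilon> * \<bar>t\<bar>) \<le> s" "s \<le> \<epsilon> * \<bar>t\<bar>" "\<phi> (k s) = 0" by blast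
    then have sa: "\<bar>s\<bar> \<le> \<epsilon> * \<bar>t\<bar>" by (simp add: abs_le_iff)
    show "\<exists>y\<in>U. \<phi> y = 0 \<and> norm (y - (p + t *\<^sub>R v)) \<le> \<epsilon> * \<bar>t\<bar>"
      by (rule bexI[OF _ kU[OF sa]]) (use s(3) sa n1 in \<open>simp add: k_def\<close>)
  qed
qed

text \<open>The curve takes an almost nearest point of \<open>S\<close> to \<open>p + t *\<^sub>R v\<close>. It may jump away
  from \<open>0\<close>, but the first order expansion of the distance to \<open>S\<close> makes it differentiable at \<open>0\<close>.\<close>

lemma tangent_space_contains:
  fixes \<phi> :: "'a::euclidean_space \<Rightarrow> real"
  assumes U: "open U" "p \<in> U" and G: "\<And>x. x \<in> U \<Longrightarrow> GDERIV \<phi> x :> G x" and nz: "G p \<noteq> 0"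
    and S: "\<And>x. x \<in> U \<Longrightarrow> \<phi> x = 0 \<Longrightarrow> x \<in> S" and p: "p \<in> S" "\<phi> p = 0" and v: "v \<bullet> G p = 0"
  shows "v \<in> tangent_space S p"
proof -
  have ne: "S \<noteq> {}" using p by blast
  have "\<exists>y\<in>S. t \<noteq> 0 \<longrightarrow> dist (p + t *\<^sub>R v) y < infdist (p + t *\<^sub>R v) S + t\<^sup>2" for t
  proof (cases "t = 0")
    case True then show ?thesis using p by blast
  next
    case False
    have bdd: "bdd_below (dist (p + t *\<^sub>R v) ` S)" by (rule bdd_belowI[of _ 0]) auto
    have "infdist (p + t *\<^sub>R v) S < infdist (p + t *\<^sub>R v) S + t\<^sup>2" using False by simp
    then have "(INF y\<in>S. dist (p + t *\<^sub>R v) y) < infdist (p + t *\<^sub>R v) S + t\<^sup>2"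
      using ne by (simp add: infdist_notempty)
    then have "\<exists>y\<in>S. dist (p + t *\<^sub>R v) y < infdist (p + t *\<^sub>R v) S + t\<^sup>2"
      by (simp only: cINF_less_iff[OF ne bdd])
    then show ?thesis by blast
  qed
  then obtain k0 where k0: "\<And>t. k0 t \<in> S" "\<And>t. t \<noteq> 0 \<Longrightarrow> dist (p + t *\<^sub>R v) (k0 t) < infdist (p + t *\<^sub>R v) S + t\<^sup>2"
    by metis
  define k where "k t = (if t = 0 then p else k0 t)" for t
  have kS: "k t \<in> S" for t using k0 p by (simp add: k_def)
  have "(k has_derivative (\<lambda>t. t *\<^sub>R v)) (at 0)"
    unfolding has_derivative_at_alt
  proof (intro conjI allI impI)
    show "bounded_linear (\<lambda>t. t *\<^sub>R v)" by (rule bounded_linear_scaleR_left)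
    fix e :: real assume e: "0 < e"
    then have "0 < e / 2" by simp
    from level_set_near_tangent_line[OF U G nz p(2) v this]
    obtain d where d: "0 < d" "\<And>t. t \<noteq> 0 \<Longrightarrow> \<bar>t\<bar> < d \<Longrightarrow> \<exists>y\<in>U. \<phi> y = 0 \<and> norm (y - (p + t *\<^sub>R v)) \<le> e / 2 * \<bar>t\<bar>"
      by blast
    show "\<exists>d>0. \<forall>t. norm (t - 0) < d \<longrightarrow> norm (k t - k 0 - (t - 0) *\<^sub>R v) \<le> e * norm (t - 0)"
    proof (intro exI[of _ "min d (e / 2)"] conjI allI impI)
      show "0 < min d (e / 2)" using d e by simp
      fix t :: real assume "norm (t - 0) < min d (e / 2)"
      then have t: "\<bar>t\<bar> < d" "\<bar>t\<bar> \<le> e / 2" by auto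
      show "norm (k t - k 0 - (t - 0) *\<^sub>R v) \<le> e * norm (t - 0)"
      proof (cases "t = 0")
        case True then show ?thesis by simp
      next
        case False
        obtain y where y: "y \<in> U" "\<phi> y = 0" "norm (y - (p + t *\<^sub>R v)) \<le> e / 2 * \<bar>t\<bar>" using d(2)[OF False t(1)] by blast
        have "infdist (p + t *\<^sub>R v) S \<le> dist (p + t *\<^sub>R v) y" by (rule infdist_le[OF S[OF y(1,2)]])
        also have "\<dots> \<le> e / 2 * \<bar>t\<bar>" using y(3) by (simp add: dist_norm norm_minus_commute)
        finally have "dist (p + t *\<^sub>R v) (k0 t) \<le> e / 2 * \<bar>t\<bar> + t\<^sup>2" using k0(2)[OF False] by simp
        also have "t\<^sup>2 = \<bar>t\<bar> * \<bar>t\<bar>" by (simp add: power2_eq_square)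
        also have "e / 2 * \<bar>t\<bar> + \<bar>t\<bar> * \<bar>t\<bar> \<le> e / 2 * \<bar>t\<bar> + e / 2 * \<bar>t\<bar>"
          using mult_right_mono[OF t(2), of "\<bar>t\<bar>"] by simp
        finally have "dist (p + t *\<^sub>R v) (k0 t) \<le> e * \<bar>t\<bar>" by simp
        moreover have "norm (k t - k 0 - (t - 0) *\<^sub>R v) = dist (p + t *\<^sub>R v) (k0 t)"
          using False by (simp add: k_def dist_norm norm_minus_commute algebra_simps)
        ultimately show ?thesis by simp
      qed
    qed
  qed
  then have "(k has_vector_derivative v) (at 0)" by (simp add: has_vector_derivative_def)
  then show ?thesis unfolding tangent_space_def using kS by (intro CollectI exI[of _ k]) (simp add: k_def)
qed

text \<open>Every totally geodesic hyperplane is of this form for a unit spacelike \<open>M\<close>, its unit normal in Minkowski space; the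
  number \<open>mink (lift x) M\<close> is the hyperbolic sine of the signed distance of \<open>x\<close> to it.\<close>

definition plane :: "'a::euclidean_space \<times> real \<Rightarrow> 'a set" where
  "plane M = {x \<in> hyp. mink (lift x) M = 0}"

lemma plane_conevec: "x \<in> hyp \<Longrightarrow> x \<in> plane M \<longleftrightarrow> mink (conevec x) M = 0"
  using hyp_norm[of x] by (simp only: plane_def mem_Collect_eq conevec_lift mink_scale_left) simp

lemma plane_normal:
  assumes "x \<in> plane M" "mink M M = 1"
  shows "x \<in> hyp" "norm (coframe x M) = 1" "frame x (coframe x M) = M"
proof -
  show x: "x \<in> hyp" and "frame x (coframe x M) = M"
    using assms(1) frame_coframe[of x M] by (auto simp: plane_def)
  have "coframe x M \<bullet> coframe x M = 1"
    using coframe_inner[OF x, of M M] assms by (simp add: plane_def)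
  then show "norm (coframe x M) = 1" by (simp add: norm_eq_sqrt_inner)
qed

lemma height_geo:
  assumes "x \<in> plane M" "mink M M = 1" "norm e = 1"
  shows "mink (lift (geo x e s)) M = sinh s * (e \<bullet> coframe x M)"
proof -
  note n = plane_normal[OF assms(1,2)]
  have "mink (frame x e) M = mink (frame x e) (frame x (coframe x M))" by (simp only: n(3))
  then have "mink (frame x e) M = e \<bullet> coframe x M" by (simp only: mink_frame[OF n(1)])
  then show ?thesis using assms(1) by (simp add: lift_geo[OF n(1) assms(3)] mink_simps plane_def)
qed

lemma plane_geodesically_spanned:
  assumes p: "p \<in> plane M" and M: "mink M M = 1" and x: "x \<in> plane M" "x \<noteq> p"
  shows "\<exists>e s. norm e = 1 \<and> e \<bullet> coframe p M = 0 \<and> x = geo p e s"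
proof -
  have ph: "p \<in> hyp" and xh: "x \<in> hyp" and pM: "mink (lift p) M = 0" and xM: "mink (lift x) M = 0"
    using p x by (auto simp: plane_def)
  define \<tau> where "\<tau> = - mink (lift x) (lift p)"
  have \<tau>: "1 < \<tau>"
  proof -
    have "lift x \<noteq> lift p" using lift_inj[OF xh ph] x(2) by blast
    then have "mink (lift x) (lift p) \<noteq> -1"
      using mink_hyperboloid_le(2)[OF lift_hyperboloid[OF xh] lift_hyperboloid[OF ph]] by blast
    moreover have "mink (lift x) (lift p) \<le> -1" by (rule mink_hyperboloid_le(1)[OF lift_hyperboloid[OF xh] lift_hyperboloid[OF ph]])
    ultimately show ?thesis by (simp add: \<tau>_def)
  qed
  define s where "s = arcosh \<tau>"
  have cs: "cosh s = \<tau>" using \<tau> by (simp add: s_def)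
  have ss: "0 < sinh s" using \<tau> by (simp add: s_def)
  define V where "V = (1 / sinh s) *\<^sub>R (lift x - \<tau> *\<^sub>R lift p)"
  have pV: "mink (lift p) V = 0"
    by (simp add: V_def mink_simps mink_lift_lift[OF ph] mink_commute[of "lift p" "lift x"] \<tau>_def del: mem_ball mem_ball_0)
  have VM: "mink V M = 0" by (simp add: V_def mink_simps pM xM)
  have "mink (lift x - \<tau> *\<^sub>R lift p) (lift x - \<tau> *\<^sub>R lift p) = \<tau>\<^sup>2 - 1"
    using mink_lift_lift[OF ph] mink_lift_lift[OF xh] mink_commute[of "lift p" "lift x"]
    by (simp add: mink_simps \<tau>_def power2_eq_square)
  also have "\<tau>\<^sup>2 - 1 = (sinh s)\<^sup>2" using cosh_square_eq[of s] cs by simp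
  finally have VV: "mink V V = 1"
    using ss unfolding V_def mink_scale_left mink_scale_right by (simp add: power2_eq_square)
  define e where "e = coframe p V"
  have fe: "frame p e = V" unfolding e_def by (rule frame_coframe[OF ph pV])
  have "e \<bullet> e = 1" unfolding e_def coframe_inner[OF ph pV pV] by (rule VV)
  then have e: "norm e = 1" by (simp add: norm_eq_sqrt_inner)
  have "e \<bullet> coframe p M = 0" unfolding e_def coframe_inner[OF ph pV pM] by (rule VM)
  moreover have "x = geo p e s"
  proof (rule lift_inj[OF xh geo_hyp[OF ph e]])
    show "lift x = lift (geo p e s)"
      unfolding lift_geo[OF ph e] fe cs using ss by (simp add: V_def)
  qed
  ultimately show ?thesis using e by blast
qed

text \<open>All points of the plane with the same tangent space at \<open>p\<close> lie on geodesics that start tangentially at \<open>p\<close>.\<close>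

lemma plane_subset_totally_geodesic:
  assumes P: "totally_geodesic_hyperplane P" and p: "p \<in> P"
  shows "\<exists>M. mink M M = 1 \<and> p \<in> plane M \<and> plane M \<subseteq> P"
proof -
  have S: "C2_hypersurface P" using P by (simp add: totally_geodesic_hyperplane_def)
  obtain U \<phi> G where U: "p \<in> U" "open U" "U \<subseteq> hyp" and G: "\<forall>x\<in>U. GDERIV \<phi> x :> G x"
    and nz: "G p \<noteq> 0" and i: "\<forall>x\<in>U. x \<in> P \<longleftrightarrow> \<phi> x = 0"
    using C2_hypersurface_local[OF S p] by blast
  have ph: "p \<in> hyp" using U by blast
  define \<nu> where "\<nu> = (1 / norm (G p)) *\<^sub>R G p"
  have \<nu>: "norm \<nu> = 1" using nz by (simp add: \<nu>_def)
  define M where "M = frame p \<nu>"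
  have MM: "mink M M = 1" unfolding M_def mink_frame[OF ph] using \<nu> by (simp add: dot_square_norm)
  have pM: "p \<in> plane M" using ph mink_lift_frame[OF ph, of \<nu>] by (simp add: plane_def M_def)
  have co: "coframe p M = \<nu>" by (simp add: M_def coframe_frame)
  have "x \<in> P" if x: "x \<in> plane M" for x
  proof (cases "x = p")
    case True then show ?thesis using p by simp
  next
    case False
    then obtain e s where e: "norm e = 1" "e \<bullet> \<nu> = 0" and xs: "x = geo p e s"
      using plane_geodesically_spanned[OF pM MM x] unfolding co by blast
    have tan: "(1 / conf p) *\<^sub>R e \<in> tangent_space P p"
    proof (rule tangent_space_contains[where G = G and \<phi> = \<phi>, OF U(2,1) _ nz _ p])
      show "GDERIV \<phi> x :> G x" if "x \<in> U" for x using G that by blast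
      show "x \<in> P" if "x \<in> U" "\<phi> x = 0" for x using i that by blast
      show "\<phi> p = 0" using i U(1) p by blast
      have "e \<bullet> G p = 0" using e(2) nz by (simp add: \<nu>_def)
      then show "((1 / conf p) *\<^sub>R e) \<bullet> G p = 0" by simp
    qed
    have cg: "complete_geodesic (geo p e)" using geo_complete_geodesic(1)[OF ph e(1), of 1] by simp
    have g0: "geo p e 0 = p" by (rule geo_0[OF ph])
    have "range (geo p e) \<subseteq> P"
      using P unfolding totally_geodesic_hyperplane_def
      using cg g0 p tan geo_velocity[OF ph e(1)] by metis
    then show ?thesis unfolding xs by blast
  qed
  then show ?thesis using MM pM by blast
qed

text \<open>The two hypersurfaces have the same tangent space at \<open>p\<close>. Near \<open>p\<close> every short segment in the normal direction meets
  the plane, and it meets \<open>P\<close> at most once; since the plane is contained in \<open>P\<close>, the two points coincide.\<close>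

lemma plane_locally_fills:
  assumes S: "C2_hypersurface P" and sub: "plane M \<subseteq> P" and M: "mink M M = 1" and p: "p \<in> plane M"
  shows "\<exists>W. open W \<and> p \<in> W \<and> P \<inter> W \<subseteq> plane M"
proof -
  have pP: "p \<in> P" using p sub by blast
  obtain U \<phi> G where U: "p \<in> U" "open U" "U \<subseteq> hyp" and G: "\<forall>x\<in>U. GDERIV \<phi> x :> G x"
    and Gc: "continuous_on U G" and nz: "G p \<noteq> 0" and i: "\<forall>x\<in>U. x \<in> P \<longleftrightarrow> \<phi> x = 0"
    using C2_hypersurface_local[OF S pP] by blast
  have ph: "p \<in> hyp" using U by blast
  define \<nu> where "\<nu> = coframe p M"
  have \<nu>: "norm \<nu> = 1" unfolding \<nu>_def by (rule plane_normal(2)[OF p M])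
  have \<nu>\<nu>: "\<nu> \<bullet> \<nu> = 1" using \<nu> by (simp add: dot_square_norm)
  have perp: "e \<bullet> G p = 0" if e: "norm e = 1" "e \<bullet> \<nu> = 0" for e
  proof -
    have inP: "geo p e s \<in> P" for s
    proof -
      have "geo p e s \<in> plane M" using geo_hyp[OF ph e(1)] height_geo[OF p M e(1), of s] e(2) by (simp add: plane_def \<nu>_def)
      then show ?thesis using sub by blast
    qed
    have "\<forall>\<^sub>F s in nhds 0. geo p e s \<in> U"
      by (rule eventually_geo[OF ph e(1)]) (use U in \<open>simp add: eventually_nhds_in_open\<close>)
    then have "\<forall>\<^sub>F s in nhds 0. \<phi> (geo p e s) = 0" by eventually_elim (use i inP in blast)
    moreover have "((\<lambda>s. \<phi> (geo p e s)) has_real_derivative ((1 / conf p) *\<^sub>R e) \<bullet> G p) (at 0)"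
    proof (rule GDERIV_along_curve)
      show "GDERIV \<phi> (geo p e 0) :> G p" using G U(1) geo_0[OF ph] by simp
      show "(geo p e has_vector_derivative (1 / conf p) *\<^sub>R e) (at 0)"
        using geo_has_derivative[OF ph e(1), of 0] by (simp only: geo_velocity[OF ph e(1)])
    qed
    ultimately have "((\<lambda>s. 0) has_real_derivative ((1 / conf p) *\<^sub>R e) \<bullet> G p) (at (0::real))"
      by (subst (asm) DERIV_cong_ev[OF refl _ refl]) auto
    then have "((1 / conf p) *\<^sub>R e) \<bullet> G p = 0" using DERIV_unique[OF DERIV_const[of 0]] by metis
    then show ?thesis using conf_pos[OF ph] by simp
  qed
  define k where "k = \<nu> \<bullet> G p"
  have k: "k \<noteq> 0"
  proof
    assume k0: "k = 0"
    have "(1 / norm (G p)) *\<^sub>R G p \<bullet> G p = 0"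
      by (rule perp) (use nz k0 in \<open>simp_all add: k_def inner_commute\<close>)
    then show False using nz by simp
  qed
  define \<psi> where "\<psi> y = mink (conevec y) M" for y
  have \<psi>c: "continuous_on UNIV \<psi>" unfolding \<psi>_def[abs_def] by (intro continuous_intros)
  (* On a small ball the derivative of \<phi> in the direction \<nu> does not vanish, so every segment in this
     direction meets P at most once. *)
  have "((\<lambda>y. k * (\<nu> \<bullet> G y)) \<longlongrightarrow> k * (\<nu> \<bullet> G p)) (at p)"
    using Gc U continuous_on_eq_continuous_at[of U G] by (intro tendsto_intros) (auto simp: isCont_def)
  moreover have "0 < k * (\<nu> \<bullet> G p)" using k not_real_square_gt_zero[of k] unfolding k_def[symmetric] by blast
  ultimately have "\<forall>\<^sub>F y in at p. 0 < k * (\<nu> \<bullet> G y)" by (rule order_tendstoD(1))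
  then have "\<forall>\<^sub>F y in nhds p. 0 < k * (\<nu> \<bullet> G y)"
    using \<open>0 < k * (\<nu> \<bullet> G p)\<close> by (simp add: eventually_nhds_conv_at)
  then have "\<forall>\<^sub>F y in nhds p. 0 < k * (\<nu> \<bullet> G y) \<and> y \<in> U"
    using U by (simp add: eventually_conj eventually_nhds_in_open)
  then obtain r where r: "0 < r" "\<And>y. dist y p < r \<Longrightarrow> 0 < k * (\<nu> \<bullet> G y) \<and> y \<in> U"
    unfolding eventually_nhds_metric by blast
  define h where "h = min (r / 2) (1 / (\<bar>snd M\<bar> + 1))"
  have h: "0 < h" "h < r" "\<bar>snd M\<bar> * h < 1"
  proof -
    show "0 < h" "h < r" using r(1) by (auto simp: h_def)
    have "h \<le> 1 / (\<bar>snd M\<bar> + 1)" by (simp add: h_def)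
    then have "(\<bar>snd M\<bar> + 1) * h \<le> 1" by (simp add: pos_le_divide_eq add_nonneg_pos mult.commute)
    then show "\<bar>snd M\<bar> * h < 1" using \<open>0 < h\<close> by (simp add: algebra_simps)
  qed
  have \<psi>s: "\<psi> (p + s *\<^sub>R \<nu>) = 2 * s - snd M * s\<^sup>2" for s
  proof -
    have m: "fst M = \<nu> + snd M *\<^sub>R p" by (simp add: \<nu>_def coframe_def)
    have p0: "mink (conevec p) M = 0" using p plane_conevec[OF ph] by blast
    have "\<psi> (p + s *\<^sub>R \<nu>) = mink (conevec p) M + 2 * s * (\<nu> \<bullet> fst M) - snd M * (2 * s * (p \<bullet> \<nu>) + s\<^sup>2 * (\<nu> \<bullet> \<nu>))"
      by (simp add: \<psi>_def mink_def conevec_def power2_norm_eq_inner inner_simps inner_commute algebra_simps)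
        (simp add: power2_eq_square)
    also have "\<nu> \<bullet> fst M = 1 + snd M * (p \<bullet> \<nu>)" by (simp add: m inner_simps \<nu>\<nu> inner_commute)
    finally show ?thesis by (simp add: p0 \<nu>\<nu> algebra_simps)
  qed
  have "0 < \<psi> (p + h *\<^sub>R \<nu>)" and "\<psi> (p + (- h) *\<^sub>R \<nu>) < 0"
  proof -
    have "\<bar>snd M * h\<bar> < 1" using h by (simp add: abs_mult)
    then have a: "- 1 < snd M * h" "snd M * h < 1" by auto
    have "\<psi> (p + h *\<^sub>R \<nu>) = h * (2 - snd M * h)" by (simp add: \<psi>s power2_eq_square algebra_simps)
    moreover have "0 < h * (2 - snd M * h)" using h(1) a by (intro mult_pos_pos) auto
    ultimately show "0 < \<psi> (p + h *\<^sub>R \<nu>)" by simp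
    have "\<psi> (p + (- h) *\<^sub>R \<nu>) = - (h * (2 + snd M * h))" unfolding \<psi>s by (simp add: power2_eq_square algebra_simps)
    moreover have "0 < h * (2 + snd M * h)" using h(1) a by (intro mult_pos_pos) auto
    ultimately show "\<psi> (p + (- h) *\<^sub>R \<nu>) < 0" by simp
  qed
  define W where "W = ball p (r - h) \<inter> {y. 0 < \<psi> (y + h *\<^sub>R \<nu>)} \<inter> {y. \<psi> (y + (- h) *\<^sub>R \<nu>) < 0}"
  have "open W"
  proof -
    have "continuous_on UNIV (\<lambda>y. \<psi> (y + s *\<^sub>R \<nu>))" for s
      unfolding \<psi>_def[abs_def] by (intro continuous_intros)
    then show ?thesis unfolding W_def by (intro open_Int open_ball open_Collect_less continuous_on_const)
  qed
  moreover have "p \<in> W"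
    using \<open>0 < \<psi> (p + h *\<^sub>R \<nu>)\<close> \<open>\<psi> (p + (- h) *\<^sub>R \<nu>) < 0\<close> h(2) unfolding W_def by simp
  moreover have "P \<inter> W \<subseteq> plane M"
  proof
    fix y assume y: "y \<in> P \<inter> W"
    have near: "0 < k * (\<nu> \<bullet> G (y + s *\<^sub>R \<nu>)) \<and> y + s *\<^sub>R \<nu> \<in> U" if "\<bar>s\<bar> \<le> h" for s
    proof (rule r(2))
      have "dist (y + s *\<^sub>R \<nu>) p \<le> dist y p + norm (s *\<^sub>R \<nu>)"
        unfolding dist_norm using norm_triangle_ineq[of "y - p" "s *\<^sub>R \<nu>"] by (simp add: algebra_simps)
      also have "\<dots> < r" using y that \<nu> by (simp add: W_def dist_commute)
      finally show "dist (y + s *\<^sub>R \<nu>) p < r" .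
    qed
    have yU: "y \<in> U" using near[of 0] h(1) by simp
    have yh: "y \<in> hyp" using yU U(3) by blast
    have y0: "\<phi> y = 0" using y yU i by blast
    have "\<exists>s\<ge>- h. s \<le> h \<and> \<psi> (y + s *\<^sub>R \<nu>) = 0"
    proof (rule IVT)
      show "\<forall>s. - h \<le> s \<and> s \<le> h \<longrightarrow> isCont (\<lambda>s. \<psi> (y + s *\<^sub>R \<nu>)) s"
        unfolding \<psi>_def conevec_def mink_def by (intro allI impI continuous_intros)
    qed (use y h(1) in \<open>auto simp: W_def\<close>)
    then obtain s where s: "- h \<le> s" "s \<le> h" "\<psi> (y + s *\<^sub>R \<nu>) = 0" by blast
    have sU: "y + s *\<^sub>R \<nu> \<in> U" using near[of s] s by (simp add: abs_le_iff)
    then have "y + s *\<^sub>R \<nu> \<in> plane M" using s(3) plane_conevec[of "y + s *\<^sub>R \<nu>" M] U(3) unfolding \<psi>_def by blast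
    then have s0: "\<phi> (y + s *\<^sub>R \<nu>) = 0" using sub i sU by blast
    have der: "((\<lambda>t. \<phi> (y + t *\<^sub>R \<nu>)) has_real_derivative \<nu> \<bullet> G (y + t *\<^sub>R \<nu>)) (at t)" if "\<bar>t\<bar> \<le> h" for t
    proof (rule GDERIV_along_curve)
      show "GDERIV \<phi> (y + t *\<^sub>R \<nu>) :> G (y + t *\<^sub>R \<nu>)" using near[OF that] G by blast
      show "((\<lambda>t. y + t *\<^sub>R \<nu>) has_vector_derivative \<nu>) (at t)" by (auto intro!: derivative_eq_intros)
    qed
    have "s = 0"
    proof (rule ccontr)
      assume sne: "s \<noteq> 0"
      have "\<exists>t. \<bar>t\<bar> \<le> h \<and> s * (\<nu> \<bullet> G (y + t *\<^sub>R \<nu>)) = 0"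
      proof (cases "0 < s")
        case True
        have "\<exists>t>0. t < s \<and> \<phi> (y + s *\<^sub>R \<nu>) - \<phi> (y + 0 *\<^sub>R \<nu>) = (s - 0) * (\<nu> \<bullet> G (y + t *\<^sub>R \<nu>))"
          by (rule MVT2[OF True]) (rule der, use s in auto)
        then obtain t where t: "0 < t" "t < s" "\<phi> (y + s *\<^sub>R \<nu>) - \<phi> (y + 0 *\<^sub>R \<nu>) = (s - 0) * (\<nu> \<bullet> G (y + t *\<^sub>R \<nu>))" by blast
        have "s * (\<nu> \<bullet> G (y + t *\<^sub>R \<nu>)) = 0" using t(3) s0 y0 by simp
        then show ?thesis using t s by (intro exI[of _ t]) auto
      next
        case False
        then have neg: "s < 0" using sne by simp
        have "\<exists>t>s. t < 0 \<and> \<phi> (y + 0 *\<^sub>R \<nu>) - \<phi> (y + s *\<^sub>R \<nu>) = (0 - s) * (\<nu> \<bullet> G (y + t *\<^sub>R \<nu>))"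
          by (rule MVT2[OF neg]) (rule der, use s in auto)
        then obtain t where t: "s < t" "t < 0" "\<phi> (y + 0 *\<^sub>R \<nu>) - \<phi> (y + s *\<^sub>R \<nu>) = (0 - s) * (\<nu> \<bullet> G (y + t *\<^sub>R \<nu>))" by blast
        have "s * (\<nu> \<bullet> G (y + t *\<^sub>R \<nu>)) = 0" using t(3) s0 y0 by simp
        then show ?thesis using t s by (intro exI[of _ t]) auto
      qed
      then obtain t where "\<bar>t\<bar> \<le> h" "\<nu> \<bullet> G (y + t *\<^sub>R \<nu>) = 0" using sne by auto
      with near[of t] show False by simp
    qed
    then have "\<psi> y = 0" using s(3) by simp
    then show "y \<in> plane M" using plane_conevec[OF yh] by (simp add: \<psi>_def)
  qed
  ultimately show ?thesis by blast
qed

text \<open>The plane through one point is open and closed in the connected hypersurface.\<close>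

theorem totally_geodesic_hyperplane_is_plane:
  assumes P: "totally_geodesic_hyperplane P"
  shows "\<exists>M. mink M M = 1 \<and> P = plane M"
proof -
  have ne: "P \<noteq> {}" and con: "connected P" and S: "C2_hypersurface P"
    using P by (auto simp: totally_geodesic_hyperplane_def)
  have Ph: "P \<subseteq> hyp" using S by (simp add: C2_hypersurface_def)
  obtain p where p: "p \<in> P" using ne by blast
  obtain M where M: "mink M M = 1" "p \<in> plane M" "plane M \<subseteq> P"
    using plane_subset_totally_geodesic[OF P p] by blast
  have "openin (top_of_set P) (plane M)"
    unfolding openin_subopen[of _ "plane M"]
  proof
    fix x assume "x \<in> plane M"
    from plane_locally_fills[OF S M(3,1) this] obtain W where W: "open W" "x \<in> W" "P \<inter> W \<subseteq> plane M" by blast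
    show "\<exists>T. openin (top_of_set P) T \<and> x \<in> T \<and> T \<subseteq> plane M"
      using W \<open>x \<in> plane M\<close> M(3) by (intro exI[of _ "P \<inter> W"]) (auto intro: openin_open_Int)
  qed
  moreover have "closedin (top_of_set P) (plane M)"
  proof -
    have "plane M = {x \<in> P. mink (conevec x) M = 0}"
      using plane_conevec Ph M(3) by blast
    moreover have "continuous_on P (\<lambda>x. mink (conevec x) M)" by (intro continuous_intros)
    ultimately show ?thesis by (simp add: continuous_closedin_preimage_constant)
  qed
  ultimately have "plane M = {} \<or> plane M = P" using con unfolding connected_clopen by blast
  then show ?thesis using M by blast
qed

section \<open>Sides, caps and equidistant hypersurfaces\<close>

lemma components_by_height:
  fixes h :: "'a::topological_space \<Rightarrow> real"
  assumes h: "continuous_on S h"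
    and A: "connected {x \<in> S. k < h x}" "{x \<in> S. k < h x} \<noteq> {}"
    and B: "connected {x \<in> S. h x < k}" "{x \<in> S. h x < k} \<noteq> {}"
  shows "components (S - {x \<in> S. h x = k}) = {{x \<in> S. k < h x}, {x \<in> S. h x < k}}"
proof -
  define D where "D = S - {x \<in> S. h x = k}"
  define a where "a = {x \<in> S. k < h x}"
  define b where "b = {x \<in> S. h x < k}"
  have con: "connected a" "connected b" and ne: "a \<noteq> {}" "b \<noteq> {}" using A B by (auto simp: a_def b_def)
  have sub: "a \<subseteq> D" "b \<subseteq> D" by (auto simp: a_def b_def D_def)
  have dis: "a \<inter> b = {}" by (auto simp: a_def b_def)
  have split: "d \<subseteq> a \<or> d \<subseteq> b" if d: "connected d" "d \<subseteq> D" for d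
  proof (rule ccontr)
    assume "\<not> (d \<subseteq> a \<or> d \<subseteq> b)"
    then obtain x y where x: "x \<in> d" "x \<notin> a" and y: "y \<in> d" "y \<notin> b" by blast
    have "h x < k" using x d(2) by (force simp: a_def D_def)
    moreover have "k < h y" using y d(2) by (force simp: b_def D_def)
    moreover have "connected (h ` d)"
      by (rule connected_continuous_image[OF continuous_on_subset[OF h] d(1)]) (use d(2) in \<open>auto simp: D_def\<close>)
    ultimately have "k \<in> h ` d" using x(1) y(1) unfolding connected_iff_interval by (meson imageI less_imp_le)
    then show False using d(2) by (auto simp: D_def)
  qed
  have "a \<in> components D"
    unfolding in_components_maximal using ne(1) sub(1) con(1) split dis by blast
  moreover have "b \<in> components D"
    unfolding in_components_maximal using ne(2) sub(2) con(2) split dis by blast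
  moreover have "c = a \<or> c = b" if c: "c \<in> components D" for c
  proof -
    have m: "c \<noteq> {} \<and> c \<subseteq> D \<and> connected c \<and> (\<forall>d. d \<noteq> {} \<and> c \<subseteq> d \<and> d \<subseteq> D \<and> connected d \<longrightarrow> d = c)"
      using c unfolding in_components_maximal .
    then have c1: "c \<noteq> {}" "c \<subseteq> D" "connected c" by simp_all
    have c2: "d = c" if "d \<noteq> {}" "c \<subseteq> d" "d \<subseteq> D" "connected d" for d
      using m that by blast
    from split[OF c1(3,2)] show ?thesis
    proof
      assume "c \<subseteq> a" from c2[OF ne(1) this sub(1) con(1)] show ?thesis by simp
    next
      assume "c \<subseteq> b" from c2[OF ne(2) this sub(2) con(2)] show ?thesis by simp
    qed
  qed
  ultimately have "components D = {a, b}" by blast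
  then show ?thesis by (simp only: D_def a_def b_def)
qed

definition side :: "'a::euclidean_space \<times> real \<Rightarrow> real \<Rightarrow> 'a set" where
  "side M k = {x \<in> hyp. k < mink (lift x) M}"

definition cap :: "'a::euclidean_space \<times> real \<Rightarrow> 'a set" where
  "cap M = {\<xi> \<in> sphere 0 1. 0 < mink (conevec \<xi>) M}"

lemma continuous_on_lift: "continuous_on hyp (\<lambda>x::'a::euclidean_space. lift x)"
  unfolding lift_def conf_def by (intro continuous_intros) (use hyp_norm in force)+

lemma future_ideal_point:
  assumes "Z \<in> future" "mink Z Z = 0"
  shows "norm ((1 / snd Z) *\<^sub>R fst Z) = 1" "conevec ((1 / snd Z) *\<^sub>R fst Z) = (2 / snd Z) *\<^sub>R Z"
proof -
  have s: "0 < snd Z" using assms(1) by (simp add: future_def)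
  have "(norm (fst Z))\<^sup>2 = (snd Z)\<^sup>2" using assms(2) by (simp add: mink_self)
  then have "norm (fst Z) = snd Z" using s by (metis less_eq_real_def norm_ge_zero power2_eq_imp_eq)
  then show n: "norm ((1 / snd Z) *\<^sub>R fst Z) = 1" using s by simp
  show "conevec ((1 / snd Z) *\<^sub>R fst Z) = (2 / snd Z) *\<^sub>R Z"
    unfolding conevec_def n using s by (simp add: prod_eq_iff)
qed

locale oriented_plane =
  fixes M T :: "'a::euclidean_space \<times> real"
  assumes T: "T \<in> hyperboloid" and TM: "mink T M = 0" and MM: "mink M M = 1"
    and con: "connected (plane M)"
begin

lemma opposite: "oriented_plane (- M) T"
proof
  show "T \<in> hyperboloid" by (rule T)
  show "mink T (- M) = 0" "mink (- M) (- M) = 1" using TM MM by (simp_all add: mink_simps)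
  have "plane (- M) = plane M" by (simp add: plane_def mink_simps)
  then show "connected (plane (- M))" using con by simp
qed

lemma push:
  assumes "p \<in> plane M"
  shows "cosh r *\<^sub>R lift p + sinh r *\<^sub>R M \<in> hyperboloid" "mink (cosh r *\<^sub>R lift p + sinh r *\<^sub>R M) M = sinh r"
proof -
  have p: "p \<in> hyp" "mink (lift p) M = 0" using assms by (auto simp: plane_def)
  show "cosh r *\<^sub>R lift p + sinh r *\<^sub>R M \<in> hyperboloid"
    by (rule boost_in_hyperboloid[OF lift_hyperboloid[OF p(1)] p(2) MM])
  show "mink (cosh r *\<^sub>R lift p + sinh r *\<^sub>R M) M = sinh r" by (simp add: mink_simps p MM)
qed

text \<open>The point \<open>p\<close> is the foot of the perpendicular from \<open>x\<close> to the plane.\<close>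

lemma foot:
  assumes x: "x \<in> hyp" and r: "mink (lift x) M = sinh r"
  shows "\<exists>p\<in>plane M. lift x = cosh r *\<^sub>R lift p + sinh r *\<^sub>R M"
proof -
  define X where "X = (1 / cosh r) *\<^sub>R (lift x - sinh r *\<^sub>R M)"
  have c: "0 < cosh r" by (rule cosh_real_pos)
  have sq: "cosh r * cosh r = 1 + sinh r * sinh r" using cosh_square_eq[of r] by (simp add: power2_eq_square)
  have Mx: "mink M (lift x) = sinh r" using r by (simp add: mink_commute)
  have "mink (lift x - sinh r *\<^sub>R M) (lift x - sinh r *\<^sub>R M) = - (cosh r * cosh r)"
    unfolding mink_simps r Mx MM mink_lift_lift[OF x] sq by (simp add: algebra_simps)
  then have XX: "mink X X = -1" using c unfolding X_def mink_scale_left mink_scale_right by simp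
  have "mink (lift x) (lift x - sinh r *\<^sub>R M) = - (cosh r * cosh r)"
    unfolding mink_simps r mink_lift_lift[OF x] sq by (simp add: algebra_simps)
  then have "mink (lift x) X = - cosh r" using c by (simp add: X_def mink_scale_right)
  then have Xh: "X \<in> hyperboloid" using c by (intro hyperboloidI[OF lift_hyperboloid[OF x] _ XX]) simp
  have XM: "mink X M = 0" unfolding X_def mink_simps r MM by simp
  have "proj X \<in> plane M" using proj_hyp[OF Xh] XM by (simp add: plane_def lift_proj[OF Xh])
  moreover have "lift x = cosh r *\<^sub>R lift (proj X) + sinh r *\<^sub>R M"
    unfolding lift_proj[OF Xh] using c by (simp add: X_def)
  ultimately show ?thesis by blast
qed

lemma plane_nonempty: "proj T \<in> plane M"
  using proj_hyp[OF T] TM by (simp add: plane_def lift_proj[OF T])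

text \<open>Fermi coordinates: the side is the image of the plane times a half line.\<close>

lemma side_connected: "connected (side M k)"
proof -
  define F where "F z = proj (cosh (snd z) *\<^sub>R lift (fst z) + sinh (snd z) *\<^sub>R M)" for z :: "'a \<times> real"
  define D where "D = plane M \<times> {arsinh k<..}"
  have "connected D" unfolding D_def by (intro connected_Times con connected_Ioi)
  moreover have "continuous_on D F"
  proof -
    have "continuous_on D (\<lambda>z. lift (fst z))"
      by (rule continuous_on_compose2[OF continuous_on_lift]) (auto intro!: continuous_intros simp: D_def plane_def)
    then have c: "continuous_on D (\<lambda>z. cosh (snd z) *\<^sub>R lift (fst z) + sinh (snd z) *\<^sub>R M)"
      by (intro continuous_intros)
    have "1 + snd (cosh (snd z) *\<^sub>R lift (fst z) + sinh (snd z) *\<^sub>R M) \<noteq> 0" if "z \<in> D" for z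
      using push(1)[of "fst z" "snd z"] that by (auto simp: D_def hyperboloid_def)
    then show ?thesis unfolding F_def proj_def by (intro continuous_intros c) auto
  qed
  moreover have "F ` D = side M k"
  proof (intro equalityI subsetI)
    fix x assume "x \<in> F ` D"
    then obtain p r where p: "p \<in> plane M" "arsinh k < r" and x: "x = proj (cosh r *\<^sub>R lift p + sinh r *\<^sub>R M)"
      by (auto simp: D_def F_def)
    have "sinh (arsinh k) < sinh r" unfolding sinh_real_less_iff by (rule p(2))
    then show "x \<in> side M k"
      using push[OF p(1), of r] proj_hyp[of "cosh r *\<^sub>R lift p + sinh r *\<^sub>R M"]
      by (simp add: side_def x lift_proj)
  next
    fix x assume "x \<in> side M k"
    then have x: "x \<in> hyp" "k < mink (lift x) M" by (auto simp: side_def)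
    define r where "r = arsinh (mink (lift x) M)"
    have "mink (lift x) M = sinh r" by (simp add: r_def)
    from foot[OF x(1) this] obtain p where p: "p \<in> plane M" "lift x = cosh r *\<^sub>R lift p + sinh r *\<^sub>R M" by blast
    have "arsinh k < r" using x(2) by (simp add: r_def)
    then have "(p, r) \<in> D" using p by (simp add: D_def)
    moreover have "F (p, r) = x" using p(2) proj_lift[OF x(1)] by (simp add: F_def)
    ultimately show "x \<in> F ` D" by blast
  qed
  ultimately show ?thesis using connected_continuous_image by metis
qed

lemma side_nonempty: "side M k \<noteq> {}"
proof -
  define X where "X = cosh (arsinh k + 1) *\<^sub>R lift (proj T) + sinh (arsinh k + 1) *\<^sub>R M"
  have X: "X \<in> hyperboloid" and h: "mink X M = sinh (arsinh k + 1)"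
    unfolding X_def by (rule push[OF plane_nonempty])+
  have "sinh (arsinh k) < sinh (arsinh k + 1)" by (simp add: sinh_real_less_iff del: sinh_arsinh_real)
  then have "proj X \<in> side M k" using proj_hyp[OF X] h by (simp add: side_def lift_proj[OF X])
  then show ?thesis by blast
qed

lemma normal_ideal_point:
  assumes "p \<in> plane M"
  shows "lift p + M \<in> future" "mink (lift p + M) (lift p + M) = 0" "mink (lift p + M) M = 1"
proof -
  have p: "p \<in> hyp" "mink (lift p) M = 0" using assms by (auto simp: plane_def)
  show z: "mink (lift p + M) (lift p + M) = 0"
    using mink_lift_lift[OF p(1)] p(2) mink_commute[of M "lift p"] by (simp add: mink_simps MM)
  show "lift p + M \<in> future"
  proof (rule futureI[OF lift_hyperboloid[OF p(1)]])
    show "mink (lift p) (lift p + M) < 0" unfolding mink_add_right mink_lift_lift[OF p(1)] p(2) by simp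
    show "mink (lift p + M) (lift p + M) \<le> 0" unfolding z by simp
  qed
  show "mink (lift p + M) M = 1" by (simp add: mink_simps p MM)
qed

text \<open>The end points of the rays orthogonal to the plane form the open hemisphere.\<close>

lemma cap_image: "(\<lambda>p. (1 / snd (lift p + M)) *\<^sub>R fst (lift p + M)) ` plane M = cap M"
proof (intro equalityI subsetI)
  fix \<xi> assume "\<xi> \<in> (\<lambda>p. (1 / snd (lift p + M)) *\<^sub>R fst (lift p + M)) ` plane M"
  then obtain p where p: "p \<in> plane M" and \<xi>: "\<xi> = (1 / snd (lift p + M)) *\<^sub>R fst (lift p + M)" by blast
  note n = normal_ideal_point[OF p]
  have "0 < snd (lift p + M)" using n(1) by (simp add: future_def)
  then show "\<xi> \<in> cap M"
    unfolding cap_def \<xi> using future_ideal_point[OF n(1,2)] n(3) by (simp add: mink_scale_left)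
next
  fix \<xi> assume "\<xi> \<in> cap M"
  then have \<xi>: "norm \<xi> = 1" and m: "0 < mink (conevec \<xi>) M" by (auto simp: cap_def)
  define m' where "m' = mink (conevec \<xi>) M"
  define Z where "Z = (1 / m') *\<^sub>R conevec \<xi>"
  have m': "0 < m'" using m by (simp add: m'_def)
  have ZZ: "mink Z Z = 0" unfolding Z_def mink_scale_left mink_scale_right mink_conevec using \<xi> by simp
  have ZM: "mink Z M = 1" unfolding Z_def mink_scale_left m'_def[symmetric] using m' by simp
  have "mink T (conevec \<xi>) < 0" by (rule mink_future_neg[OF T conevec_future]) (simp add: \<xi>)
  then have TZ: "mink T Z < 0" unfolding Z_def mink_scale_right using m' by (simp add: divide_less_0_iff)
  have X: "Z - M \<in> hyperboloid"
    by (rule hyperboloidI[OF T]) (use TZ TM ZZ ZM MM mink_commute[of M Z] in \<open>simp_all add: mink_simps\<close>)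
  define p where "p = proj (Z - M)"
  have lp: "lift p = Z - M" unfolding p_def by (rule lift_proj[OF X])
  have "p \<in> plane M" using proj_hyp[OF X] ZM MM unfolding plane_def mem_Collect_eq lp by (simp add: p_def mink_simps)
  moreover have "\<xi> = (1 / snd (lift p + M)) *\<^sub>R fst (lift p + M)"
    using m' \<xi> by (simp add: lp Z_def conevec_def)
  ultimately show "\<xi> \<in> (\<lambda>p. (1 / snd (lift p + M)) *\<^sub>R fst (lift p + M)) ` plane M" by blast
qed

lemma cap_connected: "connected (cap M)"
proof -
  have "continuous_on (plane M) (\<lambda>p. lift p)"
    by (rule continuous_on_subset[OF continuous_on_lift]) (auto simp: plane_def)
  moreover have "snd (lift p + M) \<noteq> 0" if "p \<in> plane M" for p
    using normal_ideal_point(1)[OF that] by (simp add: future_def)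
  ultimately have "continuous_on (plane M) (\<lambda>p. (1 / snd (lift p + M)) *\<^sub>R fst (lift p + M))"
    by (intro continuous_intros) auto
  then show ?thesis unfolding cap_image[symmetric] using con by (rule connected_continuous_image)
qed

lemma cap_nonempty: "cap M \<noteq> {}"
  unfolding cap_image[symmetric] using plane_nonempty by blast

text \<open>The boost with axis orthogonal to the plane moves the points of the equator into the open hemisphere.\<close>

lemma closure_cap: "closure (cap M) = {\<xi> \<in> sphere 0 1. 0 \<le> mink (conevec \<xi>) M}"
proof (intro equalityI subsetI)
  have "closed {\<xi> \<in> sphere 0 1. 0 \<le> mink (conevec \<xi>) M}"
  proof -
    have "closed (sphere 0 1 \<inter> {\<xi>. 0 \<le> mink (conevec \<xi>) M})"
      by (intro closed_Int closed_sphere closed_Collect_le continuous_intros)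
    moreover have "sphere 0 1 \<inter> {\<xi>. 0 \<le> mink (conevec \<xi>) M} = {\<xi> \<in> sphere 0 1. 0 \<le> mink (conevec \<xi>) M}" by blast
    ultimately show ?thesis by simp
  qed
  moreover have "cap M \<subseteq> {\<xi> \<in> sphere 0 1. 0 \<le> mink (conevec \<xi>) M}" by (auto simp: cap_def)
  ultimately show "\<xi> \<in> {\<xi> \<in> sphere 0 1. 0 \<le> mink (conevec \<xi>) M}" if "\<xi> \<in> closure (cap M)" for \<xi>
    using closure_minimal that by blast
next
  fix \<xi> assume "\<xi> \<in> {\<xi> \<in> sphere 0 1. 0 \<le> mink (conevec \<xi>) M}"
  then have s: "\<xi> \<in> sphere 0 1" and n: "norm \<xi> = 1" and m: "0 \<le> mink (conevec \<xi>) M" by auto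
  have lid: "lorentz (id :: 'a \<times> real \<Rightarrow> _)" by (simp add: lorentz_def linear_id)
  define t where "t k = inverse (real (Suc k))" for k
  have "(\<lambda>k. act (boost T M (t k) \<circ> id) \<xi>) \<longlonglongrightarrow> act (boost T M 0 \<circ> id) \<xi>"
    unfolding t_def
    by (rule tendsto_act_boost[OF T TM MM lid _ tendsto_const LIMSEQ_inverse_real_of_nat]) (simp add: n)
  moreover have "act (boost T M 0 \<circ> id) \<xi> = \<xi>" by (simp add: act_def boost_0 conevec_def n)
  moreover have "act (boost T M (t k) \<circ> id) \<xi> \<in> cap M" for k
  proof -
    have L: "lorentz (boost T M (t k) \<circ> id)" by (rule lorentz_compose[OF boost_lorentz[OF T TM MM] lid])
    obtain r where r: "0 < r" "conevec (act (boost T M (t k) \<circ> id) \<xi>) = r *\<^sub>R (boost T M (t k) \<circ> id) (conevec \<xi>)"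
      using act_sphere(2)[OF L s] by blast
    have "mink T (conevec \<xi>) < 0" by (rule mink_future_neg[OF T conevec_future]) (simp add: n)
    then have "sinh (t k) * mink (conevec \<xi>) T < 0" by (intro mult_pos_neg) (simp_all add: t_def mink_commute)
    moreover have "0 \<le> cosh (t k) * mink (conevec \<xi>) M" using m cosh_real_pos[of "t k"] by simp
    ultimately have "0 < mink (boost T M (t k) (conevec \<xi>)) M" by (simp add: mink_boost_V[OF TM MM])
    then have "0 < mink (conevec (act (boost T M (t k) \<circ> id) \<xi>)) M"
      using r(1) unfolding r(2) comp_apply id_apply mink_scale_left by (rule mult_pos_pos[rotated])
    then show ?thesis using act_sphere(1)[OF L s] unfolding cap_def by blast
  qed
  ultimately show "\<xi> \<in> closure (cap M)" using closure_limit[of "\<lambda>k. act (boost T M (t k) \<circ> id) \<xi>"] by simp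
qed

lemma ideal_boundary_side: "ideal_boundary (side M k) = {\<xi> \<in> sphere 0 1. 0 \<le> mink (conevec \<xi>) M}"
proof (intro equalityI subsetI)
  fix \<xi> assume "\<xi> \<in> ideal_boundary (side M k)"
  then have \<xi>: "\<xi> \<in> sphere 0 1" "\<xi> \<in> closure (side M k)" by (auto simp: ideal_boundary_def)
  have "continuous_on UNIV (\<lambda>x. mink (conevec x) M - k * (1 - (norm x)\<^sup>2))" by (intro continuous_intros)
  then have cl: "closed {x. 0 \<le> mink (conevec x) M - k * (1 - (norm x)\<^sup>2)}"
    by (intro closed_Collect_le continuous_on_const)
  have "side M k \<subseteq> {x. 0 \<le> mink (conevec x) M - k * (1 - (norm x)\<^sup>2)}"
  proof
    fix x assume "x \<in> side M k"
    then have x: "x \<in> hyp" "k < mink (lift x) M" by (auto simp: side_def)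
    have "k * (1 - (norm x)\<^sup>2) \<le> mink (lift x) M * (1 - (norm x)\<^sup>2)"
      using x(2) hyp_norm[OF x(1)] by (intro mult_right_mono) auto
    also have "\<dots> = mink (conevec x) M"
      unfolding conevec_lift[OF x(1)] mink_scale_left by (rule mult.commute)
    finally show "x \<in> {x. 0 \<le> mink (conevec x) M - k * (1 - (norm x)\<^sup>2)}" by simp
  qed
  from closure_minimal[OF this cl] \<xi> show "\<xi> \<in> {\<xi> \<in> sphere 0 1. 0 \<le> mink (conevec \<xi>) M}" by auto
next
  have "cap M \<subseteq> closure (side M k)"
  proof
    fix \<xi> assume "\<xi> \<in> cap M"
    then have n: "norm \<xi> = 1" and m: "0 < mink (conevec \<xi>) M" by (auto simp: cap_def)
    define r where "r j = 1 - inverse (real (Suc j))" for j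
    have r: "0 \<le> r j" "r j < 1" for j
    proof -
      have "inverse (real (Suc j)) \<le> 1" by (rule inverse_le_1_iff[THEN iffD2]) simp
      moreover have "0 < inverse (real (Suc j))" by simp
      ultimately show "0 \<le> r j" "r j < 1" unfolding r_def by linarith+
    qed
    have "r \<longlonglongrightarrow> 1 - 0" unfolding r_def[abs_def] by (intro tendsto_intros LIMSEQ_inverse_real_of_nat)
    then have "(\<lambda>j. r j *\<^sub>R \<xi>) \<longlonglongrightarrow> (1 - 0) *\<^sub>R \<xi>" by (intro tendsto_intros)
    then have lim: "(\<lambda>j. r j *\<^sub>R \<xi>) \<longlonglongrightarrow> \<xi>" by simp
    have "(\<lambda>j. mink (conevec (r j *\<^sub>R \<xi>)) M - k * (1 - (norm (r j *\<^sub>R \<xi>))\<^sup>2)) \<longlonglongrightarrow> mink (conevec \<xi>) M - k * (1 - (norm \<xi>)\<^sup>2)"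
      by (intro tendsto_intros lim)
    then have "\<forall>\<^sub>F j in sequentially. 0 < mink (conevec (r j *\<^sub>R \<xi>)) M - k * (1 - (norm (r j *\<^sub>R \<xi>))\<^sup>2)"
      by (rule order_tendstoD(1)) (simp add: n m)
    then obtain j0 where j0: "\<And>j. j0 \<le> j \<Longrightarrow> 0 < mink (conevec (r j *\<^sub>R \<xi>)) M - k * (1 - (norm (r j *\<^sub>R \<xi>))\<^sup>2)"
      by (auto simp: eventually_sequentially)
    have "r j *\<^sub>R \<xi> \<in> side M k" if "j0 \<le> j" for j
    proof -
      have x: "r j *\<^sub>R \<xi> \<in> hyp" using r[of j] n by simp
      have q: "0 < 1 - (norm (r j *\<^sub>R \<xi>))\<^sup>2" by (rule hyp_norm[OF x])
      have "k * (1 - (norm (r j *\<^sub>R \<xi>))\<^sup>2) < mink (conevec (r j *\<^sub>R \<xi>)) M" using j0[OF that] by simp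
      also have "\<dots> = mink (lift (r j *\<^sub>R \<xi>)) M * (1 - (norm (r j *\<^sub>R \<xi>))\<^sup>2)"
        unfolding conevec_lift[OF x] mink_scale_left by (rule mult.commute)
      finally have "k < mink (lift (r j *\<^sub>R \<xi>)) M" using q by (simp only: mult_less_cancel_right_pos)
      then show ?thesis using x unfolding side_def by blast
    qed
    moreover have "(\<lambda>j. r (j + j0) *\<^sub>R \<xi>) \<longlonglongrightarrow> \<xi>" by (rule LIMSEQ_ignore_initial_segment[OF lim])
    ultimately show "\<xi> \<in> closure (side M k)" by (intro closure_limit[of "\<lambda>j. r (j + j0) *\<^sub>R \<xi>"]) simp_all
  qed
  from closure_minimal[OF this closed_closure] closure_cap
  show "\<xi> \<in> ideal_boundary (side M k)" if "\<xi> \<in> {\<xi> \<in> sphere 0 1. 0 \<le> mink (conevec \<xi>) M}" for \<xi>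
    using that unfolding ideal_boundary_def by blast
qed

text \<open>The geodesic ray from \<open>T\<close> to an ideal point of the equator stays in the plane. Up to parametrisation it consists of
  the normalised vectors \<open>T + r *\<^sub>R Z\<close> with the null vector \<open>Z\<close> of the ideal point.\<close>

lemma ideal_boundary_plane: "ideal_boundary (plane M) = {\<xi> \<in> sphere 0 1. mink (conevec \<xi>) M = 0}"
proof (intro equalityI subsetI)
  fix \<xi> assume "\<xi> \<in> ideal_boundary (plane M)"
  then have \<xi>: "\<xi> \<in> sphere 0 1" "\<xi> \<in> closure (plane M)" by (auto simp: ideal_boundary_def)
  have "closed {x. mink (conevec x) M = 0}" by (intro closed_Collect_eq continuous_intros)
  moreover have "plane M \<subseteq> {x. mink (conevec x) M = 0}"
  proof
    fix x assume x: "x \<in> plane M"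
    then have "x \<in> hyp" by (simp add: plane_def)
    with x show "x \<in> {x. mink (conevec x) M = 0}" using plane_conevec by blast
  qed
  ultimately show "\<xi> \<in> {\<xi> \<in> sphere 0 1. mink (conevec \<xi>) M = 0}" using closure_minimal \<xi> by blast
next
  fix \<xi> assume "\<xi> \<in> {\<xi> \<in> sphere 0 1. mink (conevec \<xi>) M = 0}"
  then have n: "norm \<xi> = 1" and m: "mink (conevec \<xi>) M = 0" by auto
  define Z where "Z = conevec \<xi>"
  define \<beta> where "\<beta> = - mink T Z"
  have \<beta>: "0 < \<beta>" using mink_future_neg[OF T conevec_future, of \<xi>] n by (simp add: \<beta>_def Z_def)
  have ZZ: "mink Z Z = 0" by (simp add: Z_def mink_conevec n)
  have TT: "mink T T = -1" using T by (simp add: hyperboloid_def)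
  define s where "s j = sqrt (1 + 2 * real (Suc j) * \<beta>)" for j
  have s1: "0 < 1 + 2 * real (Suc j) * \<beta>" for j using \<beta> by (intro add_pos_pos) auto
  have s: "0 < s j" "s j * s j = 1 + 2 * real (Suc j) * \<beta>" for j
    unfolding s_def by (rule real_sqrt_gt_zero[OF s1], simp only: real_sqrt_mult_self abs_of_pos[OF s1])
  define X where "X j = (1 / s j) *\<^sub>R (T + real (Suc j) *\<^sub>R Z)" for j
  have X: "X j \<in> hyperboloid" for j
  proof (rule hyperboloidI[OF T])
    have "mink T (T + real (Suc j) *\<^sub>R Z) = - (1 + real (Suc j) * \<beta>)" unfolding mink_simps TT \<beta>_def by simp
    moreover have "0 < 1 + real (Suc j) * \<beta>" using \<beta> by (intro add_pos_pos) auto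
    ultimately show "mink T (X j) < 0"
      using s(1)[of j] unfolding X_def mink_scale_right by (simp add: divide_less_0_iff)
    have "mink (T + real (Suc j) *\<^sub>R Z) (T + real (Suc j) *\<^sub>R Z) = - (s j * s j)"
      unfolding mink_simps TT ZZ mink_commute[of Z T] s(2) \<beta>_def by (simp add: algebra_simps)
    then show "mink (X j) (X j) = -1"
      using s(1)[of j] unfolding X_def mink_scale_left mink_scale_right by simp
  qed
  have XM: "mink (X j) M = 0" for j unfolding X_def mink_simps TM using m by (simp add: Z_def)
  have in_plane: "proj (X j) \<in> plane M" for j
    using proj_hyp[OF X] XM unfolding plane_def mem_Collect_eq lift_proj[OF X] by blast
  define q where "q j = inverse (real (Suc j))" for j
  have q0: "q \<longlonglongrightarrow> 0" unfolding q_def[abs_def] by (rule LIMSEQ_inverse_real_of_nat)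
  have sq: "s j * q j = sqrt (q j * q j + 2 * q j * \<beta>)" for j
  proof (rule real_sqrt_unique[symmetric])
    have rq: "real (Suc j) * q j = 1" unfolding q_def by (rule right_inverse) simp
    have "(s j * q j)\<^sup>2 = (s j * s j) * (q j * q j)" by (simp only: power2_eq_square mult.assoc mult.left_commute)
    also have "\<dots> = q j * q j + 2 * (real (Suc j) * q j) * q j * \<beta>" unfolding s(2) by (simp only: algebra_simps)
    finally show "(s j * q j)\<^sup>2 = q j * q j + 2 * q j * \<beta>" unfolding rq by simp
    show "0 \<le> s j * q j" using s(1)[of j] by (simp add: q_def)
  qed
  have pr: "proj (X j) = (1 / (s j * q j + snd (q j *\<^sub>R T + Z))) *\<^sub>R fst (q j *\<^sub>R T + Z)" for j
  proof -
    have rq: "real (Suc j) * q j = 1" unfolding q_def by (rule right_inverse) simp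
    have qp: "0 < q j" by (simp add: q_def)
    have a: "q j *\<^sub>R T + Z = (s j * q j) *\<^sub>R X j"
      using s(1)[of j] rq unfolding X_def by (simp add: scaleR_add_right mult.commute)
    have "s j * q j + snd (q j *\<^sub>R T + Z) = (s j * q j) * (1 + snd (X j))" unfolding a by (simp add: algebra_simps)
    then show ?thesis unfolding a proj_def using s(1)[of j] qp by simp
  qed
  have "(\<lambda>j. (1 / (sqrt (q j * q j + 2 * q j * \<beta>) + snd (q j *\<^sub>R T + Z))) *\<^sub>R fst (q j *\<^sub>R T + Z)) \<longlonglongrightarrow>
     (1 / (sqrt (0 * 0 + 2 * 0 * \<beta>) + snd (0 *\<^sub>R T + Z))) *\<^sub>R fst (0 *\<^sub>R T + Z)"
    by (intro tendsto_intros q0) (simp add: Z_def conevec_def n)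
  moreover have "(1 / (sqrt (0 * 0 + 2 * 0 * \<beta>) + snd (0 *\<^sub>R T + Z))) *\<^sub>R fst (0 *\<^sub>R T + Z) = \<xi>"
    by (simp add: Z_def conevec_def n)
  ultimately have "(\<lambda>j. proj (X j)) \<longlonglongrightarrow> \<xi>" unfolding pr sq by simp
  from closure_limit[OF in_plane this] n show "\<xi> \<in> ideal_boundary (plane M)" by (simp add: ideal_boundary_def)
qed

end

lemma oriented_plane_side_opposite: "side (- M) (- k) = {x \<in> hyp. mink (lift x) M < k}"
  by (simp add: side_def mink_simps)

lemma cap_opposite: "cap (- M) = {\<xi> \<in> sphere 0 1. mink (conevec \<xi>) M < 0}"
  by (simp add: cap_def mink_simps)

context oriented_plane
begin

lemma components_level:
  "components (hyp - {x \<in> hyp. mink (lift x) M = k}) = {side M k, side (- M) (- k)}"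
proof -
  interpret opp: oriented_plane "- M" T by (rule opposite)
  show ?thesis
    using components_by_height[of hyp "\<lambda>x. mink (lift x) M" k] side_connected[of k] side_nonempty[of k]
      opp.side_connected[of "- k"] opp.side_nonempty[of "- k"]
    unfolding oriented_plane_side_opposite side_def[of M k]
    by (intro components_by_height continuous_on_mink continuous_on_lift continuous_on_const) simp_all
qed

lemma components_sphere:
  "components (sphere 0 1 - ideal_boundary (plane M)) = {cap M, cap (- M)}"
proof -
  interpret opp: oriented_plane "- M" T by (rule opposite)
  show ?thesis
    using cap_connected cap_nonempty opp.cap_connected opp.cap_nonempty
    unfolding cap_opposite ideal_boundary_plane cap_def[of M]
    by (intro components_by_height) (simp_all add: continuous_on_mink continuous_on_conevec)
qed

text \<open>A unit vector orthogonal to the tangent space is the standard normal up to sign, and the sign is constant because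
  it is continuous on a connected set.\<close>

lemma unit_normal_field_standard:
  assumes N: "unit_normal_field (plane M) N"
  shows "\<exists>\<sigma>. \<sigma>\<^sup>2 = 1 \<and> (\<forall>p\<in>plane M. N p = (\<sigma> / conf p) *\<^sub>R coframe p M)"
proof -
  have Nc: "continuous_on (plane M) N" and Nn: "\<And>p. p \<in> plane M \<Longrightarrow> unit_normal_at (plane M) p (N p)"
    using N by (auto simp: unit_normal_field_def)
  define \<sigma> where "\<sigma> p = conf p * (N p \<bullet> coframe p M)" for p
  have st: "N p = (\<sigma> p / conf p) *\<^sub>R coframe p M \<and> (\<sigma> p)\<^sup>2 = 1" if p: "p \<in> plane M" for p
  proof -
    define \<nu> where "\<nu> = coframe p M"
    have ph: "p \<in> hyp" and \<nu>: "norm \<nu> = 1" unfolding \<nu>_def by (rule plane_normal[OF p MM])+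
    have c: "0 < conf p" by (rule conf_pos[OF ph])
    have \<nu>\<nu>: "\<nu> \<bullet> \<nu> = 1" using \<nu> by (simp add: dot_square_norm)
    have perp: "N p \<bullet> e = 0" if e: "norm e = 1" "e \<bullet> \<nu> = 0" for e
    proof -
      have "geo p e s \<in> plane M" for s
        using geo_hyp[OF ph e(1)] height_geo[OF p MM e(1), of s] e(2) by (simp add: plane_def \<nu>_def)
      moreover have "(geo p e has_vector_derivative (1 / conf p) *\<^sub>R e) (at 0)"
        using geo_has_derivative[OF ph e(1), of 0] by (simp only: geo_velocity[OF ph e(1)])
      ultimately have "(1 / conf p) *\<^sub>R e \<in> tangent_space (plane M) p"
        unfolding tangent_space_def using geo_0[OF ph] by blast
      then have "hinner p (N p) ((1 / conf p) *\<^sub>R e) = 0" using Nn[OF p] by (simp add: unit_normal_at_def)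
      then show ?thesis using c by (simp add: hinner_def)
    qed
    define w where "w = N p - (N p \<bullet> \<nu>) *\<^sub>R \<nu>"
    have w\<nu>: "w \<bullet> \<nu> = 0" by (simp add: w_def inner_simps \<nu>\<nu>)
    have "w = 0"
    proof (rule ccontr)
      assume w: "w \<noteq> 0"
      have "N p \<bullet> ((1 / norm w) *\<^sub>R w) = 0" by (rule perp) (use w w\<nu> in simp_all)
      then have "N p \<bullet> w = 0" using w by simp
      then have "w \<bullet> w = 0" using w\<nu> unfolding w_def by (simp add: inner_simps inner_commute)
      then show False using w by simp
    qed
    then have Np: "N p = (N p \<bullet> \<nu>) *\<^sub>R \<nu>" by (simp add: w_def)
    then have 1: "N p = (\<sigma> p / conf p) *\<^sub>R \<nu>" using c by (simp add: \<sigma>_def \<nu>_def)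
    have "hinner p (N p) (N p) = 1"
      using Nn[OF p] by (simp add: unit_normal_at_def hnorm_def)
    then have "(\<sigma> p)\<^sup>2 = 1" using c \<nu>\<nu> unfolding hinner_def 1 by (simp add: power2_eq_square)
    with 1 show ?thesis by (simp add: \<nu>_def)
  qed
  have "continuous_on (plane M) \<sigma>"
  proof -
    have "continuous_on (plane M) (\<lambda>p. conf p)"
      unfolding conf_def by (intro continuous_intros) (use hyp_norm in \<open>force simp: plane_def\<close>)
    then show ?thesis unfolding \<sigma>_def[abs_def] coframe_def by (intro continuous_intros Nc)
  qed
  then have "connected (\<sigma> ` plane M)" using con by (rule connected_continuous_image)
  moreover have "\<sigma> p = 1 \<or> \<sigma> p = -1" if "p \<in> plane M" for p using st[OF that] by (simp add: power2_eq_1_iff)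
  ultimately have same: "\<sigma> p = \<sigma> q" if "p \<in> plane M" "q \<in> plane M" for p q
  proof -
    have "0 \<notin> \<sigma> ` plane M" using \<open>\<And>p. p \<in> plane M \<Longrightarrow> \<sigma> p = 1 \<or> \<sigma> p = -1\<close> by force
    then have "\<not> (\<sigma> p \<le> 0 \<and> 0 \<le> \<sigma> q)" "\<not> (\<sigma> q \<le> 0 \<and> 0 \<le> \<sigma> p)"
      using \<open>connected (\<sigma> ` plane M)\<close> that unfolding connected_iff_interval by blast+
    then show ?thesis using \<open>\<And>p. p \<in> plane M \<Longrightarrow> \<sigma> p = 1 \<or> \<sigma> p = -1\<close>[OF that(1)]
      \<open>\<And>p. p \<in> plane M \<Longrightarrow> \<sigma> p = 1 \<or> \<sigma> p = -1\<close>[OF that(2)] by auto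
  qed
  show ?thesis
  proof (intro exI[of _ "\<sigma> (proj T)"] conjI ballI)
    show "(\<sigma> (proj T))\<^sup>2 = 1" using st[OF plane_nonempty] by blast
    fix p assume p: "p \<in> plane M"
    show "N p = (\<sigma> (proj T) / conf p) *\<^sub>R coframe p M" unfolding same[OF plane_nonempty p] using st[OF p] by blast
  qed
qed

lemma equidistant_level:
  assumes N: "\<And>p. p \<in> plane M \<Longrightarrow> N p = (\<sigma> / conf p) *\<^sub>R coframe p M"
  shows "equidistant (plane M) N c = {x \<in> hyp. mink (lift x) M = sinh (\<sigma> * c)}"
proof -
  have ex: "hexp p (c *\<^sub>R N p) = geo p (coframe p M) (\<sigma> * c)" if p: "p \<in> plane M" for p
  proof -
    note n = plane_normal[OF p MM]
    have "c *\<^sub>R N p = (\<sigma> * c / conf p) *\<^sub>R coframe p M" by (simp add: N[OF p])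
    then show ?thesis by (simp only: hexp_eq[OF n(1,2)])
  qed
  have lg: "lift (geo p (coframe p M) r) = cosh r *\<^sub>R lift p + sinh r *\<^sub>R M" if p: "p \<in> plane M" for p r
    using plane_normal[OF p MM] by (simp only: lift_geo)
  show ?thesis
  proof (intro equalityI subsetI)
    fix x assume "x \<in> equidistant (plane M) N c"
    then obtain p where p: "p \<in> plane M" and x: "x = geo p (coframe p M) (\<sigma> * c)"
      unfolding equidistant_def using ex by blast
    have "x \<in> hyp" unfolding x using plane_normal[OF p MM] by (intro geo_hyp)
    moreover have "mink (lift x) M = sinh (\<sigma> * c)" unfolding x lg[OF p] by (rule push(2)[OF p])
    ultimately show "x \<in> {x \<in> hyp. mink (lift x) M = sinh (\<sigma> * c)}" by blast
  next
    fix x assume "x \<in> {x \<in> hyp. mink (lift x) M = sinh (\<sigma> * c)}"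
    then have x: "x \<in> hyp" "mink (lift x) M = sinh (\<sigma> * c)" by auto
    from foot[OF x] obtain p where p: "p \<in> plane M" "lift x = cosh (\<sigma> * c) *\<^sub>R lift p + sinh (\<sigma> * c) *\<^sub>R M" by blast
    have "geo p (coframe p M) (\<sigma> * c) \<in> hyp" using plane_normal[OF p(1) MM] by (intro geo_hyp)
    then have xg: "x = geo p (coframe p M) (\<sigma> * c)" by (rule lift_inj[OF x(1)]) (simp only: lg[OF p(1)] p(2))
    show "x \<in> equidistant (plane M) N c"
      unfolding equidistant_def by (rule image_eqI[OF _ p(1)]) (simp only: ex[OF p(1)] xg[symmetric])
  qed
qed

lemma equidistant_side_eq:
  assumes N: "\<And>p. p \<in> plane M \<Longrightarrow> N p = (\<sigma> / conf p) *\<^sub>R coframe p M"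
  shows "equidistant_side (plane M) N {\<xi> \<in> sphere 0 1. 0 \<le> mink (conevec \<xi>) M} c = side M (sinh (\<sigma> * c))"
proof -
  interpret opp: oriented_plane "- M" T by (rule opposite)
  have ne: "{\<xi> \<in> sphere 0 1. 0 \<le> mink (conevec \<xi>) (- M)} \<noteq> {\<xi> \<in> sphere 0 1. 0 \<le> mink (conevec \<xi>) M}"
  proof -
    obtain \<xi> where "\<xi> \<in> cap M" using cap_nonempty by blast
    then have "\<xi> \<in> {\<xi> \<in> sphere 0 1. 0 \<le> mink (conevec \<xi>) M}" "\<xi> \<notin> {\<xi> \<in> sphere 0 1. 0 \<le> mink (conevec \<xi>) (- M)}"
      by (auto simp: cap_def mink_simps)
    then show ?thesis by blast
  qed
  define k where "k = sinh (\<sigma> * c)"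
  have lev: "components (hyp - equidistant (plane M) N c) = {side M k, side (- M) (- k)}"
  proof -
    have "equidistant (plane M) N c = {x \<in> hyp. mink (lift x) M = k}"
      unfolding k_def by (rule equidistant_level) (rule N)
    then show ?thesis by (simp only: components_level)
  qed
  show ?thesis
    unfolding equidistant_side_def lev k_def[symmetric]
  proof (rule the_equality)
    show "side M k \<in> {side M k, side (- M) (- k)} \<and>
        ideal_boundary (side M k) = {\<xi> \<in> sphere 0 1. 0 \<le> mink (conevec \<xi>) M}"
      using ideal_boundary_side by blast
  next
    fix D assume D: "D \<in> {side M k, side (- M) (- k)} \<and>
        ideal_boundary D = {\<xi> \<in> sphere 0 1. 0 \<le> mink (conevec \<xi>) M}"
    have "D \<noteq> side (- M) (- k)"
    proof
      assume "D = side (- M) (- k)"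
      then have "ideal_boundary D = {\<xi> \<in> sphere 0 1. 0 \<le> mink (conevec \<xi>) (- M)}"
        using opp.ideal_boundary_side by simp
      then show False using D ne by simp
    qed
    then show "D = side M k" using D by blast
  qed
qed

end

section \<open>Hyperbolic translations\<close>

lemma mink_has_derivative:
  assumes "(f has_vector_derivative f') (at s)" "(g has_vector_derivative g') (at s)"
  shows "((\<lambda>s. mink (f s) (g s)) has_real_derivative mink (f s) g' + mink f' (g s)) (at s)"
proof -
  have "((\<lambda>s. fst (f s) \<bullet> fst (g s)) has_real_derivative fst (f s) \<bullet> fst g' + fst f' \<bullet> fst (g s)) (at s)"
    using bounded_bilinear.has_vector_derivative[OF bounded_bilinear_inner
        linear_component_derivatives(1)[OF assms(1)] linear_component_derivatives(1)[OF assms(2)]]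
    by (simp only: has_real_derivative_iff_has_vector_derivative)
  moreover have "((\<lambda>s. snd (f s) * snd (g s)) has_real_derivative snd f' * snd (g s) + snd g' * snd (f s)) (at s)"
    by (rule DERIV_mult[OF linear_component_derivatives(2)[OF assms(1), folded has_real_derivative_iff_has_vector_derivative]
      linear_component_derivatives(2)[OF assms(2), folded has_real_derivative_iff_has_vector_derivative]])
  ultimately show ?thesis
    unfolding mink_def by (rule DERIV_cong[OF DERIV_diff]) (simp add: algebra_simps)
qed

lemma hdist_eq_imp:
  assumes "x \<in> hyp" "y \<in> hyp" "x' \<in> hyp" "y' \<in> hyp" "hdist x y = hdist x' y'"
  shows "mink (lift x) (lift y) = mink (lift x') (lift y')"
proof -
  have "1 \<le> - mink (lift x) (lift y)" "1 \<le> - mink (lift x') (lift y')"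
    using mink_hyperboloid_le(1)[OF lift_hyperboloid[OF assms(1)] lift_hyperboloid[OF assms(2)]]
      mink_hyperboloid_le(1)[OF lift_hyperboloid[OF assms(3)] lift_hyperboloid[OF assms(4)]] by auto
  moreover have "arcosh (- mink (lift x) (lift y)) = arcosh (- mink (lift x') (lift y'))"
    using assms(5) by (simp only: hdist_lift[OF assms(1,2)] hdist_lift[OF assms(3,4)])
  ultimately have "- mink (lift x) (lift y) = - mink (lift x') (lift y')"
    by (metis cosh_arcosh_real)
  then show ?thesis by simp
qed

lemma act_has_derivative:
  assumes A: "lorentz A" and x: "x \<in> hyp"
  shows "(act A has_derivative
     (\<lambda>w. (1 / conf (act A x)) *\<^sub>R coframe (act A x) (A (conf x *\<^sub>R frame x w)))) (at x)"
proof -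
  define D where "D y = snd (A (conevec y)) + (1 - (norm y)\<^sup>2)" for y
  define q where "q = 1 - (norm x)\<^sup>2"
  have q: "0 < q" unfolding q_def by (rule hyp_norm[OF x])
  have qc: "conf x * q = 2" unfolding q_def by (rule conf_norm'[OF x])
  have linA: "linear A" by (rule lorentz_linear[OF A])
  then have blA: "bounded_linear A" by (simp add: linear_conv_bounded_linear)
  define J where "J w = (2 *\<^sub>R w, 2 * (x \<bullet> w))" for w
  have "((\<lambda>y. 1 + (norm y)\<^sup>2) has_derivative (\<lambda>w. 2 * (x \<bullet> w))) (at x)"
    unfolding power2_norm_eq_inner by (auto intro!: derivative_eq_intros simp: inner_commute)
  then have dJ: "(conevec has_derivative J) (at x)"
    unfolding conevec_def[abs_def] J_def[abs_def] by (intro has_derivative_Pair derivative_intros)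
  have dA: "((\<lambda>y. A (conevec y)) has_derivative (\<lambda>w. A (J w))) (at x)"
    by (rule bounded_linear.has_derivative[OF blA dJ])
  have dn: "((\<lambda>y. 1 - (norm y)\<^sup>2) has_derivative (\<lambda>w. - (2 * (x \<bullet> w)))) (at x)"
    unfolding power2_norm_eq_inner by (auto intro!: derivative_eq_intros simp: inner_commute)
  have dD: "(D has_derivative (\<lambda>w. snd (A (J w)) - 2 * (x \<bullet> w))) (at x)"
    using has_derivative_add[OF bounded_linear.has_derivative[OF bounded_linear_snd dA] dn]
    by (simp add: D_def[abs_def])
  have AX: "A (lift x) = lift (act A x)" by (rule lift_act[OF A x, symmetric])
  have ax: "act A x \<in> hyp" by (rule act_hyp[OF A x])
  have Dx: "D x = q * conf (act A x)"
  proof -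
    have "A (conevec x) = q *\<^sub>R lift (act A x)"
      unfolding conevec_lift[OF x] q_def[symmetric] linear_cmul[OF linA] AX ..
    then show ?thesis by (simp add: D_def q_def[symmetric] lift_def algebra_simps)
  qed
  have cp: "0 < conf (act A x)" by (rule conf_pos[OF ax])
  have Dp: "0 < D x" unfolding Dx using q cp by simp
  have "((\<lambda>y. inverse (D y)) has_derivative (\<lambda>w. - (inverse (D x) * (snd (A (J w)) - 2 * (x \<bullet> w)) * inverse (D x)))) (at x)"
    by (rule Deriv.has_derivative_inverse[OF _ dD]) (use Dp in simp)
  from has_derivative_scaleR[OF this bounded_linear.has_derivative[OF bounded_linear_fst dA]]
  have "(act A has_derivative (\<lambda>w. inverse (D x) *\<^sub>R fst (A (J w)) +
      (- (inverse (D x) * (snd (A (J w)) - 2 * (x \<bullet> w)) * inverse (D x))) *\<^sub>R fst (A (conevec x)))) (at x)"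
    by (simp add: act_def[abs_def] D_def inverse_eq_divide)
  moreover have "inverse (D x) *\<^sub>R fst (A (J w)) +
      (- (inverse (D x) * (snd (A (J w)) - 2 * (x \<bullet> w)) * inverse (D x))) *\<^sub>R fst (A (conevec x))
     = (1 / conf (act A x)) *\<^sub>R coframe (act A x) (A (conf x *\<^sub>R frame x w))" for w
  proof -
    define V where "V = A (conf x *\<^sub>R frame x w)"
    have Jw: "J w = q *\<^sub>R (conf x *\<^sub>R frame x w) - (2 * (x \<bullet> w)) *\<^sub>R lift x"
    proof -
      have "q * conf x = 2" using qc by (simp only: mult.commute)
      then have "q *\<^sub>R (conf x *\<^sub>R frame x w) = 2 *\<^sub>R frame x w" by (simp only: scaleR_scaleR)
      then show ?thesis by (simp add: J_def frame_def lift_def algebra_simps)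
    qed
    have AJ: "A (J w) = q *\<^sub>R V - (2 * (x \<bullet> w)) *\<^sub>R lift (act A x)"
      unfolding Jw V_def linear_diff[OF linA] linear_cmul[OF linA] AX ..
    have f: "fst (A (conevec x)) = D x *\<^sub>R act A x"
      using Dp by (simp add: act_def D_def)
    have i: "(- (inverse (D x) * s * inverse (D x))) *\<^sub>R (D x *\<^sub>R z) = - (inverse (D x) *\<^sub>R (s *\<^sub>R z))"
      for s and z :: 'a using Dp by simp
    have "inverse (D x) *\<^sub>R fst (A (J w)) +
      (- (inverse (D x) * (snd (A (J w)) - 2 * (x \<bullet> w)) * inverse (D x))) *\<^sub>R fst (A (conevec x))
      = inverse (D x) *\<^sub>R (fst (A (J w)) - (snd (A (J w)) - 2 * (x \<bullet> w)) *\<^sub>R act A x)"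
      unfolding f i by (simp only: scaleR_diff_right add_uminus_conv_diff)
    also have "fst (A (J w)) - (snd (A (J w)) - 2 * (x \<bullet> w)) *\<^sub>R act A x = q *\<^sub>R coframe (act A x) V"
      unfolding AJ by (simp add: lift_def coframe_def algebra_simps)
    also have "inverse (D x) *\<^sub>R (q *\<^sub>R coframe (act A x) V) = (1 / conf (act A x)) *\<^sub>R coframe (act A x) V"
      unfolding Dx using q cp by (simp add: inverse_eq_divide)
    finally show ?thesis by (simp only: V_def)
  qed
  ultimately show ?thesis by simp
qed

text \<open>The boost in the plane of the geodesic.\<close>

lemma exists_hyp_translation:
  assumes \<gamma>: "unit_speed_geodesic \<gamma>"
  shows "\<exists>L. is_hyp_translation \<gamma> t L"
proof -
  obtain e where e: "norm e = 1" and x0: "\<gamma> 0 \<in> hyp" and ge: "\<forall>s. \<gamma> s = geo (\<gamma> 0) e s"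
    using unit_speed_geodesic_eq_geo[OF \<gamma>] by blast
  have cg: "complete_geodesic \<gamma>" using \<gamma> by (simp add: unit_speed_geodesic_def)
  define x where "x = \<gamma> 0"
  have xh: "x \<in> hyp" and g: "\<gamma> = geo x e" unfolding x_def by (rule x0, rule ext, rule ge[rule_format])
  define X0 where "X0 = lift x"
  define V0 where "V0 = frame x e"
  have X0: "X0 \<in> hyperboloid" unfolding X0_def by (rule lift_hyperboloid[OF xh])
  have XV: "mink X0 V0 = 0" unfolding X0_def V0_def by (rule mink_lift_frame[OF xh])
  have VV: "mink V0 V0 = 1" unfolding V0_def mink_frame[OF xh] using e by (simp add: dot_square_norm)
  define A where "A = boost X0 V0 t"
  have A: "lorentz A" unfolding A_def by (rule boost_lorentz[OF X0 XV VV])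
  have AX: "A X0 = cosh t *\<^sub>R X0 + sinh t *\<^sub>R V0" unfolding A_def by (rule boost_apply_T[OF X0 XV])
  have AV: "A V0 = sinh t *\<^sub>R X0 + cosh t *\<^sub>R V0" unfolding A_def by (rule boost_apply_V[OF XV VV])
  have linA: "linear A" by (rule lorentz_linear[OF A])
  define X where "X s = cosh s *\<^sub>R X0 + sinh s *\<^sub>R V0" for s
  define X' where "X' s = sinh s *\<^sub>R X0 + cosh s *\<^sub>R V0" for s
  have lg: "lift (\<gamma> s) = X s" for s unfolding g X_def X0_def V0_def by (rule lift_geo[OF xh e])
  have gh: "\<gamma> s \<in> hyp" for s unfolding g by (rule geo_hyp[OF xh e])
  have AXs: "A (X s) = X (s + t)" for s
    unfolding X_def linear_add[OF linA] linear_cmul[OF linA] AX AV cosh_add sinh_add by (simp add: algebra_simps)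
  have AXs': "A (X' s) = X' (s + t)" for s
    unfolding X'_def linear_add[OF linA] linear_cmul[OF linA] AX AV cosh_add sinh_add by (simp add: algebra_simps)
  have mv: "act A (\<gamma> s) = \<gamma> (s + t)" for s
    by (rule lift_inj[OF act_hyp[OF A gh] gh]) (simp only: lift_act[OF A gh] lg AXs)
  have dX: "(X has_vector_derivative X' s) (at s)" and dX': "(X' has_vector_derivative X s) (at s)" for s
    unfolding X_def[abs_def] X'_def[abs_def] by (auto intro!: derivative_eq_intros simp: algebra_simps)
  have vel: "(\<gamma> has_vector_derivative velocity \<gamma> s) (at s)" for s unfolding g by (rule geo_has_derivative[OF xh e])
  have fv: "conf (\<gamma> s) *\<^sub>R frame (\<gamma> s) (velocity \<gamma> s) = X' s" for s
  proof -
    have "(X has_vector_derivative conf (\<gamma> s) *\<^sub>R frame (\<gamma> s) (velocity \<gamma> s)) (at s)"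
      using lift_has_derivative[of \<gamma> s, OF gh vel] unfolding lg .
    from vector_derivative_unique_at[OF this dX] show ?thesis .
  qed
  (* In Minkowski space a parallel field is a constant multiple of the velocity plus a constant vector
     orthogonal to the plane of the boost; the boost fixes the latter and shifts the former. *)
  have par: "A (conf (\<gamma> s) *\<^sub>R frame (\<gamma> s) (V s)) = conf (\<gamma> (s + t)) *\<^sub>R frame (\<gamma> (s + t)) (V (s + t))"
    if V: "parallel_along \<gamma> V" for V s
  proof -
    define Y where "Y s = conf (\<gamma> s) *\<^sub>R frame (\<gamma> s) (V s)" for s
    have XY: "mink (X s) (Y s) = 0" for s
      unfolding Y_def lg[symmetric] mink_scale_right mink_lift_frame[OF gh] by simp
    have dY: "(Y has_vector_derivative mink (X' s) (Y s) *\<^sub>R X s) (at s)" for s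
    proof -
      have "(Y has_vector_derivative ((conf (\<gamma> s))\<^sup>2 * (velocity \<gamma> s \<bullet> V s)) *\<^sub>R lift (\<gamma> s)) (at s)"
        unfolding Y_def[abs_def]
        by (rule parallel_lift_derivative[OF gh vel]) (use V in \<open>simp add: parallel_along_def\<close>)
      moreover have "(conf (\<gamma> s))\<^sup>2 * (velocity \<gamma> s \<bullet> V s) = mink (X' s) (Y s)"
        unfolding fv[symmetric] Y_def mink_scale_left mink_scale_right mink_frame[OF gh] by (simp add: power2_eq_square)
      ultimately show ?thesis by (simp only: lg)
    qed
    define a where "a = mink (X' 0) (Y 0)"
    have "((\<lambda>s. mink (X' s) (Y s)) has_real_derivative 0) (at s)" for s
    proof (rule DERIV_cong[OF mink_has_derivative[OF dX' dY]])
      have "mink (X' s) (X s) = 0"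
        unfolding lg[symmetric] fv[symmetric] mink_scale_left by (simp add: mink_commute[of "frame _ _"] mink_lift_frame[OF gh])
      then show "mink (X' s) (mink (X' s) (Y s) *\<^sub>R X s) + mink (X s) (Y s) = 0"
        by (simp add: mink_scale_right XY)
    qed
    then have a: "mink (X' s) (Y s) = a" for s
      unfolding a_def by (intro constant_if_derivative_zero) (simp add: has_real_derivative_iff_has_vector_derivative)
    have "((\<lambda>s. Y s - a *\<^sub>R X' s) has_vector_derivative 0) (at s)" for s
    proof (rule has_vector_derivative_eq_rhs)
      show "((\<lambda>s. Y s - a *\<^sub>R X' s) has_vector_derivative mink (X' s) (Y s) *\<^sub>R X s - a *\<^sub>R X s) (at s)"
        by (intro has_vector_derivative_diff dY bounded_linear.has_vector_derivative[OF bounded_linear_scaleR_right dX'])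
    qed (simp add: a)
    then have W: "Y s - a *\<^sub>R X' s = Y 0 - a *\<^sub>R X' 0" for s by (rule constant_if_derivative_zero)
    define W0 where "W0 = Y 0 - a *\<^sub>R X' 0"
    have X00: "X 0 = X0" "X' 0 = V0" by (simp_all add: X_def X'_def)
    have "mink W0 X0 = 0"
      using XY[of 0] XV by (simp add: W0_def X00 mink_simps mink_commute[of "Y 0"] mink_commute[of V0 X0])
    moreover have "mink W0 V0 = 0"
      using a[of 0] VV by (simp add: W0_def X00 mink_simps mink_commute[of "Y 0"])
    ultimately have AW: "A W0 = W0" unfolding A_def by (rule boost_fix)
    have Ys: "Y s = a *\<^sub>R X' s + W0" for s using W[of s] by (simp add: W0_def algebra_simps)
    have "A (Y s) = Y (s + t)"
      unfolding Ys[of s] Ys[of "s + t"] linear_add[OF linA] linear_cmul[OF linA] AW AXs' ..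
    then show ?thesis by (simp only: Y_def)
  qed
  obtain B where B: "lorentz B" "\<And>X. B (A X) = X" "\<And>X. A (B X) = X" using lorentz_inverse[OF A] by blast
  have "is_hyp_translation \<gamma> t (act A)"
    unfolding is_hyp_translation_def hyp_isometry_def
  proof (intro conjI ballI allI)
    show "bij_betw (act A) hyp hyp"
    proof (rule bij_betwI[where g = "act B"])
      show "act A \<in> hyp \<rightarrow> hyp" using act_hyp[OF A] by blast
      show "act B \<in> hyp \<rightarrow> hyp" using act_hyp[OF B(1)] by blast
      show "act B (act A y) = y" if "y \<in> hyp" for y
        by (rule lift_inj[OF act_hyp[OF B(1) act_hyp[OF A that]] that])
          (simp only: lift_act[OF B(1) act_hyp[OF A that]] lift_act[OF A that] B(2))
      show "act A (act B y) = y" if "y \<in> hyp" for y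
        by (rule lift_inj[OF act_hyp[OF A act_hyp[OF B(1) that]] that])
          (simp only: lift_act[OF A act_hyp[OF B(1) that]] lift_act[OF B(1) that] B(3))
    qed
    show "hdist (act A y) (act A z) = hdist y z" if "y \<in> hyp" "z \<in> hyp" for y z by (rule act_isometry[OF A that])
    show "act A (\<gamma> s) = \<gamma> (s + t)" for s by (rule mv)
    fix s
    show "\<exists>L'. (act A has_derivative L') (at (\<gamma> s)) \<and> (\<forall>V. parallel_along \<gamma> V \<longrightarrow> L' (V s) = V (s + t))"
    proof (rule exI, rule conjI[OF act_has_derivative[OF A gh]], intro allI impI)
      fix V assume V: "parallel_along \<gamma> V"
      show "(1 / conf (act A (\<gamma> s))) *\<^sub>R coframe (act A (\<gamma> s)) (A (conf (\<gamma> s) *\<^sub>R frame (\<gamma> s) (V s))) = V (s + t)"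
        unfolding par[OF V] mv using conf_pos[OF gh[of "s + t"]]
        by (simp add: linear_cmul[OF coframe_linear] coframe_frame)
    qed
  qed
  then show ?thesis by blast
qed

text \<open>In Minkowski space the unit normal of \<open>plane M\<close> is the constant vector \<open>M\<close>.\<close>

lemma normal_parallel:
  assumes \<gamma>: "complete_geodesic \<gamma>" "range \<gamma> \<subseteq> plane M"
  shows "parallel_along \<gamma> (\<lambda>s. (1 / conf (\<gamma> s)) *\<^sub>R coframe (\<gamma> s) M)"
  unfolding parallel_along_def
proof
  fix s
  define c where "c = conf (\<gamma> s)"
  define x where "x = \<gamma> s"
  define v where "v = velocity \<gamma> s"
  define m where "m = fst M"
  define a where "a = snd M"
  have pl: "\<gamma> s \<in> plane M" for s using \<gamma>(2) by blast
  have hyp: "\<gamma> s \<in> hyp" and m0: "mink (lift (\<gamma> s)) M = 0" for s using pl[of s] by (auto simp: plane_def)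
  have "\<gamma> differentiable (at s)" using \<gamma>(1) by (simp add: complete_geodesic_def)
  then have dg: "(\<gamma> has_vector_derivative v) (at s)"
    unfolding v_def velocity_def by (simp only: vector_derivative_works[symmetric])
  have c: "0 < c" unfolding c_def by (rule conf_pos[OF hyp])
  have cn: "c * (x \<bullet> x) = c - 2" unfolding c_def x_def by (rule conf_norm[OF hyp])
  have cm: "c * (x \<bullet> m) = (c - 1) * a"
    using m0[of s] by (simp add: mink_def lift_def c_def x_def m_def a_def algebra_simps)
  have vm: "v \<bullet> m = a * (x \<bullet> v)"
  proof -
    have "((\<lambda>s. mink (lift (\<gamma> s)) M) has_real_derivative mink (conf (\<gamma> s) *\<^sub>R frame (\<gamma> s) v) M) (at s)"
      by (rule has_real_derivative_mink_left[OF lift_has_derivative[OF hyp dg]])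
    then have "((\<lambda>s. 0) has_real_derivative mink (conf (\<gamma> s) *\<^sub>R frame (\<gamma> s) v) M) (at s)" by (simp only: m0)
    then have "mink (conf (\<gamma> s) *\<^sub>R frame (\<gamma> s) v) M = 0" using DERIV_unique[OF DERIV_const[of 0]] by metis
    then have "mink (frame x v) M = 0" using c by (simp add: mink_scale_left c_def x_def)
    then have "(c * (x \<bullet> m)) * (x \<bullet> v) + v \<bullet> m - c * (x \<bullet> v) * a = 0"
      by (simp add: mink_def frame_def c_def x_def m_def a_def inner_simps algebra_simps)
    then show ?thesis unfolding cm by (simp add: algebra_simps)
  qed
  define w where "w = (1 / c) *\<^sub>R (m - a *\<^sub>R x)"
  have xw: "c * (x \<bullet> w) = a / c"
  proof -
    have "c * (c * (x \<bullet> w)) = c * (x \<bullet> m) - a * (c * (x \<bullet> x))" using c by (simp add: w_def inner_simps algebra_simps)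
    also have "\<dots> = a" unfolding cm cn by (simp add: algebra_simps)
    finally show ?thesis using c by (simp add: field_simps)
  qed
  have vw: "v \<bullet> w = 0" unfolding w_def by (simp add: inner_simps vm inner_commute[of x v])
  have di: "((\<lambda>s. 1 / conf (\<gamma> s)) has_real_derivative - (x \<bullet> v)) (at s)"
    using DERIV_divide[OF DERIV_const[of 1] conf_has_derivative[of \<gamma> s, OF hyp dg]] c
    by (simp add: c_def x_def power2_eq_square)
  have dm: "((\<lambda>s. coframe (\<gamma> s) M) has_vector_derivative - (a *\<^sub>R v)) (at s)"
    unfolding coframe_def a_def
    using has_vector_derivative_diff[OF has_vector_derivative_const[of "fst M"]
        bounded_linear.has_vector_derivative[OF bounded_linear_scaleR_right dg, of "snd M"]] by simp
  have rhs: "- christoffel x v w = (1 / c) *\<^sub>R (- (a *\<^sub>R v)) + (- (x \<bullet> v)) *\<^sub>R (m - a *\<^sub>R x)"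
  proof -
    have "- christoffel x v w = - ((x \<bullet> v) *\<^sub>R (c *\<^sub>R w)) - (c * (x \<bullet> w)) *\<^sub>R v"
      by (simp add: christoffel_def vw c_def x_def algebra_simps)
    also have "c *\<^sub>R w = m - a *\<^sub>R x" using c by (simp add: w_def)
    finally show ?thesis unfolding xw by simp
  qed
  have "((\<lambda>s. (1 / conf (\<gamma> s)) *\<^sub>R coframe (\<gamma> s) M) has_vector_derivative
      (1 / conf (\<gamma> s)) *\<^sub>R (- (a *\<^sub>R v)) + (- (x \<bullet> v)) *\<^sub>R coframe (\<gamma> s) M) (at s)"
    by (rule has_vector_derivative_scaleR[OF di dm])
  then show "((\<lambda>s. (1 / conf (\<gamma> s)) *\<^sub>R coframe (\<gamma> s) M) has_vector_derivative
      - christoffel (\<gamma> s) (velocity \<gamma> s) ((1 / conf (\<gamma> s)) *\<^sub>R coframe (\<gamma> s) M)) (at s)"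
    using rhs by (simp only: x_def v_def w_def c_def m_def a_def coframe_def)
qed

text \<open>The translation preserves \<open>mink (lift x) (lift y)\<close>, and it maps the normal of the plane at \<open>\<gamma> 0\<close> to the normal at
  \<open>\<gamma> t\<close> because the normal field is parallel. Differentiating this product in \<open>y\<close> along the normal geodesic at \<open>\<gamma> 0\<close>
  gives the product of \<open>lift x\<close> with \<open>M\<close>.\<close>

lemma translation_preserves_height:
  assumes \<gamma>: "complete_geodesic \<gamma>" "range \<gamma> \<subseteq> plane M" and M: "mink M M = 1"
    and L: "is_hyp_translation \<gamma> t L" and x: "x \<in> hyp"
  shows "L x \<in> hyp" "mink (lift (L x)) M = mink (lift x) M"
proof -
  have bij: "bij_betw L hyp hyp" and iso: "\<And>p q. p \<in> hyp \<Longrightarrow> q \<in> hyp \<Longrightarrow> hdist (L p) (L q) = hdist p q"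
    and mv: "\<And>s. L (\<gamma> s) = \<gamma> (s + t)"
    using L by (auto simp: is_hyp_translation_def hyp_isometry_def simp del: mem_ball mem_ball_0)
  have Lh: "L y \<in> hyp" if "y \<in> hyp" for y using bij that by (rule bij_betwE[THEN bspec])
  show "L x \<in> hyp" by (rule Lh[OF x])
  obtain L' where L': "(L has_derivative L') (at (\<gamma> 0))" "\<And>V. parallel_along \<gamma> V \<Longrightarrow> L' (V 0) = V (0 + t)"
    using L unfolding is_hyp_translation_def by blast
  define p where "p = \<gamma> 0"
  have pp: "p \<in> plane M" and tp: "\<gamma> t \<in> plane M" using \<gamma>(2) by (auto simp: p_def)
  note n = plane_normal[OF pp M] and nt = plane_normal[OF tp M]
  define y where "y = geo p (coframe p M)"
  have yh: "y h \<in> hyp" for h unfolding y_def by (rule geo_hyp[OF n(1,2)])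
  have y0: "y 0 = p" unfolding y_def by (rule geo_0[OF n(1)])
  have dy: "(y has_vector_derivative (1 / conf p) *\<^sub>R coframe p M) (at 0)"
    using geo_has_derivative[OF n(1,2), of 0] unfolding y_def geo_velocity[OF n(1,2)] .
  have dly: "((\<lambda>h. lift (y h)) has_vector_derivative M) (at 0)"
    using lift_has_derivative[of y 0, OF yh dy] conf_pos[OF n(1)] by (simp add: y0 frame_scale n(3))
  have "L' ((1 / conf p) *\<^sub>R coframe p M) = (1 / conf (\<gamma> t)) *\<^sub>R coframe (\<gamma> t) M"
    using L'(2)[OF normal_parallel[OF \<gamma>]] by (simp add: p_def)
  moreover have "((\<lambda>h. L (y h)) has_vector_derivative L' ((1 / conf p) *\<^sub>R coframe p M)) (at 0)"
  proof -
    have d: "(L has_derivative L') (at (y 0))" using L'(1) by (simp only: y0 p_def)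
    have lin: "linear L'" using L'(1) by (rule has_derivative_linear)
    show ?thesis
      using has_derivative_compose[OF dy[unfolded has_vector_derivative_def] d]
      unfolding has_vector_derivative_def linear_cmul[OF lin] .
  qed
  ultimately have dL: "((\<lambda>h. L (y h)) has_vector_derivative (1 / conf (\<gamma> t)) *\<^sub>R coframe (\<gamma> t) M) (at 0)" by simp
  have L0: "L (y 0) = \<gamma> t" unfolding y0 p_def mv by simp
  have dlL: "((\<lambda>h. lift (L (y h))) has_vector_derivative M) (at 0)"
    using lift_has_derivative[of "\<lambda>h. L (y h)" 0, OF Lh[OF yh] dL] conf_pos[OF nt(1)]
    by (simp add: L0 frame_scale nt(3))
  have eq: "mink (lift (L x)) (lift (L (y h))) = mink (lift x) (lift (y h))" for h
    by (rule hdist_eq_imp[OF Lh[OF x] Lh[OF yh] x yh iso[OF x yh]])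
  have "((\<lambda>h. mink (lift x) (lift (y h))) has_real_derivative mink (lift (L x)) M) (at 0)"
    using has_real_derivative_mink_right[OF dlL, of "lift (L x)"] unfolding eq .
  from DERIV_unique[OF this has_real_derivative_mink_right[OF dly]]
  show "mink (lift (L x)) M = mink (lift x) M" .
qed

section \<open>Symmetry of the domain and of the solution\<close>

theorem theorem4p1:
  fixes f :: "real \<Rightarrow> real"
    and E \<C> P \<Omega> :: "'a::euclidean_space set"
    and N :: "'a \<Rightarrow> 'a"
    and u :: "'a \<Rightarrow> real"
  assumes "DIM('a) \<ge> 2"
    and "\<exists>L. L-lipschitz_on UNIV f" and "antimono f"
    and "asymptotic_equator E"
    and "asymptotic_hemisphere E \<C>"
    and "totally_geodesic_hyperplane P" and "ideal_boundary P = E"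
    and "unit_normal_field P N"
    and "C2_domain \<Omega>"
    and "ideal_boundary (hboundary \<Omega>) = E"
    and "ideal_boundary \<Omega> = \<C>"
    and "C2_upto_boundary \<Omega> u"
    and "OEP_solution f \<Omega> u"
  shows "\<exists>c. \<Omega> = equidistant_side P N \<C> c \<and>
             translating_invariant P (equidistant_side P N \<C> c) u"
proof -
  obtain M0 where M0: "mink M0 M0 = 1" "P = plane M0"
    using totally_geodesic_hyperplane_is_plane[OF assms(6)] by blast
  have Pne: "P \<noteq> {}" and Pcon: "connected P"
    using assms(6) by (auto simp: totally_geodesic_hyperplane_def)
  obtain p where p: "p \<in> P" using Pne by blast
  define T where "T = lift p"
  have pm: "p \<in> hyp" "mink (lift p) M0 = 0" using p M0(2) by (auto simp: plane_def)
  have O0: "oriented_plane M0 T"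
  proof
    show "T \<in> hyperboloid" unfolding T_def by (rule lift_hyperboloid[OF pm(1)])
    show "mink T M0 = 0" unfolding T_def by (rule pm(2))
    show "mink M0 M0 = 1" by (rule M0(1))
    show "connected (plane M0)" using Pcon M0(2) by simp
  qed
  have E: "E = ideal_boundary (plane M0)" using assms(7) M0(2) by simp
  obtain K where K: "K \<in> components (sphere 0 1 - E)" "\<C> = closure K"
    using assms(5) unfolding asymptotic_hemisphere_def by blast
  have "K = cap M0 \<or> K = cap (- M0)"
    using K(1) unfolding E oriented_plane.components_sphere[OF O0] by blast
  then obtain M where M: "K = cap M" "P = plane M" "oriented_plane M T"
  proof
    assume "K = cap M0"
    then show ?thesis using that M0(2) O0 by blast
  next
    assume "K = cap (- M0)"
    moreover have "P = plane (- M0)" by (simp add: M0(2) plane_def mink_simps)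
    ultimately show ?thesis using that oriented_plane.opposite[OF O0] by blast
  qed
  interpret op: oriented_plane M T by (rule M(3))
  have C: "\<C> = {\<xi> \<in> sphere 0 1. 0 \<le> mink (conevec \<xi>) M}" unfolding K(2) M(1) by (rule op.closure_cap)
  have E': "E = {\<xi> \<in> sphere 0 1. mink (conevec \<xi>) M = 0}"
    using op.ideal_boundary_plane assms(7) M(2) by simp
  obtain \<sigma> where \<sigma>: "\<sigma>\<^sup>2 = 1" "\<And>p. p \<in> plane M \<Longrightarrow> N p = (\<sigma> / conf p) *\<^sub>R coframe p M"
    using op.unit_normal_field_standard[of N] assms(8) unfolding M(2) by blast
  have side: "equidistant_side P N \<C> c = side M (sinh (\<sigma> * c))" for c
    unfolding M(2) C by (rule op.equidistant_side_eq) (rule \<sigma>(2))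
  obtain L where L: "L-lipschitz_on UNIV f" using assms(2) by blast
  obtain Cc \<alpha> where oep: "\<alpha> \<le> 0 \<and> (\<forall>x\<in>\<Omega>. hlaplacian u x + f (u x) = 0) \<and>
       (\<forall>x\<in>\<Omega>. u x > 0) \<and>
       bounded (u ` \<Omega>) \<and>
       (\<forall>x\<in>hboundary \<Omega>. u x = 0) \<and>
       (\<forall>\<epsilon>>0. \<exists>R. \<forall>p\<in>\<Omega>. hdist_set p (hboundary \<Omega>) > R \<longrightarrow> \<bar>u p - Cc\<bar> < \<epsilon>) \<and>
       (\<forall>p\<in>hboundary \<Omega>. \<forall>v. outward_unit_normal \<Omega> p v \<longrightarrow>
          hinner p (Lim (at p within \<Omega>) (hgrad u)) v = \<alpha>)"
    using assms(13) unfolding OEP_solution_def by (elim exE)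
  interpret eq: equator_oep f \<Omega> u M T Cc \<alpha> L
  proof
    show "0 \<le> L" by (rule lipschitz_on_nonneg[OF L])
    show "\<bar>f a - f b\<bar> \<le> L * \<bar>a - b\<bar>" for a b using lipschitz_onD[OF L, of a b] by (simp add: dist_real_def)
    show "ideal_boundary (hboundary \<Omega>) = {\<xi> \<in> sphere 0 1. mink (conevec \<xi>) M = 0}" using assms(10) E' by simp
    show "ideal_boundary \<Omega> = {\<xi> \<in> sphere 0 1. 0 \<le> mink (conevec \<xi>) M}" using assms(11) C by simp
    show "hlaplacian u x + f (u x) = 0" if "x \<in> \<Omega>" for x using oep that by blast
    show "0 < u x" if "x \<in> \<Omega>" for x using oep that by blast
    show "bounded (u ` \<Omega>)" using oep by blast
    show "u x = 0" if "x \<in> hboundary \<Omega>" for x using oep that by blast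
    show "\<exists>R. \<forall>p\<in>\<Omega>. R < hdist_set p (hboundary \<Omega>) \<longrightarrow> \<bar>u p - Cc\<bar> < \<epsilon>" if "0 < \<epsilon>" for \<epsilon>
      using oep that by blast
    show "hinner p (Lim (at p within \<Omega>) (hgrad u)) v = \<alpha>"
      if "p \<in> hboundary \<Omega>" "outward_unit_normal \<Omega> p v" for p v
      using oep that by blast
  qed (fact assms op.T op.TM op.MM)+
  obtain k where k: "\<Omega> = side M k" using eq.Omega_height unfolding side_def by blast
  define c where "c = \<sigma> * arsinh k"
  have "\<sigma> * c = arsinh k" using \<sigma>(1) by (simp add: c_def mult.assoc[symmetric] power2_eq_square)
  then have Oc: "\<Omega> = equidistant_side P N \<C> c" unfolding side k by simp
  have "translating_invariant P \<Omega> u"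
    unfolding translating_invariant_def
  proof (intro allI impI ballI, elim conjE)
    fix \<gamma> t q assume \<gamma>: "unit_speed_geodesic \<gamma>" "range \<gamma> \<subseteq> P" and q: "q \<in> \<Omega>"
    have tr: "is_hyp_translation \<gamma> t (hyp_translation \<gamma> t)"
      unfolding hyp_translation_def by (rule someI_ex[OF exists_hyp_translation[OF \<gamma>(1)]])
    have cg: "complete_geodesic \<gamma>" using \<gamma>(1) by (simp add: unit_speed_geodesic_def)
    have qh: "q \<in> hyp" using q eq.Omega(4) by blast
    note h = translation_preserves_height[OF cg \<gamma>(2)[unfolded M(2)] op.MM tr qh]
    show "u q = u (hyp_translation \<gamma> t q)" by (rule eq.same_height(2)[OF q h(1) h(2)[symmetric]])
  qed
  then show ?thesis using Oc by metis
qed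

end
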